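(* Let $(B_\gamma(t))_{t\in[0,T]}$, $\gamma\in\Gamma=\{0,\dots,P_\eta-1\}$, be the branches of a Brownian decision tree on $[0,T]$ with branching points $0<\tau_1<\dots<\tau_\eta<T$ and offspring numbers $N_1,\dots,N_\eta\ge 1$, where $P_\eta=\prod_{j=1}^\eta N_j$, and let $$\mu_0(T)=(T-\tau_\eta)+\sum_{l=1}^{\eta}(\tau_l-\tau_{l-1})\prod_{j=l}^{\eta}N_j,\qquad \tau_0=0.$$ For $c\in\mathbb{R}$ put $$\mathcal{T}(u)=\inf\{t\in[0,T]:\ \forall\,\gamma\in\Gamma:\ B_\gamma(t)-ct>u\}\qquad(\inf\varnothing=T+1).$$ Then for all $x,y\in(0,\infty)$ with $x>y$, $$\lim_{u\to\infty}\mathbb{P}\left\{u^2(T-\mathcal{T}(u))\ge x\ \middle|\ \mathcal{T}(u)\le T-y/u^2\right\}=\exp\left(-\frac{(x-y)P_\eta}{2\mu_0^2(T)}\right).$$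
   Context: Brownian decision tree. Fix $T>0$, an integer $\eta\ge 1$, deterministic branching points $0<\tau_1<\dots<\tau_\eta<T$ and integers $N_1,\dots,N_\eta\ge 1$. Conventions: $\tau_0=0$, $\tau_{\eta+1}=T$, $P_0=1$. Put $P_i=\prod_{j=1}^iN_j$, $\Gamma=\{0,1,\dots,P_\eta-1\}$, and let $i(t)=\max\{i\in\{1,\dots,\eta\}: t>\tau_i\}$ for $t>\tau_1$, $i(t)=0$ for $t\in[0,\tau_1]$. Let $B_0^*$ be a standard one-dimensional Brownian motion and, for $i=1,\dots,\eta$, let $\boldsymbol{B}_i^*$ be a standard $\mathbb{R}^{P_i}$-valued Brownian motion (independent components), all of these being mutually independent. Define $\widetilde{\boldsymbol{B}}_\Gamma(t)=B_0^*(t)$ for $t\in[0,\tau_1]$ and, recursively for $t\in(\tau_i,\tau_{i+1}]$, let $\widetilde{\boldsymbol{B}}_\Gamma(t)\in\mathbb{R}^{P_i}$ be the vector obtained by stacking $N_i$ copies of $\widetilde{\boldsymbol{B}}_\Gamma(\tau_i)\in\mathbb{R}^{P_{i-1}}$, plus $\boldsymbol{B}_i^*(t-\tau_i)$. The branch indexed by $\gamma\in\Gamma$ is $B_\gamma(t)=(\widetilde{\boldsymbol{B}}_\Gamma(t))_{(\gamma \bmod P_{i(t)})+1}$. *)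

theory Defs
  imports "HOL-Probability.Probability"
begin

text \<open>
  All paths, not only almost all, are continuous; this keeps hitting events measurable even when
  \<open>M\<close> is not complete.
\<close>

definition std_brownian_motion :: "'a measure \<Rightarrow> (real \<Rightarrow> 'a \<Rightarrow> real) \<Rightarrow> bool" where
  "std_brownian_motion M W \<longleftrightarrow>
     prob_space M \<and>
     (\<forall>t\<ge>0. W t \<in> borel_measurable M) \<and>
     (AE \<omega> in M. W 0 \<omega> = 0) \<and>
     (\<forall>\<omega>\<in>space M. continuous_on {0..} (\<lambda>t. W t \<omega>)) \<and>
     (\<forall>s t. 0 \<le> s \<and> s < t \<longrightarrow>
        distributed M lborel (\<lambda>\<omega>. W t \<omega> - W s \<omega>)
          (\<lambda>x. ennreal (normal_density 0 (sqrt (t - s)) x))) \<and>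
     (\<forall>(n::nat) t. 0 \<le> t 0 \<and> (\<forall>k<n. t k < t (Suc k)) \<longrightarrow>
        prob_space.indep_vars M (\<lambda>_. borel) (\<lambda>k \<omega>. W (t (Suc k)) \<omega> - W (t k) \<omega>) {..<n})"

definition offspring_prod :: "(nat \<Rightarrow> nat) \<Rightarrow> nat \<Rightarrow> nat" where
  "offspring_prod N i = (\<Prod>j=1..i. N j)"

text \<open>
  Vectors in dimension \<open>P\<^sub>i = offspring_prod N i\<close> are functions on \<open>{..<P\<^sub>i}\<close>: components are numbered
  from 0, and \<open>W i k\<close> is the component number \<open>k\<close> of the Brownian motion that drives the tree after
  the branching point \<open>\<tau>\<^sub>i\<close> (with \<open>\<tau>\<^sub>0 = 0\<close>, \<open>P\<^sub>0 = 1\<close>). Independence of the components of each vector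
  together with mutual independence of the vectors amounts to mutual independence of all \<open>W i k\<close>,
  seen as random paths, i.e. random elements of the product space over the time set \<open>{0..}\<close>.
\<close>

definition driving_brownian_motions ::
  "'a measure \<Rightarrow> nat \<Rightarrow> (nat \<Rightarrow> nat) \<Rightarrow> (nat \<Rightarrow> nat \<Rightarrow> real \<Rightarrow> 'a \<Rightarrow> real) \<Rightarrow> bool" where
  "driving_brownian_motions M \<eta> N W \<longleftrightarrow>
     (\<forall>i\<le>\<eta>. \<forall>k<offspring_prod N i. std_brownian_motion M (W i k)) \<and>
     prob_space.indep_vars M (\<lambda>_. Pi\<^sub>M {0..} (\<lambda>_. borel))
       (\<lambda>(i, k) \<omega>. \<lambda>t\<in>{0..}. W i k t \<omega>)
       (SIGMA i:{..\<eta>}. {..<offspring_prod N i})"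

text \<open>
  \<open>tree_vector \<tau> N W i t \<omega> k\<close> is the component number \<open>k\<close> of the state vector at a time
  \<open>t \<in> (\<tau>\<^sub>i, \<tau>\<^sub>i\<^sub>+\<^sub>1]\<close> (\<open>t \<in> [0, \<tau>\<^sub>1]\<close> for \<open>i = 0\<close>).
  The component number \<open>k\<close> of a stack of copies of a vector \<open>v\<close> of dimension \<open>p\<close> is \<open>v (k mod p)\<close>.
\<close>

primrec tree_vector ::
  "(nat \<Rightarrow> real) \<Rightarrow> (nat \<Rightarrow> nat) \<Rightarrow> (nat \<Rightarrow> nat \<Rightarrow> real \<Rightarrow> 'a \<Rightarrow> real) \<Rightarrow>
   nat \<Rightarrow> real \<Rightarrow> 'a \<Rightarrow> nat \<Rightarrow> real" where
  "tree_vector \<tau> N W 0 t \<omega> k = W 0 k t \<omega>"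
| "tree_vector \<tau> N W (Suc i) t \<omega> k =
     tree_vector \<tau> N W i (\<tau> (Suc i)) \<omega> (k mod offspring_prod N i)
     + W (Suc i) k (t - \<tau> (Suc i)) \<omega>"

definition level_at :: "nat \<Rightarrow> (nat \<Rightarrow> real) \<Rightarrow> real \<Rightarrow> nat" where
  "level_at \<eta> \<tau> t = (if t > \<tau> 1 then Max {i \<in> {1..\<eta>}. t > \<tau> i} else 0)"

definition branch ::
  "nat \<Rightarrow> (nat \<Rightarrow> real) \<Rightarrow> (nat \<Rightarrow> nat) \<Rightarrow> (nat \<Rightarrow> nat \<Rightarrow> real \<Rightarrow> 'a \<Rightarrow> real) \<Rightarrow>
   nat \<Rightarrow> real \<Rightarrow> 'a \<Rightarrow> real" where
  "branch \<eta> \<tau> N W \<gamma> t \<omega> =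
     (let i = level_at \<eta> \<tau> t in tree_vector \<tau> N W i t \<omega> (\<gamma> mod offspring_prod N i))"

definition hitting_time ::
  "real \<Rightarrow> nat \<Rightarrow> (nat \<Rightarrow> real) \<Rightarrow> (nat \<Rightarrow> nat) \<Rightarrow> (nat \<Rightarrow> nat \<Rightarrow> real \<Rightarrow> 'a \<Rightarrow> real) \<Rightarrow>
   real \<Rightarrow> real \<Rightarrow> 'a \<Rightarrow> real" where
  "hitting_time T \<eta> \<tau> N W c u \<omega> =
     (let S = {t \<in> {0..T}. \<forall>\<gamma> < offspring_prod N \<eta>. branch \<eta> \<tau> N W \<gamma> t \<omega> - c * t > u}
      in if S = {} then T + 1 else Inf S)"

definition mu0 :: "real \<Rightarrow> nat \<Rightarrow> (nat \<Rightarrow> real) \<Rightarrow> (nat \<Rightarrow> nat) \<Rightarrow> real" where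
  "mu0 T \<eta> \<tau> N = (T - \<tau> \<eta>) + (\<Sum>l=1..\<eta>. (\<tau> l - \<tau> (l - 1)) * real (\<Prod>j=l..\<eta>. N j))"

end

theory Submission
  imports Defs
begin

text \<open>
  Let \<open>P i\<close> be the number of states at level \<open>i\<close> and \<open>v0\<close> the variance of the average of all branches at time
  \<open>T\<close>, so that \<open>mu0 T \<eta> \<tau> N = P \<eta> * v0\<close>. The conditional probability is the quotient of the
  probabilities of hitting by time \<open>T - x / u\<^sup>2\<close> and by time \<open>T - y / u\<^sup>2\<close>, and these times differ by the
  delay \<open>\<delta> = (x - y) / u\<^sup>2\<close>. Neither probability is computed. Instead the first is expressed through the second by
  a change of measure, so that no Pickands-type constant appears.

  Fix a short time \<open>h\<close>. In the last level, exceedance during \<open>[h, q]\<close> (time counted from the last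
  branching point) is a functional of the states at the branching point, of the values \<open>W \<eta> k h\<close>, and of the
  later increments. Exceedance during \<open>[h + \<delta>, q + \<delta>]\<close> is the same functional with
  \<open>W \<eta> k (h + \<delta>) - c * \<delta>\<close> in place of \<open>W \<eta> k h\<close>. So only the laws \<open>N(0, h)\<close> and
  \<open>N(- c \<delta>, h + \<delta>)\<close> have to be compared (\<open>exceed_grid_change_of_measure\<close>). If \<open>W \<eta> k (h + \<delta>)\<close> is close to
  \<open>u * z\<close>, their density ratio is close to \<open>exp (- (x - y) * z\<^sup>2 / (2 * h\<^sup>2))\<close> (\<open>shift_ratio_limit\<close>).

  Given an exceedance of the high level \<open>u\<close>, each of the \<open>P \<eta>\<close> values \<open>W \<eta> k (h + \<delta>)\<close> is close to
  \<open>u * h / mu0 T \<eta> \<tau> N\<close> up to an exponentially smaller probability (\<open>late_deviation_bound\<close>). The product of the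
  ratios is then close to \<open>exp (- (x - y) * P \<eta> / (2 * (mu0 T \<eta> \<tau> N)\<^sup>2))\<close>, the claimed limit.

  Everything else is needed only on the scale of \<open>exp (- u\<^sup>2 / (2 * v0))\<close>. If all branches exceed a
  level, so does their average; a maximal inequality of Levy type (\<open>passage_bound\<close>) and Chernoff bounds
  show that the deviations above, and exceedances before the last level or shortly after its start
  (\<open>exceed_early_bound\<close>), decay at a strictly faster Gaussian rate, whereas \<open>level_lower_bound\<close> shows that
  the hitting probability itself has the rate \<open>1 / (2 * v0)\<close> at most. Events on
  dyadic grids involve finitely many independent Gaussian increments only; continuity of the paths then
  allows the grids to be refined.
\<close>

section \<open>Independent families and Gaussian variables\<close>

text \<open>
  A rectangle in the coordinates \<open>(a, b)\<close> is an intersection over \<open>a\<close> of preimages under \<open>Z a\<close>, so its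
  probability factors first over \<open>a\<close> and then, inside each \<open>Z a\<close>, over \<open>b\<close>. This turns independent
  processes with independent increments into one independent family of increments.
\<close>

lemma (in prob_space) indep_vars_Sigma:
  assumes Z: "indep_vars N Z A" and A: "finite A" "\<And>a. a \<in> A \<Longrightarrow> finite (B a)"
    and f: "\<And>a b. a \<in> A \<Longrightarrow> b \<in> B a \<Longrightarrow> f a b \<in> measurable (N a) K"
    and ind: "\<And>a. a \<in> A \<Longrightarrow> indep_vars (\<lambda>_. K) (\<lambda>b \<omega>. f a b (Z a \<omega>)) (B a)"
  shows "indep_vars (\<lambda>_. K) (\<lambda>(a, b) \<omega>. f a b (Z a \<omega>)) (Sigma A B)"
proof (cases "Sigma A B = {}")
  case True
  then show ?thesis by (simp add: indep_vars_def2 indep_sets_def)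
next
  case False
  have rvZ: "random_variable (N a) (Z a)" if "a \<in> A" for a
    using Z that by (auto simp: indep_vars_def2)
  have rv: "random_variable K (\<lambda>\<omega>. f a b (Z a \<omega>))" if "a \<in> A" "b \<in> B a" for a b
    using measurable_compose[OF rvZ f] that by blast
  define A0 where "A0 = {a \<in> A. B a \<noteq> {}}"
  have A0: "finite A0" "A0 \<noteq> {}" "A0 \<subseteq> A" "Sigma A0 B = Sigma A B"
    using A False by (auto simp: A0_def)
  have main: "prob (\<Inter>p\<in>Sigma A B. (case p of (a, b) \<Rightarrow> \<lambda>\<omega>. f a b (Z a \<omega>)) -` C p \<inter> space M)
      = (\<Prod>p\<in>Sigma A B. prob ((case p of (a, b) \<Rightarrow> \<lambda>\<omega>. f a b (Z a \<omega>)) -` C p \<inter> space M))"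
    if C: "C \<in> (\<Pi> p\<in>Sigma A B. sets K)" for C
  proof -
    (* The event that all coordinates (a, b) fall into C (a, b), as a set of values of Z a. *)
    define D where "D a = {z \<in> space (N a). \<forall>b\<in>B a. f a b z \<in> C (a, b)}" for a
    have D: "D a \<in> sets (N a)" if "a \<in> A" for a
    proof -
      have "{z \<in> space (N a). f a b z \<in> C (a, b)} \<in> sets (N a)" if "b \<in> B a" for b
        using measurable_sets[OF f[OF \<open>a \<in> A\<close> that], of "C (a, b)"] C \<open>a \<in> A\<close> that
        by (auto simp: vimage_def Int_def conj_commute)
      then show ?thesis
        unfolding D_def using A(2)[OF that] by (intro sets.sets_Collect_finite_All) auto
    qed
    have "(\<Inter>p\<in>Sigma A B. (case p of (a, b) \<Rightarrow> \<lambda>\<omega>. f a b (Z a \<omega>)) -` C p \<inter> space M)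
        = (\<Inter>a\<in>A0. Z a -` D a \<inter> space M)"
    proof -
      have "Z a \<omega> \<in> space (N a)" if "a \<in> A" "\<omega> \<in> space M" for a \<omega>
        using measurable_space[OF rvZ] that by blast
      then show ?thesis
        using A0(2) unfolding D_def A0_def set_eq_iff by (auto split: prod.splits)
    qed
    then have "prob (\<Inter>p\<in>Sigma A B. (case p of (a, b) \<Rightarrow> \<lambda>\<omega>. f a b (Z a \<omega>)) -` C p \<inter> space M)
        = (\<Prod>a\<in>A0. prob (Z a -` D a \<inter> space M))"
      using indep_varsD[OF Z A0(2,1,3), of D] D A0(3) by (simp only: subset_iff)
    also have "\<dots> = (\<Prod>a\<in>A0. \<Prod>b\<in>B a. prob ((\<lambda>\<omega>. f a b (Z a \<omega>)) -` C (a, b) \<inter> space M))"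
    proof (rule prod.cong)
      fix a assume a: "a \<in> A0"
      then have "Z a -` D a \<inter> space M = (\<Inter>b\<in>B a. (\<lambda>\<omega>. f a b (Z a \<omega>)) -` C (a, b) \<inter> space M)"
        using measurable_space[OF rvZ, of a] A0 by (auto simp: D_def A0_def)
      moreover have "a \<in> A" "B a \<noteq> {}" "finite (B a)" "\<And>b. b \<in> B a \<Longrightarrow> C (a, b) \<in> sets K"
        using a A C by (auto simp: A0_def)
      moreover from this have "prob (\<Inter>b\<in>B a. (\<lambda>\<omega>. f a b (Z a \<omega>)) -` C (a, b) \<inter> space M)
          = (\<Prod>b\<in>B a. prob ((\<lambda>\<omega>. f a b (Z a \<omega>)) -` C (a, b) \<inter> space M))"
        by (intro indep_varsD_finite[OF ind]) auto
      ultimately show "prob (Z a -` D a \<inter> space M)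
          = (\<Prod>b\<in>B a. prob ((\<lambda>\<omega>. f a b (Z a \<omega>)) -` C (a, b) \<inter> space M))"
        by (simp only:)
    qed simp
    also have "\<dots> = (\<Prod>p\<in>Sigma A B. prob ((case p of (a, b) \<Rightarrow> \<lambda>\<omega>. f a b (Z a \<omega>)) -` C p \<inter> space M))"
      unfolding A0(4)[symmetric] using A A0
      by (subst prod.Sigma) (auto intro!: prod.cong)
    finally show ?thesis .
  qed
  show ?thesis
    by (subst indep_vars_finite[where E="\<lambda>_. sets K"])
       (use A False main rv in \<open>auto simp: sets.sigma_sets_eq Int_stable_def sets.space_closed
          split: prod.split\<close>)
qed

text \<open>
  The combinatorial core of Levy's maximal inequality. The events \<open>disjointed A j\<close> (\<open>A j\<close> is the first
  to occur) are disjoint, and each of them leads to \<open>E\<close> whenever the continuation \<open>F j\<close> happens.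
\<close>

lemma (in prob_space) first_passage_bound:
  fixes A F :: "nat \<Rightarrow> 'a set"
  assumes ev: "\<And>j. j < n \<Longrightarrow> A j \<in> events" "\<And>j. j < n \<Longrightarrow> F j \<in> events" "E \<in> events"
    and sub: "\<And>j. j < n \<Longrightarrow> A j \<inter> F j \<subseteq> E"
    and q: "\<And>j. j < n \<Longrightarrow> q * prob (disjointed A j) \<le> prob (disjointed A j \<inter> F j)"
  shows "q * prob (\<Union>j<n. A j) \<le> prob E"
proof -
  have d: "disjointed A j \<in> events" if "j < n" for j
    unfolding disjointed_def using ev that by (intro sets.Diff sets.finite_UN) auto
  have "(\<Union>j<n. A j) = (\<Union>j<n. disjointed A j)"
    by (simp add: finite_UN_disjointed_eq lessThan_atLeast0)
  moreover have "prob (\<Union>j<n. disjointed A j) = (\<Sum>j<n. prob (disjointed A j))"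
    by (rule finite_measure_finite_Union)
       (use d disjoint_family_disjointed in \<open>auto intro: disjoint_family_on_mono\<close>)
  ultimately have "q * prob (\<Union>j<n. A j) = (\<Sum>j<n. q * prob (disjointed A j))"
    by (simp add: sum_distrib_left)
  also have "\<dots> \<le> (\<Sum>j<n. prob (disjointed A j \<inter> F j))"
    by (intro sum_mono q) auto
  also have "\<dots> = prob (\<Union>j<n. disjointed A j \<inter> F j)"
    by (rule finite_measure_finite_Union[symmetric])
       (use d ev disjoint_family_disjointed[of A] in \<open>auto simp: disjoint_family_on_def disjoint_iff\<close>)
  also have "\<dots> \<le> prob E"
    by (rule finite_measure_mono) (use sub disjointed_subset[of A] ev in fastforce)+
  finally show ?thesis .
qed

lemma PiM_density:
  assumes I: "finite I" and D: "\<And>i. prob_space (D i)"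
    and r: "\<And>i. i \<in> I \<Longrightarrow> r i \<in> borel_measurable (D i)"
    and Q: "\<And>i. prob_space (density (D i) (r i))"
  shows "Pi\<^sub>M I (\<lambda>i. density (D i) (r i)) = density (Pi\<^sub>M I D) (\<lambda>v. \<Prod>i\<in>I. r i (v i))"
proof -
  interpret D: product_prob_space D I by (simp add: product_prob_spaceI D)
  interpret Q: product_prob_space "\<lambda>i. density (D i) (r i)" I by (simp add: product_prob_spaceI Q)
  have m: "(\<lambda>v. \<Prod>i\<in>I. r i (v i)) \<in> borel_measurable (Pi\<^sub>M I D)"
    by (rule borel_measurable_prod_ennreal) (auto intro!: measurable_compose[OF measurable_component_singleton] r)
  show ?thesis
  proof (rule Q.PiM_eqI[symmetric, OF I])
    show "sets (density (Pi\<^sub>M I D) (\<lambda>v. \<Prod>i\<in>I. r i (v i))) = sets (Pi\<^sub>M I (\<lambda>i. density (D i) (r i)))"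
      by (simp cong: sets_PiM_cong)
  next
    fix A assume "\<And>i. i \<in> I \<Longrightarrow> A i \<in> sets (density (D i) (r i))"
    then have A: "\<And>i. i \<in> I \<Longrightarrow> A i \<in> sets (D i)" by simp
    have "emeasure (density (Pi\<^sub>M I D) (\<lambda>v. \<Prod>i\<in>I. r i (v i))) (Pi\<^sub>E I A)
        = (\<integral>\<^sup>+v. (\<Prod>i\<in>I. r i (v i)) * indicator (Pi\<^sub>E I A) v \<partial>Pi\<^sub>M I D)"
      using A I m by (subst emeasure_density) (auto intro: sets_PiM_I_finite)
    also have "\<dots> = (\<integral>\<^sup>+v. (\<Prod>i\<in>I. r i (v i) * indicator (A i) (v i)) \<partial>Pi\<^sub>M I D)"
    proof (rule nn_integral_cong)
      fix v assume v: "v \<in> space (Pi\<^sub>M I D)"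
      have "indicator (Pi\<^sub>E I A) v = (\<Prod>i\<in>I. indicator (A i) (v i) :: ennreal)"
        using v I by (auto simp: space_PiM PiE_def Pi_def indicator_def intro!: prod.neutral prod_zero[symmetric])
      then show "(\<Prod>i\<in>I. r i (v i)) * indicator (Pi\<^sub>E I A) v = (\<Prod>i\<in>I. r i (v i) * indicator (A i) (v i))"
        by (simp add: prod.distrib)
    qed
    also have "\<dots> = (\<Prod>i\<in>I. \<integral>\<^sup>+x. r i x * indicator (A i) x \<partial>D i)"
      using I A r by (intro D.product_nn_integral_prod borel_measurable_times_ennreal borel_measurable_indicator) auto
    also have "\<dots> = (\<Prod>i\<in>I. emeasure (density (D i) (r i)) (A i))"
      using A r by (intro prod.cong refl) (simp add: emeasure_density)
    finally show "emeasure (density (Pi\<^sub>M I D) (\<lambda>v. \<Prod>i\<in>I. r i (v i))) (Pi\<^sub>E I A)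
        = (\<Prod>i\<in>I. emeasure (density (D i) (r i)) (A i))" .
  qed
qed

text \<open>
  The law of an independent family is a product, so the one-dimensional likelihood ratios multiply: a
  finite-dimensional Cameron-Martin-Girsanov formula.
\<close>

lemma (in prob_space) indep_change_of_measure:
  fixes f g r :: "'i \<Rightarrow> real \<Rightarrow> real"
  assumes I: "finite I" "I \<noteq> {}"
    and X: "indep_vars (\<lambda>_. borel) X I" "\<And>p. p \<in> I \<Longrightarrow> distributed M lborel (X p) (f p)"
    and Y: "indep_vars (\<lambda>_. borel) Y I" "\<And>p. p \<in> I \<Longrightarrow> distributed M lborel (Y p) (g p)"
    and r[measurable]: "\<And>p. r p \<in> borel_measurable borel"
    and fg: "\<And>p x. p \<in> I \<Longrightarrow> f p x = r p x * g p x" and nn: "\<And>p x. 0 \<le> r p x" "\<And>p x. p \<in> I \<Longrightarrow> 0 \<le> g p x"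
    and S: "S \<in> sets (Pi\<^sub>M I (\<lambda>_. borel))"
  shows "emeasure M {\<omega> \<in> space M. (\<lambda>p\<in>I. X p \<omega>) \<in> S}
     = (\<integral>\<^sup>+\<omega>. ennreal (\<Prod>p\<in>I. r p (Y p \<omega>)) * indicator {\<omega> \<in> space M. (\<lambda>p\<in>I. Y p \<omega>) \<in> S} \<omega> \<partial>M)"
proof -
  obtain p0 where p0: "p0 \<in> I" using I by auto
  (* Extending the marginals by the one at p0 makes every factor a probability space. *)
  define sel where "sel p = (if p \<in> I then p else p0)" for p
  have sel: "sel p \<in> I" "p \<in> I \<Longrightarrow> sel p = p" for p using p0 by (auto simp: sel_def)
  have rvX: "\<And>p. p \<in> I \<Longrightarrow> random_variable borel (X p)" and rvY: "\<And>p. p \<in> I \<Longrightarrow> random_variable borel (Y p)"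
    using X Y by (auto simp: indep_vars_def2)
  define D where "D p = distr M borel (Y (sel p))" for p
  have D: "prob_space (D p)" for p unfolding D_def by (rule prob_space_distr) (rule rvY[OF sel(1)])
  have setsD: "sets (D p) = sets borel" for p by (simp add: D_def)
  have fm: "distr M borel (X p) = density (D p) (r p)" if "p \<in> I" for p
  proof -
    have "distr M borel (X p) = distr M lborel (X p)" by (rule distr_cong) auto
    also have "\<dots> = density lborel (f p)" using X(2)[OF that] by (rule distributed_distr_eq_density)
    also have "\<dots> = density (density lborel (g p)) (r p)"
    proof (subst density_density_eq)
      show "(\<lambda>x. ennreal (g p x)) \<in> borel_measurable lborel"
        using Y(2)[OF that] by (rule distributed_borel_measurable)
      show "density lborel (\<lambda>x. ennreal (f p x)) = density lborel (\<lambda>x. ennreal (g p x) * ennreal (r p x))"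
        using fg nn that by (simp add: ennreal_mult mult.commute)
    qed simp
    also have "density lborel (g p) = distr M lborel (Y p)"
      using distributed_distr_eq_density[OF Y(2)[OF that]] by simp
    also have "\<dots> = D p" unfolding D_def sel(2)[OF that] by (rule distr_cong) auto
    finally show ?thesis .
  qed
  have Q: "prob_space (density (D p) (r (sel p)))" for p
  proof -
    have "density (D p) (r (sel p)) = distr M borel (X (sel p))"
      using fm[OF sel(1), of p] sel by (simp add: D_def)
    then show ?thesis using prob_space_distr[OF rvX[OF sel(1)], of p] by simp
  qed
  have YI: "(\<lambda>\<omega>. \<lambda>p\<in>I. Y p \<omega>) \<in> measurable M (Pi\<^sub>M I (\<lambda>_. borel))"
    and XI: "(\<lambda>\<omega>. \<lambda>p\<in>I. X p \<omega>) \<in> measurable M (Pi\<^sub>M I (\<lambda>_. borel))"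
    using rvX rvY by (simp_all add: measurable_restrict)
  have rm: "(\<lambda>v. \<Prod>p\<in>I. ennreal (r p (v p))) \<in> borel_measurable (Pi\<^sub>M I (\<lambda>_. borel))"
    by measurable
  have "distr M (Pi\<^sub>M I (\<lambda>_. borel)) (\<lambda>\<omega>. \<lambda>p\<in>I. X p \<omega>) = Pi\<^sub>M I (\<lambda>p. distr M borel (X p))"
    using X rvX I by (subst indep_vars_iff_distr_eq_PiM'[symmetric]) auto
  also have "\<dots> = Pi\<^sub>M I (\<lambda>p. density (D p) (r (sel p)))"
    by (rule PiM_cong) (auto simp: fm sel)
  also have "\<dots> = density (Pi\<^sub>M I D) (\<lambda>v. \<Prod>p\<in>I. ennreal (r (sel p) (v p)))"
    using I by (intro PiM_density D Q) (auto simp: measurable_cong_sets[OF setsD refl])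
  also have "\<dots> = density (Pi\<^sub>M I D) (\<lambda>v. \<Prod>p\<in>I. ennreal (r p (v p)))"
    using sel by (intro arg_cong2[where f=density] refl ext prod.cong) auto
  also have "Pi\<^sub>M I D = Pi\<^sub>M I (\<lambda>p. distr M borel (Y p))"
    by (rule PiM_cong) (auto simp: D_def sel)
  also have "\<dots> = distr M (Pi\<^sub>M I (\<lambda>_. borel)) (\<lambda>\<omega>. \<lambda>p\<in>I. Y p \<omega>)"
    using indep_vars_iff_distr_eq_PiM'[OF I(2), of Y "\<lambda>_. borel"] rvY Y(1) by simp
  finally have eq: "distr M (Pi\<^sub>M I (\<lambda>_. borel)) (\<lambda>\<omega>. \<lambda>p\<in>I. X p \<omega>)
    = density (distr M (Pi\<^sub>M I (\<lambda>_. borel)) (\<lambda>\<omega>. \<lambda>p\<in>I. Y p \<omega>)) (\<lambda>v. \<Prod>p\<in>I. ennreal (r p (v p)))" .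
  have "emeasure M {\<omega> \<in> space M. (\<lambda>p\<in>I. X p \<omega>) \<in> S}
      = emeasure (distr M (Pi\<^sub>M I (\<lambda>_. borel)) (\<lambda>\<omega>. \<lambda>p\<in>I. X p \<omega>)) S"
    using S XI by (subst emeasure_distr) (auto intro!: arg_cong[where f="emeasure M"])
  also have "\<dots> = (\<integral>\<^sup>+v. (\<Prod>p\<in>I. ennreal (r p (v p))) * indicator S v
      \<partial>distr M (Pi\<^sub>M I (\<lambda>_. borel)) (\<lambda>\<omega>. \<lambda>p\<in>I. Y p \<omega>))"
    unfolding eq using S rm by (subst emeasure_density) auto
  also have "\<dots> = (\<integral>\<^sup>+\<omega>. (\<Prod>p\<in>I. ennreal (r p (Y p \<omega>))) * indicator S (\<lambda>p\<in>I. Y p \<omega>) \<partial>M)"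
    using YI S rm by (subst nn_integral_distr) (auto intro!: nn_integral_cong)
  also have "\<dots> = (\<integral>\<^sup>+\<omega>. ennreal (\<Prod>p\<in>I. r p (Y p \<omega>)) * indicator {\<omega> \<in> space M. (\<lambda>p\<in>I. Y p \<omega>) \<in> S} \<omega> \<partial>M)"
    using nn by (intro nn_integral_cong) (auto simp: prod_ennreal indicator_def)
  finally show ?thesis .
qed

lemma normal_density_exp_tilt:
  assumes "0 < \<sigma>"
  shows "exp (a * x) * normal_density 0 \<sigma> x = exp (a\<^sup>2 * \<sigma>\<^sup>2 / 2) * normal_density (a * \<sigma>\<^sup>2) \<sigma> x"
proof -
  have "a * x + - x\<^sup>2 / (2 * \<sigma>\<^sup>2) = a\<^sup>2 * \<sigma>\<^sup>2 / 2 + - (x - a * \<sigma>\<^sup>2)\<^sup>2 / (2 * \<sigma>\<^sup>2)"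
    using assms by (simp add: field_simps power2_eq_square)
  then show ?thesis
    by (simp add: normal_density_def exp_add[symmetric])
qed

lemma (in prob_space) nn_integral_exp_normal:
  assumes X: "distributed M lborel X (normal_density 0 \<sigma>)" and \<sigma>: "0 < \<sigma>"
  shows "(\<integral>\<^sup>+\<omega>. ennreal (exp (a * X \<omega>)) \<partial>M) = ennreal (exp (a\<^sup>2 * \<sigma>\<^sup>2 / 2))"
proof -
  have "(\<integral>\<^sup>+\<omega>. ennreal (exp (a * X \<omega>)) \<partial>M) = (\<integral>\<^sup>+x. normal_density 0 \<sigma> x * ennreal (exp (a * x)) \<partial>lborel)"
    by (rule distributed_nn_integral[OF X, symmetric]) simp
  also have "\<dots> = (\<integral>\<^sup>+x. ennreal (exp (a\<^sup>2 * \<sigma>\<^sup>2 / 2)) * normal_density (a * \<sigma>\<^sup>2) \<sigma> x \<partial>lborel)"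
    using normal_density_exp_tilt[OF \<sigma>, of a]
    by (intro nn_integral_cong) (simp add: ennreal_mult[symmetric] mult.commute)
  also have "\<dots> = ennreal (exp (a\<^sup>2 * \<sigma>\<^sup>2 / 2)) * (\<integral>\<^sup>+x. normal_density (a * \<sigma>\<^sup>2) \<sigma> x \<partial>lborel)"
    by (rule nn_integral_cmult) simp
  also have "(\<integral>\<^sup>+x. normal_density (a * \<sigma>\<^sup>2) \<sigma> x \<partial>lborel) = 1"
    using \<sigma> by (subst nn_integral_eq_integral) auto
  finally show ?thesis by simp
qed

text \<open>
  Exponential Markov inequality; by independence the moment generating function factorises. Going
  through the moment generating function rather than the law of the sum allows vanishing coefficients.
\<close>

lemma (in prob_space) normal_chernoff:
  assumes I: "finite I" and X: "indep_vars (\<lambda>_. borel) X I"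
    and N: "\<And>p. p \<in> I \<Longrightarrow> distributed M lborel (X p) (normal_density 0 (\<sigma> p))"
    and \<sigma>: "\<And>p. p \<in> I \<Longrightarrow> 0 < \<sigma> p"
  shows "prob {\<omega> \<in> space M. r \<le> (\<Sum>p\<in>I. a p * X p \<omega>)} \<le> exp ((\<Sum>p\<in>I. (a p)\<^sup>2 * (\<sigma> p)\<^sup>2) / 2 - r)"
proof -
  have rv[measurable]: "\<And>p. p \<in> I \<Longrightarrow> random_variable borel (X p)" using X by (auto simp: indep_vars_def2)
  have "indep_vars (\<lambda>_. borel) (\<lambda>p \<omega>. ennreal (exp (a p * X p \<omega>))) I"
    using indep_vars_compose2[OF X, of "\<lambda>p x. ennreal (exp (a p * x))" "\<lambda>_. borel"] by simp
  from indep_vars_nn_integral[OF I this]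
  have E: "(\<integral>\<^sup>+\<omega>. (\<Prod>p\<in>I. ennreal (exp (a p * X p \<omega>))) \<partial>M) = (\<Prod>p\<in>I. ennreal (exp ((a p)\<^sup>2 * (\<sigma> p)\<^sup>2 / 2)))"
    using nn_integral_exp_normal[OF N \<sigma>] by simp
  have "emeasure M {\<omega> \<in> space M. r \<le> (\<Sum>p\<in>I. a p * X p \<omega>)}
      = (\<integral>\<^sup>+\<omega>. indicator {\<omega> \<in> space M. r \<le> (\<Sum>p\<in>I. a p * X p \<omega>)} \<omega> \<partial>M)"
    by (rule nn_integral_indicator[symmetric]) measurable
  also have "\<dots> \<le> (\<integral>\<^sup>+\<omega>. ennreal (exp (- r)) * (\<Prod>p\<in>I. ennreal (exp (a p * X p \<omega>))) \<partial>M)"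
    by (intro nn_integral_mono)
       (auto simp: indicator_def prod_ennreal exp_sum[OF I, symmetric] ennreal_mult[symmetric]
          exp_add[symmetric] simp flip: ennreal_1 intro!: ennreal_leI)
  also have "\<dots> = ennreal (exp (- r)) * (\<Prod>p\<in>I. ennreal (exp ((a p)\<^sup>2 * (\<sigma> p)\<^sup>2 / 2)))"
    unfolding E[symmetric] by (intro nn_integral_cmult) measurable
  also have "\<dots> = ennreal (exp ((\<Sum>p\<in>I. (a p)\<^sup>2 * (\<sigma> p)\<^sup>2) / 2 - r))"
    by (simp add: prod_ennreal exp_sum[OF I, symmetric] ennreal_mult[symmetric] exp_add[symmetric]
        sum_divide_distrib exp_diff exp_minus field_simps)
  finally show ?thesis by (simp add: emeasure_eq_measure)
qed

lemma (in prob_space) normal_ge_0_prob: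
  assumes X: "distributed M lborel X (normal_density 0 \<sigma>)" and \<sigma>: "0 < \<sigma>"
  shows "1 / 2 \<le> prob {\<omega> \<in> space M. 0 \<le> X \<omega>}"
proof -
  have [measurable]: "random_variable borel X" using distributed_measurable[OF X] by simp
  have X': "distributed M lborel (\<lambda>\<omega>. - X \<omega>) (normal_density 0 \<sigma>)"
    using normal_density_affine[OF X \<sigma>, of "-1" 0] by simp
  have "emeasure M {\<omega> \<in> space M. 0 \<le> - X \<omega>} = emeasure M {\<omega> \<in> space M. 0 \<le> X \<omega>}"
    using distributed_emeasure[OF X', of "{0..}"] distributed_emeasure[OF X, of "{0..}"]
    by (auto simp: vimage_def Int_def conj_commute)
  then have "prob {\<omega> \<in> space M. 0 \<le> - X \<omega>} = prob {\<omega> \<in> space M. 0 \<le> X \<omega>}"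
    by (simp add: measure_def)
  moreover have "prob ({\<omega> \<in> space M. 0 \<le> - X \<omega>} \<union> {\<omega> \<in> space M. 0 \<le> X \<omega>}) = 1"
    by (subst prob_space[symmetric]) (rule arg_cong[where f=prob], auto)
  moreover have "prob ({\<omega> \<in> space M. 0 \<le> - X \<omega>} \<union> {\<omega> \<in> space M. 0 \<le> X \<omega>})
     \<le> prob {\<omega> \<in> space M. 0 \<le> - X \<omega>} + prob {\<omega> \<in> space M. 0 \<le> X \<omega>}"
    by (rule measure_Un_le) measurable
  ultimately show ?thesis by linarith
qed

text \<open>
  On an interval of length \<open>\<sigma>\<close> to the right of \<open>r\<close> the density is at least its value at \<open>r + \<sigma>\<close>.
\<close>

lemma (in prob_space) normal_tail_lower:
  assumes X: "distributed M lborel X (normal_density 0 \<sigma>)" and \<sigma>: "0 < \<sigma>" and r: "0 \<le> r"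
  shows "exp (- (r / \<sigma> + 1)\<^sup>2 / 2) / sqrt (2 * pi) \<le> prob {\<omega> \<in> space M. r < X \<omega>}"
proof -
  define k where "k = exp (- (r / \<sigma> + 1)\<^sup>2 / 2) / sqrt (2 * pi)"
  have k: "k / \<sigma> \<le> normal_density 0 \<sigma> x" if "x \<in> {r<..<r + \<sigma>}" for x
  proof -
    have "(x / \<sigma>)\<^sup>2 \<le> (r / \<sigma> + 1)\<^sup>2"
      using that r \<sigma> by (intro power_mono) (auto simp: field_simps)
    then have "x\<^sup>2 / (2 * \<sigma>\<^sup>2) \<le> (r / \<sigma> + 1)\<^sup>2 / 2"
      by (simp add: power_divide)
    then have "exp (- (r / \<sigma> + 1)\<^sup>2 / 2) \<le> exp (- x\<^sup>2 / (2 * \<sigma>\<^sup>2))"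
      by simp
    then have "exp (- (r / \<sigma> + 1)\<^sup>2 / 2) / (sqrt (2 * pi) * \<sigma>) \<le> exp (- x\<^sup>2 / (2 * \<sigma>\<^sup>2)) / (sqrt (2 * pi) * \<sigma>)"
      using \<sigma> by (intro divide_right_mono) auto
    then show ?thesis
      using \<sigma> by (simp add: k_def normal_density_def real_sqrt_mult)
  qed
  have "ennreal k = ennreal (k / \<sigma>) * emeasure lborel {r<..<r + \<sigma>}"
    using \<sigma> by (simp add: k_def ennreal_mult'[symmetric])
  also have "\<dots> = (\<integral>\<^sup>+x. ennreal (k / \<sigma>) * indicator {r<..<r + \<sigma>} x \<partial>lborel)"
    by (rule nn_integral_cmult_indicator[symmetric]) simp
  also have "\<dots> \<le> (\<integral>\<^sup>+x. ennreal (normal_density 0 \<sigma> x) * indicator {r<..} x \<partial>lborel)"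
    using k by (intro nn_integral_mono) (auto simp: indicator_def intro!: ennreal_leI)
  also have "\<dots> = emeasure M {\<omega> \<in> space M. r < X \<omega>}"
    using distributed_emeasure[OF X, of "{r<..}"] by (auto simp: vimage_def Int_def conj_commute)
  finally show ?thesis by (simp add: emeasure_eq_measure k_def)
qed

section \<open>Dyadic grids\<close>

lemma continuous_pos_nhd:
  fixes f :: "'k \<Rightarrow> real \<Rightarrow> real"
  assumes K: "finite K" and f: "\<And>k. k \<in> K \<Longrightarrow> continuous_on {0..} (f k)"
    and s: "0 < s" and pos: "\<And>k. k \<in> K \<Longrightarrow> 0 < f k s"
  obtains e where "0 < e" "\<And>r. \<bar>r - s\<bar> < e \<Longrightarrow> 0 < r \<and> (\<forall>k\<in>K. 0 < f k r)"
proof -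
  have "\<forall>\<^sub>F r in nhds s. \<forall>k\<in>K. 0 < f k r"
  proof (intro eventually_ball_finite[OF K] ballI)
    fix k assume k: "k \<in> K"
    have "isCont (f k) s"
      by (rule continuous_on_interior[OF f[OF k]]) (simp add: s)
    then have "filterlim (f k) (nhds (f k s)) (nhds s)"
      using continuous_at tendsto_nhds_iff by blast
    then show "\<forall>\<^sub>F r in nhds s. 0 < f k r"
      using order_tendstoD(1) pos[OF k] by blast
  qed
  moreover have "\<forall>\<^sub>F r in nhds s. 0 < r"
    using eventually_nhds_in_open[of "{0<..}" s] s by simp
  ultimately have "\<forall>\<^sub>F r in nhds s. 0 < r \<and> (\<forall>k\<in>K. 0 < f k r)"
    by (rule eventually_conj[rotated])
  then show ?thesis
    using that unfolding eventually_nhds_metric dist_real_def by blast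
qed

text \<open>
  The factor \<open>2 ^ n\<close> makes the grids nested in \<open>n\<close>, so that exceedance events on them increase.
\<close>

definition dyadic :: "real \<Rightarrow> real \<Rightarrow> nat \<Rightarrow> nat \<Rightarrow> real" where
  "dyadic p q n j = p + real j * ((q - p) / 2 ^ n)"

lemma dyadic_Suc: "dyadic p q (Suc n) (2 * j) = dyadic p q n j"
  by (simp add: dyadic_def)

lemma dyadic_in:
  assumes "p < q" "1 \<le> j" "j < 2 ^ n"
  shows "dyadic p q n j \<in> {p<..<q}"
proof -
  have "real j < 2 ^ n" using assms(3) by (metis of_nat_less_iff of_nat_numeral of_nat_power)
  then have "real j * (q - p) < 2 ^ n * (q - p)" using assms by simp
  then show ?thesis using assms by (simp add: dyadic_def field_simps)
qed

lemma dyadic_dense: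
  assumes s: "p < s" "s < q" and e: "0 < e"
  obtains n j where "1 \<le> j" "j < 2 ^ n" "\<bar>dyadic p q n j - s\<bar> < e"
proof -
  define m where "m = min e (s - p)"
  have m: "0 < m" using assms by (simp add: m_def)
  obtain n where "(q - p) / m < 2 ^ n" using real_arch_pow[of 2 "(q - p) / m"] by auto
  then have n: "(q - p) / 2 ^ n < m" using m by (simp add: field_simps)
  define d where "d = (q - p) / 2 ^ n"
  have d: "0 < d" "d < e" "d < s - p" "2 ^ n * d = q - p" using n assms by (auto simp: d_def m_def)
  define j where "j = nat \<lfloor>(s - p) / d\<rfloor>"
  have j: "real j \<le> (s - p) / d" "(s - p) / d < real j + 1"
    using d by (auto simp: j_def)
  have "real j * d \<le> s - p" "s - p < real j * d + d"
    using j d by (auto simp: field_simps)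
  moreover have "1 \<le> j"
    using d by (simp add: j_def le_nat_iff le_floor_iff)
  moreover have "j < 2 ^ n"
  proof -
    have "real j * d < 2 ^ n * d" using \<open>real j * d \<le> s - p\<close> s d by linarith
    then have "real j < 2 ^ n" by (rule mult_right_less_imp_less) (use d in simp)
    then show ?thesis by (metis of_nat_less_iff of_nat_numeral of_nat_power)
  qed
  ultimately show ?thesis
    using d by (intro that[of j n]) (auto simp: dyadic_def d_def[symmetric])
qed

lemma offspring_prod_0: "offspring_prod N 0 = 1"
  by (simp add: offspring_prod_def)

lemma offspring_prod_dvd: "l \<le> i \<Longrightarrow> offspring_prod N l dvd offspring_prod N i"
  unfolding offspring_prod_def by (intro prod_dvd_prod_subset) auto

section \<open>Paths of the tree and the hitting time\<close>

locale brownian_tree = prob_space M for M :: "'a measure" +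
  fixes T c :: real and \<eta> :: nat and \<tau> :: "nat \<Rightarrow> real" and N :: "nat \<Rightarrow> nat"
    and W :: "nat \<Rightarrow> nat \<Rightarrow> real \<Rightarrow> 'a \<Rightarrow> real"
  assumes eta: "1 \<le> \<eta>" and tau0: "\<tau> 0 = 0" and tau_Suc: "\<And>i. i < \<eta> \<Longrightarrow> \<tau> i < \<tau> (Suc i)"
    and tau_T: "\<tau> \<eta> < T" and N_pos: "\<And>i. i \<in> {1..\<eta>} \<Longrightarrow> 1 \<le> N i"
    and driving: "driving_brownian_motions M \<eta> N W"
begin

abbreviation P :: "nat \<Rightarrow> nat" where "P \<equiv> offspring_prod N"

definition len :: "nat \<Rightarrow> real" where "len l = \<tau> (Suc l) - \<tau> l"

text \<open>
  The recursion of the tree unfolded: \<open>s\<close> is the time since the branching point \<open>\<tau> i\<close>, and the sum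
  collects the completed segments of the ancestors of component \<open>k\<close>.
\<close>

definition state :: "nat \<Rightarrow> nat \<Rightarrow> real \<Rightarrow> 'a \<Rightarrow> real" where
  "state i k s \<omega> = (\<Sum>l<i. W l (k mod P l) (len l) \<omega>) + W i k s \<omega>"

lemma P_pos: "i \<le> \<eta> \<Longrightarrow> 0 < P i"
  using N_pos by (auto simp: offspring_prod_def Suc_le_eq intro!: prod_pos)

lemma P_le: "l \<le> i \<Longrightarrow> i \<le> \<eta> \<Longrightarrow> P l \<le> P i"
  using offspring_prod_dvd[of l i N] P_pos[of i] by (auto dest: dvd_imp_le)

lemma len_pos: "l < \<eta> \<Longrightarrow> 0 < len l"
  using tau_Suc by (simp add: len_def)

lemma tau_mono: "i \<le> j \<Longrightarrow> j \<le> \<eta> \<Longrightarrow> \<tau> i \<le> \<tau> j"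
proof (induction j rule: dec_induct)
  case (step n)
  then show ?case using tau_Suc[of n] by fastforce
qed simp

lemma tau_nonneg: "i \<le> \<eta> \<Longrightarrow> 0 \<le> \<tau> i"
  using tau_mono[of 0 i] tau0 by simp

text \<open>
  Since \<open>P l\<close> divides \<open>P i\<close> for \<open>l \<le> i\<close>, passing through the intermediate levels does not matter: the
  ancestor of \<open>k\<close> at level \<open>l\<close> is \<open>k mod P l\<close>.
\<close>

lemma tree_vector_eq: "tree_vector \<tau> N W i t \<omega> k = state i k (t - \<tau> i) \<omega>"
proof (induction i arbitrary: t k)
  case 0
  then show ?case by (simp add: state_def tau0)
next
  case (Suc i)
  have "(\<Sum>l<i. W l (k mod P i mod P l) (len l) \<omega>) = (\<Sum>l<i. W l (k mod P l) (len l) \<omega>)"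
    by (intro sum.cong) (auto simp: mod_mod_cancel offspring_prod_dvd)
  then show ?case
    by (simp add: Suc state_def len_def)
qed

lemma level_at_eq:
  assumes i: "i \<le> \<eta>" "i < \<eta> \<Longrightarrow> t \<le> \<tau> (Suc i)" "\<tau> i < t \<or> i = 0"
  shows "level_at \<eta> \<tau> t = i"
proof (cases "i = 0")
  case True
  then show ?thesis using i eta by (simp add: level_at_def)
next
  case False
  then have "\<tau> 1 \<le> \<tau> i" using i by (intro tau_mono) auto
  moreover have "Max {j \<in> {1..\<eta>}. \<tau> j < t} = i"
  proof (rule Max_eqI)
    fix j assume "j \<in> {j \<in> {1..\<eta>}. \<tau> j < t}"
    then show "j \<le> i" using i tau_mono[of "Suc i" j] by (fastforce intro: leI)
  qed (use i False in auto)
  ultimately show ?thesis using i False by (simp add: level_at_def)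
qed

definition exceed_times :: "real \<Rightarrow> 'a \<Rightarrow> real set" where
  "exceed_times u \<omega> = {t \<in> {0..T}. \<forall>\<gamma> < P \<eta>. branch \<eta> \<tau> N W \<gamma> t \<omega> - c * t > u}"

text \<open>
  The map \<open>\<gamma> \<mapsto> \<gamma> mod P i\<close> sends the set of branches onto the set of states at level \<open>i\<close>.
\<close>

lemma exceed_times_iff:
  assumes i: "i \<le> \<eta>" "i < \<eta> \<Longrightarrow> s \<le> len i" "i = \<eta> \<Longrightarrow> s \<le> T - \<tau> \<eta>" "0 < s \<or> i = 0 \<and> s = 0"
  shows "\<tau> i + s \<in> exceed_times u \<omega> \<longleftrightarrow> (\<forall>k<P i. u + c * (\<tau> i + s) < state i k s \<omega>)"
proof -
  have lev: "level_at \<eta> \<tau> (\<tau> i + s) = i"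
    using i by (intro level_at_eq) (auto simp: len_def)
  have "\<tau> i + s \<le> T"
  proof (cases "i = \<eta>")
    case False
    then have "\<tau> i + s \<le> \<tau> (Suc i)" using i by (simp add: len_def)
    also have "\<dots> \<le> \<tau> \<eta>" using False i by (intro tau_mono) auto
    finally show ?thesis using tau_T by simp
  qed (use i in auto)
  moreover have "0 \<le> \<tau> i + s" using i tau_nonneg[of i] by auto
  moreover have "(\<forall>\<gamma><P \<eta>. u + c * (\<tau> i + s) < state i (\<gamma> mod P i) s \<omega>)
      \<longleftrightarrow> (\<forall>k<P i. u + c * (\<tau> i + s) < state i k s \<omega>)"
  proof safe
    fix k assume *: "\<forall>\<gamma><P \<eta>. u + c * (\<tau> i + s) < state i (\<gamma> mod P i) s \<omega>" "k < P i"
    then show "u + c * (\<tau> i + s) < state i k s \<omega>"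
      using P_le[of i \<eta>] i by (auto dest!: spec[of _ k])
  qed (use P_pos i in auto)
  ultimately show ?thesis
    by (simp add: exceed_times_def branch_def lev tree_vector_eq less_diff_eq)
qed

lemma bm: "i \<le> \<eta> \<Longrightarrow> k < P i \<Longrightarrow> std_brownian_motion M (W i k)"
  using driving by (auto simp: driving_brownian_motions_def)

lemma W_measurable: "i \<le> \<eta> \<Longrightarrow> k < P i \<Longrightarrow> 0 \<le> t \<Longrightarrow> W i k t \<in> borel_measurable M"
  using bm[of i k] by (auto simp: std_brownian_motion_def)

lemma W_continuous: "i \<le> \<eta> \<Longrightarrow> k < P i \<Longrightarrow> \<omega> \<in> space M \<Longrightarrow> continuous_on {0..} (\<lambda>t. W i k t \<omega>)"
  using bm[of i k] by (auto simp: std_brownian_motion_def)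

lemma state_measurable:
  assumes "i \<le> \<eta>" "k < P i" "0 \<le> s" shows "state i k s \<in> borel_measurable M"
proof -
  have "W l (k mod P l) (len l) \<in> borel_measurable M" if "l < i" for l
    using that assms len_pos[of l] P_pos[of l] by (intro W_measurable) auto
  then show ?thesis
    unfolding state_def[abs_def] using assms by (intro borel_measurable_add borel_measurable_sum) (auto intro: W_measurable)
qed

text \<open>
  Only times in an open interval are allowed: by continuity such an event is a countable union of
  events on grids, which gives measurability and a way to pass to the limit from finitely many times.
\<close>

definition exceed :: "real \<Rightarrow> nat \<Rightarrow> real \<Rightarrow> real \<Rightarrow> 'a set" where
  "exceed u i p q = {\<omega> \<in> space M. \<exists>s\<in>{p<..<q}. \<forall>k<P i. u + c * (\<tau> i + s) < state i k s \<omega>}"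

definition exceed_grid :: "real \<Rightarrow> nat \<Rightarrow> real \<Rightarrow> real \<Rightarrow> nat \<Rightarrow> 'a set" where
  "exceed_grid u i p q n = {\<omega> \<in> space M. \<exists>j\<in>{1..<2 ^ n}. \<forall>k<P i.
     u + c * (\<tau> i + dyadic p q n j) < state i k (dyadic p q n j) \<omega>}"

lemma state_nhd:
  assumes i: "i \<le> \<eta>" and \<omega>: "\<omega> \<in> space M" and s: "0 < s"
    and ex: "\<forall>k<P i. u + c * (\<tau> i + s) < state i k s \<omega>"
  obtains e where "0 < e" "\<And>r. \<bar>r - s\<bar> < e \<Longrightarrow> 0 < r \<and> (\<forall>k<P i. u + c * (\<tau> i + r) < state i k r \<omega>)"
proof -
  have "continuous_on {0..} (\<lambda>r. state i k r \<omega> - (u + c * (\<tau> i + r)))" if "k < P i" for k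
    unfolding state_def using W_continuous[OF i that \<omega>] by (intro continuous_intros)
  from continuous_pos_nhd[of "{..<P i}" "\<lambda>k r. state i k r \<omega> - (u + c * (\<tau> i + r))" s] this s ex
  obtain e where "0 < e" "\<And>r. \<bar>r - s\<bar> < e \<Longrightarrow> 0 < r \<and> (\<forall>k\<in>{..<P i}. 0 < state i k r \<omega> - (u + c * (\<tau> i + r)))"
    by auto
  then show ?thesis by (intro that[of e]) auto
qed

lemma exceed_grid_events:
  assumes "i \<le> \<eta>" "0 \<le> p" "p < q" shows "exceed_grid u i p q n \<in> events"
proof -
  have "{\<omega> \<in> space M. u + c * (\<tau> i + dyadic p q n j) < state i k (dyadic p q n j) \<omega>} \<in> events"
    if k: "k < P i" for k j
  proof -
    have [measurable]: "state i k (dyadic p q n j) \<in> borel_measurable M"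
      using assms k by (intro state_measurable) (auto simp: dyadic_def)
    show ?thesis by measurable
  qed
  then have "{\<omega> \<in> space M. \<forall>k\<in>{..<P i}. u + c * (\<tau> i + dyadic p q n j) < state i k (dyadic p q n j) \<omega>} \<in> events" for j
    by (intro sets.sets_Collect_finite_All) auto
  then have "{\<omega> \<in> space M. \<forall>k<P i. u + c * (\<tau> i + dyadic p q n j) < state i k (dyadic p q n j) \<omega>} \<in> events" for j
    by (simp only: Ball_def lessThan_iff)
  then show ?thesis
    unfolding exceed_grid_def by (intro sets.sets_Collect_finite_Ex finite_atLeastLessThan)
qed

lemma exceed_eq_UN:
  assumes i: "i \<le> \<eta>" "0 \<le> p" "p < q"
  shows "exceed u i p q = (\<Union>n. exceed_grid u i p q n)"
proof (intro set_eqI iffI)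
  fix \<omega> assume "\<omega> \<in> exceed u i p q"
  then obtain s where \<omega>: "\<omega> \<in> space M" and s: "p < s" "s < q" "\<forall>k<P i. u + c * (\<tau> i + s) < state i k s \<omega>"
    by (auto simp: exceed_def)
  then obtain e where e: "0 < e" "\<And>r. \<bar>r - s\<bar> < e \<Longrightarrow> 0 < r \<and> (\<forall>k<P i. u + c * (\<tau> i + r) < state i k r \<omega>)"
    using state_nhd[of i \<omega> s u] i by auto
  obtain n j where "1 \<le> j" "j < 2 ^ n" "\<bar>dyadic p q n j - s\<bar> < e"
    using dyadic_dense[OF s(1,2) e(1)] by blast
  then show "\<omega> \<in> (\<Union>n. exceed_grid u i p q n)"
    using e \<omega> by (auto simp: exceed_grid_def intro!: exI[of _ n] bexI[of _ j])
next
  fix \<omega> assume "\<omega> \<in> (\<Union>n. exceed_grid u i p q n)"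
  then obtain n j where "\<omega> \<in> space M" "1 \<le> j" "j < 2 ^ n"
      "\<forall>k<P i. u + c * (\<tau> i + dyadic p q n j) < state i k (dyadic p q n j) \<omega>"
    by (auto simp: exceed_grid_def)
  then show "\<omega> \<in> exceed u i p q"
    unfolding exceed_def using dyadic_in[OF i(3), of j n] by blast
qed

lemma exceed_events: "i \<le> \<eta> \<Longrightarrow> 0 \<le> p \<Longrightarrow> p < q \<Longrightarrow> exceed u i p q \<in> events"
  by (simp add: exceed_eq_UN exceed_grid_events image_subset_iff sets.countable_UN)

lemma exceed_grid_limit:
  assumes "i \<le> \<eta>" "0 \<le> p" "p < q"
  shows "(\<lambda>n. prob (exceed_grid u i p q n)) \<longlonglongrightarrow> prob (exceed u i p q)"
  unfolding exceed_eq_UN[OF assms]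
proof (rule finite_Lim_measure_incseq)
  show "incseq (exceed_grid u i p q)"
  proof (rule incseq_SucI, rule subsetI)
    fix n \<omega> assume "\<omega> \<in> exceed_grid u i p q n"
    then obtain j where j: "\<omega> \<in> space M" "1 \<le> j" "j < 2 ^ n"
        "\<forall>k<P i. u + c * (\<tau> i + dyadic p q n j) < state i k (dyadic p q n j) \<omega>"
      by (auto simp: exceed_grid_def)
    then show "\<omega> \<in> exceed_grid u i p q (Suc n)"
      by (auto simp: exceed_grid_def dyadic_Suc intro!: bexI[of _ "2 * j"])
  qed
qed (use assms exceed_grid_events in auto)

abbreviation hit :: "real \<Rightarrow> 'a \<Rightarrow> real" where
  "hit u \<omega> \<equiv> hitting_time T \<eta> \<tau> N W c u \<omega>"

lemma hit_eq: "hit u \<omega> = (if exceed_times u \<omega> = {} then T + 1 else Inf (exceed_times u \<omega>))"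
  by (simp only: hitting_time_def exceed_times_def Let_def)

lemma hit_less_iff_exceed_times:
  assumes "s \<le> T" shows "hit u \<omega> < s \<longleftrightarrow> (\<exists>t\<in>exceed_times u \<omega>. t < s)"
proof (cases "exceed_times u \<omega> = {}")
  case True
  then show ?thesis using assms by (simp add: hit_eq)
next
  case False
  have "bdd_below (exceed_times u \<omega>)" by (rule bdd_belowI[of _ 0]) (auto simp: exceed_times_def)
  then show ?thesis
    using False by (simp add: hit_eq cInf_less_iff)
qed

text \<open>
  Every branch is left-continuous at each positive time, the branching points included, because it keeps
  its old level at \<open>\<tau> i\<close> itself. Hence an exceedance at a time \<open>t > 0\<close> is preceded by exceedances in
  the interior of the segment that contains \<open>t\<close>. Time \<open>0\<close> has no predecessor and yields the event on
  \<open>W 0 0 0\<close>.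
\<close>

lemma hit_less_iff:
  assumes s: "\<tau> \<eta> < s" "s \<le> T" and \<omega>: "\<omega> \<in> space M"
  shows "hit u \<omega> < s \<longleftrightarrow> u < W 0 0 0 \<omega> \<or> (\<exists>i<\<eta>. \<omega> \<in> exceed u i 0 (len i)) \<or> \<omega> \<in> exceed u \<eta> 0 (s - \<tau> \<eta>)"
  unfolding hit_less_iff_exceed_times[OF s(2)]
proof
  assume "\<exists>t\<in>exceed_times u \<omega>. t < s"
  then obtain t where t: "t \<in> exceed_times u \<omega>" "t < s" by blast
  show "u < W 0 0 0 \<omega> \<or> (\<exists>i<\<eta>. \<omega> \<in> exceed u i 0 (len i)) \<or> \<omega> \<in> exceed u \<eta> 0 (s - \<tau> \<eta>)"
  proof (cases "t = 0")
    case True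
    then show ?thesis
      using t exceed_times_iff[of 0 0 u \<omega>] eta len_pos[of 0] P_pos[of 0] by (auto simp: tau0 state_def offspring_prod_0)
  next
    case False
    define i where "i = Max {i \<in> {..\<eta>}. \<tau> i < t}"
    have fin: "finite {i \<in> {..\<eta>}. \<tau> i < t}" by simp
    have "0 \<in> {i \<in> {..\<eta>}. \<tau> i < t}" using t False by (auto simp: exceed_times_def tau0)
    then have "i \<in> {i \<in> {..\<eta>}. \<tau> i < t}"
      unfolding i_def by (intro Max_in[OF fin]) blast
    then have i: "i \<le> \<eta>" "\<tau> i < t" by auto
    have imax: "j \<le> i" if "j \<le> \<eta>" "\<tau> j < t" for j
      unfolding i_def using that by (intro Max_ge[OF fin]) auto
    have le: "i < \<eta> \<Longrightarrow> t - \<tau> i \<le> len i"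
      using imax[of "Suc i"] by (auto simp: len_def not_less_eq_eq intro!: leI)
    have "\<forall>k<P i. u + c * (\<tau> i + (t - \<tau> i)) < state i k (t - \<tau> i) \<omega>"
      using exceed_times_iff[of i "t - \<tau> i" u \<omega>] t i le by (auto simp: exceed_times_def)
    then obtain e where e: "0 < e" "\<And>r. \<bar>r - (t - \<tau> i)\<bar> < e \<Longrightarrow> 0 < r \<and> (\<forall>k<P i. u + c * (\<tau> i + r) < state i k r \<omega>)"
      using state_nhd[of i \<omega> "t - \<tau> i" u] i \<omega> by auto
    define r where "r = t - \<tau> i - e / 2"
    have r: "0 < r" "r < t - \<tau> i" "\<forall>k<P i. u + c * (\<tau> i + r) < state i k r \<omega>"
      using e(1) e(2)[of r] by (auto simp: r_def)
    show ?thesis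
    proof (cases "i = \<eta>")
      case True
      then have "\<omega> \<in> exceed u \<eta> 0 (s - \<tau> \<eta>)"
        unfolding exceed_def using \<omega> r t by (auto intro!: bexI[of _ r])
      then show ?thesis by blast
    next
      case False
      then have "i < \<eta>" using i by simp
      then have "\<omega> \<in> exceed u i 0 (len i)"
        unfolding exceed_def using \<omega> r le by (auto intro!: bexI[of _ r])
      then show ?thesis using \<open>i < \<eta>\<close> by blast
    qed
  qed
next
  assume "u < W 0 0 0 \<omega> \<or> (\<exists>i<\<eta>. \<omega> \<in> exceed u i 0 (len i)) \<or> \<omega> \<in> exceed u \<eta> 0 (s - \<tau> \<eta>)"
  then consider "u < W 0 0 0 \<omega>"
    | i r where "i \<le> \<eta>" "0 < r" "i < \<eta> \<Longrightarrow> r < len i" "i = \<eta> \<Longrightarrow> r < s - \<tau> \<eta>"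
        "\<forall>k<P i. u + c * (\<tau> i + r) < state i k r \<omega>"
  proof (elim disjE exE conjE)
    fix i assume i: "i < \<eta>" "\<omega> \<in> exceed u i 0 (len i)"
    then obtain r where "0 < r" "r < len i" "\<forall>k<P i. u + c * (\<tau> i + r) < state i k r \<omega>"
      by (auto simp: exceed_def)
    then show thesis using i by (intro that(2)[of i r]) auto
  next
    assume "\<omega> \<in> exceed u \<eta> 0 (s - \<tau> \<eta>)"
    then obtain r where "0 < r" "r < s - \<tau> \<eta>" "\<forall>k<P \<eta>. u + c * (\<tau> \<eta> + r) < state \<eta> k r \<omega>"
      by (auto simp: exceed_def)
    then show thesis by (intro that(2)[of \<eta> r]) auto
  qed (rule that(1))
  then show "\<exists>t\<in>exceed_times u \<omega>. t < s"
  proof cases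
    case 1
    then have "0 \<in> exceed_times u \<omega>"
      using exceed_times_iff[of 0 0 u \<omega>] eta len_pos[of 0] by (auto simp: tau0 state_def offspring_prod_0)
    then show ?thesis using s tau_nonneg[of \<eta>] by (intro bexI[of _ 0]) auto
  next
    case 2
    then have "\<tau> i + r \<in> exceed_times u \<omega>"
      using s by (subst exceed_times_iff) auto
    moreover have "\<tau> i + r < s"
      using 2 s tau_mono[of "Suc i" \<eta>] by (cases "i = \<eta>") (auto simp: len_def)
    ultimately show ?thesis by blast
  qed
qed

lemma hit_less_events:
  assumes s: "\<tau> \<eta> < s" "s \<le> T" shows "{\<omega> \<in> space M. hit u \<omega> < s} \<in> events"
proof -
  have [measurable]: "W 0 0 0 \<in> borel_measurable M" by (intro W_measurable) (auto simp: offspring_prod_0)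
  have "{\<omega> \<in> space M. hit u \<omega> < s}
      = {\<omega> \<in> space M. u < W 0 0 0 \<omega>} \<union> (\<Union>i<\<eta>. exceed u i 0 (len i)) \<union> exceed u \<eta> 0 (s - \<tau> \<eta>)"
    using hit_less_iff[OF s, of _ u] by (auto simp: exceed_def)
  also have "\<dots> \<in> events"
    using s by (intro sets.Un sets.finite_UN exceed_events) (auto simp: len_pos)
  finally show ?thesis .
qed

text \<open>
  The event \<open>hit u \<omega> \<le> s\<close> itself does not decompose over open segments, since the infimum need not be
  attained; it is reached from the events \<open>hit u \<omega> < s'\<close> by letting \<open>s'\<close> decrease to \<open>s\<close>.
\<close>

lemma hit_le_eq_INT:
  assumes s: "s < T" and d: "0 < d"
  shows "{\<omega> \<in> space M. hit u \<omega> \<le> s} = (\<Inter>n. {\<omega> \<in> space M. hit u \<omega> < s + d / Suc n})"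
proof -
  have "x \<le> s" if "\<And>n. x < s + d / real (Suc n)" for x
  proof (rule field_le_epsilon)
    fix e :: real assume "0 < e"
    obtain n where "d / e < real (Suc n)" using reals_Archimedean2[of "d / e"] by (metis less_Suc_eq of_nat_less_iff order_less_trans)
    then have "d / real (Suc n) < e" using \<open>0 < e\<close> by (simp add: field_simps)
    then show "x \<le> s + e" using that[of n] by linarith
  qed
  moreover have "s < s + d / real (Suc n)" for n using d by simp
  ultimately show ?thesis by (auto intro: order_le_less_trans)
qed

lemma hit_le_events:
  assumes s: "\<tau> \<eta> < s" "s < T" shows "{\<omega> \<in> space M. hit u \<omega> \<le> s} \<in> events"
proof -
  have "{\<omega> \<in> space M. hit u \<omega> < s + (T - s) / Suc n} \<in> events" for n
  proof -
    define d where "d = (T - s) / Suc n"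
    have "D / Suc n \<le> D" if "0 < D" for D :: real using that by (simp add: field_simps)
    then have "0 < d" "d \<le> T - s" unfolding d_def using s by simp_all
    then show ?thesis using s unfolding d_def[symmetric] by (intro hit_less_events) auto
  qed
  then show ?thesis
    using s by (subst hit_le_eq_INT[of _ "T - s"]) auto
qed

lemma hit_le_limit:
  assumes s: "\<tau> \<eta> < s" and d: "0 < d" "s + d \<le> T"
  shows "(\<lambda>n. prob {\<omega> \<in> space M. hit u \<omega> < s + d / Suc n}) \<longlonglongrightarrow> prob {\<omega> \<in> space M. hit u \<omega> \<le> s}"
proof -
  have le: "d / Suc n \<le> d" for n using d by (simp add: field_simps)
  have pos: "0 < d / Suc n" for n using d by simp
  have "{\<omega> \<in> space M. hit u \<omega> < s + d / Suc n} \<in> events" for n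
  proof (rule hit_less_events)
    show "\<tau> \<eta> < s + d / Suc n" "s + d / Suc n \<le> T" using s d le[of n] pos[of n] by linarith+
  qed
  moreover have "decseq (\<lambda>n. {\<omega> \<in> space M. hit u \<omega> < s + d / Suc n})"
  proof (rule decseq_SucI, rule subsetI)
    fix n \<omega> assume "\<omega> \<in> {\<omega> \<in> space M. hit u \<omega> < s + d / real (Suc (Suc n))}"
    moreover have "d / real (Suc (Suc n)) \<le> d / real (Suc n)" using d by (intro divide_left_mono) auto
    ultimately show "\<omega> \<in> {\<omega> \<in> space M. hit u \<omega> < s + d / real (Suc n)}" by simp
  qed
  ultimately show ?thesis
    using finite_Lim_measure_decseq[of "\<lambda>n. {\<omega> \<in> space M. hit u \<omega> < s + d / Suc n}"] d
    by (subst hit_le_eq_INT[of _ d]) auto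
qed

end

section \<open>Increments and Gaussian bounds for one level\<close>

lemma sum_mod_lessThan:
  fixes f :: "nat \<Rightarrow> real"
  assumes "0 < p" shows "(\<Sum>k<n * p. f (k mod p)) = real n * (\<Sum>k<p. f k)"
proof (induction n)
  case (Suc n)
  have "(\<Sum>k<Suc n * p. f (k mod p)) = (\<Sum>k<n * p. f (k mod p)) + (\<Sum>k=n * p..<n * p + p. f (k mod p))"
    by (simp add: lessThan_atLeast0 sum.atLeastLessThan_concat add.commute)
  also have "(\<Sum>k=n * p..<n * p + p. f (k mod p)) = (\<Sum>k=0..<p. f ((k + n * p) mod p))"
    using sum.shift_bounds_nat_ivl[of "\<lambda>k. f (k mod p)" 0 "n * p" p] by (simp add: add.commute)
  also have "\<dots> = (\<Sum>k<p. f k)"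
    by (simp add: lessThan_atLeast0)
  finally show ?case by (simp add: Suc algebra_simps)
qed simp

text \<open>
  A Brownian motion starts in \<open>0\<close> only almost surely. Here it does so everywhere, so that states are
  exactly sums of increments; the general case follows by replacing each path by its difference
  to its starting value.
\<close>

locale brownian_tree_at_0 = brownian_tree +
  assumes W_0: "\<And>i k \<omega>. i \<le> \<eta> \<Longrightarrow> k < P i \<Longrightarrow> \<omega> \<in> space M \<Longrightarrow> W i k 0 \<omega> = 0"
begin

text \<open>
  In a study of level \<open>i\<close>, the motions of level \<open>i\<close> are sampled on the grid \<open>g\<close>, whereas each motion of
  a lower level \<open>l\<close> enters through its single increment over \<open>[0, len l]\<close>.
\<close>

definition level_grid :: "nat \<Rightarrow> (nat \<Rightarrow> real) \<Rightarrow> nat \<Rightarrow> nat \<Rightarrow> real" where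
  "level_grid i g l j = (if l < i then real j * len l else g j)"

definition incr :: "nat \<Rightarrow> (nat \<Rightarrow> real) \<Rightarrow> (nat \<times> nat) \<times> nat \<Rightarrow> 'a \<Rightarrow> real" where
  "incr i g = (\<lambda>((l, k), j) \<omega>. W l k (level_grid i g l (Suc j)) \<omega> - W l k (level_grid i g l j) \<omega>)"

definition incr_idx :: "nat \<Rightarrow> nat \<Rightarrow> ((nat \<times> nat) \<times> nat) set" where
  "incr_idx i m = (SIGMA (l, k):(SIGMA l:{..i}. {..<P l}). {..<if l < i then 1 else m})"

definition incr_sd :: "nat \<Rightarrow> (nat \<Rightarrow> real) \<Rightarrow> (nat \<times> nat) \<times> nat \<Rightarrow> real" where
  "incr_sd i g = (\<lambda>((l, k), j). sqrt (level_grid i g l (Suc j) - level_grid i g l j))"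

definition time_grid :: "(nat \<Rightarrow> real) \<Rightarrow> nat \<Rightarrow> bool" where
  "time_grid g m \<longleftrightarrow> g 0 = 0 \<and> (\<forall>j<m. g j < g (Suc j))"

lemma time_grid_nonneg: "time_grid g m \<Longrightarrow> j \<le> m \<Longrightarrow> 0 \<le> g j"
proof (induction j)
  case (Suc j)
  then show ?case by (auto simp: time_grid_def Suc_le_eq intro: order.trans[OF _ less_imp_le])
qed (simp add: time_grid_def)

lemma incr_idx_iff: "((l, k), j) \<in> incr_idx i m \<longleftrightarrow> l \<le> i \<and> k < P l \<and> j < (if l < i then 1 else m)"
  by (simp add: incr_idx_def)

lemma finite_incr_idx: "finite (incr_idx i m)"
  unfolding incr_idx_def by (intro finite_SigmaI) auto

lemma sum_incr_idx:
  "(\<Sum>p\<in>incr_idx i m. F p) = (\<Sum>l<i. \<Sum>k<P l. F ((l, k), 0)) + (\<Sum>k<P i. \<Sum>j<m. F ((i, k), j :: nat))"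
  for F :: "_ \<Rightarrow> real"
proof -
  have "(\<Sum>p\<in>incr_idx i m. F p)
      = (\<Sum>q\<in>(SIGMA l:{..i}. {..<P l}). \<Sum>j<(if fst q < i then 1 else m). F (q, j))"
    unfolding incr_idx_def by (subst sum.Sigma) (auto intro!: sum.cong simp: split_beta)
  also have "\<dots> = (\<Sum>l\<le>i. \<Sum>k<P l. \<Sum>j<(if l < i then 1 else m). F ((l, k), j))"
    by (subst sum.Sigma) (auto intro!: sum.cong)
  also have "\<dots> = (\<Sum>l<i. \<Sum>k<P l. \<Sum>j<(if l < i then 1 else m). F ((l, k), j))
      + (\<Sum>k<P i. \<Sum>j<(if i < i then 1 else m). F ((i, k), j))"
    by (simp add: lessThan_Suc_atMost[symmetric])
  also have "(\<Sum>l<i. \<Sum>k<P l. \<Sum>j<(if l < i then 1 else m). F ((l, k), j)) = (\<Sum>l<i. \<Sum>k<P l. F ((l, k), 0))"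
    by (intro sum.cong) auto
  finally show ?thesis by simp
qed

lemma level_grid_less:
  assumes "i \<le> \<eta>" "time_grid g m" "l \<le> i" "j < (if l < i then 1 else m)"
  shows "level_grid i g l j < level_grid i g l (Suc j)" "0 \<le> level_grid i g l j"
  using assms len_pos[of l] time_grid_nonneg[of g m j]
  by (auto simp: level_grid_def time_grid_def split: if_splits)

lemma incr_indep:
  assumes i: "i \<le> \<eta>" and g: "time_grid g m"
  shows "indep_vars (\<lambda>_. borel) (incr i g) (incr_idx i m)"
proof -
  define Z where "Z = (\<lambda>(i, k) \<omega>. \<lambda>t\<in>{0..}. W i k t \<omega>)"
  define f where "f = (\<lambda>(l, k::nat) j z. z (level_grid i g l (Suc j)) - z (level_grid i g l j) :: real)"
  let ?A = "SIGMA l:{..i}. {..<P l}" and ?B = "\<lambda>(l, k). {..<if l < i then 1 else m}"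
  have fZ: "f a j (Z a \<omega>) = incr i g (a, j) \<omega>" if "a \<in> ?A" "j \<in> ?B a" for a j \<omega>
  proof -
    obtain l k where a: "a = (l, k)" by (cases a)
    with that have "level_grid i g l j < level_grid i g l (Suc j)" "0 \<le> level_grid i g l j"
      by (intro level_grid_less[OF i g]; simp)+
    then show ?thesis by (simp add: f_def Z_def incr_def a)
  qed
  have "indep_vars (\<lambda>_. Pi\<^sub>M {0..} (\<lambda>_. borel)) Z (SIGMA i:{..\<eta>}. {..<P i})"
    using driving by (simp add: driving_brownian_motions_def Z_def)
  then have 1: "indep_vars (\<lambda>_. Pi\<^sub>M {0..} (\<lambda>_. borel)) Z ?A"
    by (rule indep_vars_subset) (use i in auto)
  have 2: "f a b \<in> borel_measurable (Pi\<^sub>M {0..} (\<lambda>_. borel))" if "a \<in> ?A" "b \<in> ?B a" for a b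
  proof -
    obtain l k where a: "a = (l, k)" by (cases a)
    with that have "level_grid i g l b < level_grid i g l (Suc b)" "0 \<le> level_grid i g l b"
      by (intro level_grid_less[OF i g]; simp)+
    then show ?thesis
      unfolding f_def a prod.case
      by (intro borel_measurable_diff measurable_component_singleton) auto
  qed
  have 3: "indep_vars (\<lambda>_. borel) (\<lambda>b \<omega>. f a b (Z a \<omega>)) (?B a)" if "a \<in> ?A" for a
  proof -
    obtain l k where a: "a = (l, k)" by (cases a)
    with that have lk: "l \<le> i" "k < P l" by auto
    have "std_brownian_motion M (W l k)" using lk i by (intro bm) auto
    moreover have "0 \<le> level_grid i g l 0" using g by (simp add: level_grid_def time_grid_def)
    moreover have "level_grid i g l j < level_grid i g l (Suc j)" if "j < (if l < i then 1 else m)" for j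
      by (rule level_grid_less(1)[OF i g lk(1) that])
    ultimately have "indep_vars (\<lambda>_. borel)
        (\<lambda>j \<omega>. W l k (level_grid i g l (Suc j)) \<omega> - W l k (level_grid i g l j) \<omega>) {..<if l < i then 1 else m}"
      unfolding std_brownian_motion_def by blast
    moreover have "f a b (Z a \<omega>) = W l k (level_grid i g l (Suc b)) \<omega> - W l k (level_grid i g l b) \<omega>"
      if "b \<in> ?B a" for b \<omega>
      using fZ[OF \<open>a \<in> ?A\<close> that] by (simp add: a incr_def)
    ultimately show ?thesis
      by (subst indep_vars_cong[OF refl _ refl]) (auto simp: a)
  qed
  have "indep_vars (\<lambda>_. borel) (\<lambda>(a, b) \<omega>. f a b (Z a \<omega>)) (Sigma ?A ?B)"
    by (rule indep_vars_Sigma[where f = f and B = ?B, OF 1 _ _ 2 3]) auto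
  moreover have "(SIGMA (l, k):?A. {..<if l < i then 1 else m}) = Sigma ?A ?B"
    by auto
  ultimately show ?thesis
    unfolding incr_idx_def using fZ
    by (subst indep_vars_cong[OF refl _ refl, of _ _ "\<lambda>(a, b) \<omega>. f a b (Z a \<omega>)"]) auto
qed

lemma incr_sd_pos:
  assumes "i \<le> \<eta>" "time_grid g m" "p \<in> incr_idx i m" shows "0 < incr_sd i g p"
proof -
  obtain l k j where p: "p = ((l, k), j)" by (metis surj_pair)
  then show ?thesis
    using level_grid_less(1)[OF assms(1,2), of l j] assms(3) by (simp add: incr_sd_def incr_idx_iff)
qed

lemma incr_distributed:
  assumes "i \<le> \<eta>" "time_grid g m" "p \<in> incr_idx i m"
  shows "distributed M lborel (incr i g p) (normal_density 0 (incr_sd i g p))"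
proof -
  obtain l k j where p: "p = ((l, k), j)" by (metis surj_pair)
  then have "l \<le> i" "k < P l" "j < (if l < i then 1 else m)" using assms(3) by (auto simp: incr_idx_iff)
  with level_grid_less[OF assms(1,2) this(1,3)] bm[of l k] assms(1) show ?thesis
    by (simp add: p incr_def incr_sd_def std_brownian_motion_def)
qed

text \<open>
  The state at the grid time number \<open>j\<close> as a function of the vector of increments, used to see exceedance
  events as measurable sets in a finite product space.
\<close>

definition vec_state :: "nat \<Rightarrow> ((nat \<times> nat) \<times> nat \<Rightarrow> real) \<Rightarrow> nat \<Rightarrow> nat \<Rightarrow> real" where
  "vec_state i v j k = (\<Sum>l<i. v ((l, k mod P l), 0)) + (\<Sum>j'<j. v ((i, k), j'))"

lemma incr_lower_level:
  "l < i \<Longrightarrow> i \<le> \<eta> \<Longrightarrow> k < P l \<Longrightarrow> \<omega> \<in> space M \<Longrightarrow> incr i g ((l, k), 0) \<omega> = W l k (len l) \<omega>"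
  by (simp add: incr_def level_grid_def W_0)

lemma sum_incr_top_level:
  assumes "g 0 = 0" "i \<le> \<eta>" "k < P i" "\<omega> \<in> space M"
  shows "(\<Sum>j'<j. incr i g ((i, k), j') \<omega>) = W i k (g j) \<omega>"
  using assms sum_lessThan_telescope[of "\<lambda>j. W i k (g j) \<omega>" j] by (simp add: incr_def level_grid_def W_0)

lemma state_eq_vec_state:
  assumes "g 0 = 0" "i \<le> \<eta>" "k < P i" "\<omega> \<in> space M"
  shows "state i k (g j) \<omega> = vec_state i (\<lambda>p. incr i g p \<omega>) j k"
proof -
  have "incr i g ((l, k mod P l), 0) \<omega> = W l (k mod P l) (len l) \<omega>" if "l < i" for l
    using that assms P_pos[of l] by (intro incr_lower_level) auto
  then show ?thesis
    by (simp add: state_def vec_state_def sum_incr_top_level[of g i k \<omega> j] assms)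
qed

lemma vec_state_measurable:
  assumes "\<And>l. l < i \<Longrightarrow> ((l, k mod P l), 0) \<in> J" "\<And>j'. j' < j \<Longrightarrow> ((i, k), j') \<in> J"
  shows "(\<lambda>v. vec_state i v j k) \<in> borel_measurable (Pi\<^sub>M J (\<lambda>_. borel))"
  unfolding vec_state_def using assms
  by (intro borel_measurable_add borel_measurable_sum measurable_component_singleton) auto

text \<open>
  The variance of the average of the \<open>P i\<close> states at the time \<open>\<tau> i + e\<close>: in that average all \<open>P l\<close> motions of
  level \<open>l\<close> have weight \<open>1 / P l\<close>.
\<close>

definition avg_var :: "nat \<Rightarrow> real \<Rightarrow> real" where
  "avg_var i e = (\<Sum>l<i. len l / P l) + e / P i"

lemma sum_state:
  assumes i: "i \<le> \<eta>"
  shows "(\<Sum>k<P i. state i k s \<omega>) / P i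
    = (\<Sum>l<i. (\<Sum>k<P l. W l k (len l) \<omega>) / P l) + (\<Sum>k<P i. W i k s \<omega>) / P i"
proof -
  have "(\<Sum>k<P i. \<Sum>l<i. W l (k mod P l) (len l) \<omega>) = (\<Sum>l<i. \<Sum>k<P i. W l (k mod P l) (len l) \<omega>)"
    by (rule sum.swap)
  also have "\<dots> = (\<Sum>l<i. real (P i) * ((\<Sum>k<P l. W l k (len l) \<omega>) / P l))"
  proof (rule sum.cong)
    fix l assume "l \<in> {..<i}"
    then obtain n where n: "P i = n * P l" using offspring_prod_dvd[of l i N] by (auto simp: dvd_def mult.commute)
    have "0 < P l" using \<open>l \<in> {..<i}\<close> i P_pos[of l] by simp
    then show "(\<Sum>k<P i. W l (k mod P l) (len l) \<omega>) = real (P i) * ((\<Sum>k<P l. W l k (len l) \<omega>) / P l)"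
      unfolding n using sum_mod_lessThan[of "P l" "\<lambda>k. W l k (len l) \<omega>" n] by simp
  qed simp
  also have "\<dots> = real (P i) * (\<Sum>l<i. (\<Sum>k<P l. W l k (len l) \<omega>) / P l)"
    by (rule sum_distrib_left[symmetric])
  finally have "(\<Sum>k<P i. \<Sum>l<i. W l (k mod P l) (len l) \<omega>) / P i
      = (\<Sum>l<i. (\<Sum>k<P l. W l k (len l) \<omega>) / P l)"
    using P_pos[OF i] by simp
  then show ?thesis
    by (simp add: state_def sum.distrib add_divide_distrib)
qed

text \<open>
  If all states exceed \<open>b\<close>, then so does their average. The average and \<open>W i k0 h\<close> are linear in
  independent increments, with covariance \<open>h / P i\<close>, and the Chernoff bound applies to
  \<open>lam\<close> times the average plus \<open>\<beta> * W i k0 h\<close>.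
\<close>

lemma level_chernoff:
  assumes i: "i \<le> \<eta>" and h: "0 < h" "h < e" and lam: "0 \<le> lam" and k0: "k0 < P i"
  shows "prob {\<omega> \<in> space M. (\<forall>k<P i. b < state i k e \<omega>) \<and> z \<le> \<beta> * W i k0 h \<omega>}
    \<le> exp ((lam\<^sup>2 * avg_var i e + 2 * lam * \<beta> * h / P i + \<beta>\<^sup>2 * h) / 2 - (lam * b + z))"
proof -
  define g where "g = (\<lambda>j::nat. if j = 0 then 0 else if j = 1 then h else e)"
  have g: "time_grid g 2" using h by (auto simp: time_grid_def g_def less_2_cases_iff)
  (* Weight lam / P l on every motion of level l gives lam times the average. *)
  define a where "a = (\<lambda>((l, k), j). lam / P l + (if l = i \<and> k = k0 \<and> j = (0::nat) then \<beta> else 0))"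
  have Pi: "0 < P i" using P_pos[OF i] .
  have lin: "(\<Sum>p\<in>incr_idx i 2. a p * incr i g p \<omega>) = lam * ((\<Sum>k<P i. state i k e \<omega>) / P i) + \<beta> * W i k0 h \<omega>"
    if \<omega>: "\<omega> \<in> space M" for \<omega>
  proof -
    have "(\<Sum>j<2. a ((i, k), j) * incr i g ((i, k), j) \<omega>)
        = lam / P i * W i k e \<omega> + (if k = k0 then \<beta> * W i k0 h \<omega> else 0)" if "k < P i" for k
      using W_0[OF i that \<omega>]
      by (simp add: numeral_2_eq_2 a_def incr_def level_grid_def g_def algebra_simps)
    then have "(\<Sum>k<P i. \<Sum>j<2. a ((i, k), j) * incr i g ((i, k), j) \<omega>)
        = lam / P i * (\<Sum>k<P i. W i k e \<omega>) + \<beta> * W i k0 h \<omega>"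
      using k0 by (simp add: sum.distrib sum_distrib_left)
    moreover have "(\<Sum>l<i. \<Sum>k<P l. a ((l, k), 0) * incr i g ((l, k), 0) \<omega>)
        = lam * (\<Sum>l<i. (\<Sum>k<P l. W l k (len l) \<omega>) / P l)"
      using i \<omega> by (simp add: a_def incr_lower_level sum_distrib_left sum_divide_distrib)
    ultimately show ?thesis
      unfolding sum_incr_idx sum_state[OF i] by (simp add: algebra_simps)
  qed
  have var: "(\<Sum>p\<in>incr_idx i 2. (a p)\<^sup>2 * (incr_sd i g p)\<^sup>2)
      = lam\<^sup>2 * avg_var i e + 2 * lam * \<beta> * h / P i + \<beta>\<^sup>2 * h"
  proof -
    have "(\<Sum>j<2. (a ((i, k), j))\<^sup>2 * (incr_sd i g ((i, k), j))\<^sup>2)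
        = (lam / P i)\<^sup>2 * e + (if k = k0 then 2 * lam * \<beta> * h / P i + \<beta>\<^sup>2 * h else 0)" for k
    proof -
      have sq: "(x + \<beta>)\<^sup>2 * h + x\<^sup>2 * (e - h) = x\<^sup>2 * e + (2 * x * \<beta> * h + \<beta>\<^sup>2 * h)"
        "x\<^sup>2 * h + x\<^sup>2 * (e - h) = x\<^sup>2 * e" for x
        by (simp_all add: power2_eq_square algebra_simps)
      show ?thesis
        using h sq[of "lam / P i"]
        by (simp add: numeral_2_eq_2 a_def incr_sd_def level_grid_def g_def del: power_divide)
    qed
    then have "(\<Sum>k<P i. \<Sum>j<2. (a ((i, k), j))\<^sup>2 * (incr_sd i g ((i, k), j))\<^sup>2)
        = lam\<^sup>2 * (e / P i) + 2 * lam * \<beta> * h / P i + \<beta>\<^sup>2 * h"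
      using k0 Pi by (simp add: sum.distrib power2_eq_square)
    moreover have "(\<Sum>l<i. \<Sum>k<P l. (a ((l, k), 0))\<^sup>2 * (incr_sd i g ((l, k), 0))\<^sup>2) = lam\<^sup>2 * (\<Sum>l<i. len l / P l)"
      unfolding sum_distrib_left
    proof (rule sum.cong)
      fix l assume l: "l \<in> {..<i}"
      then have "0 < P l" "0 < len l" using i P_pos[of l] len_pos[of l] by auto
      then show "(\<Sum>k<P l. (a ((l, k), 0))\<^sup>2 * (incr_sd i g ((l, k), 0))\<^sup>2) = lam\<^sup>2 * (len l / P l)"
        using l by (simp add: a_def incr_sd_def level_grid_def power2_eq_square)
    qed simp
    ultimately show ?thesis
      unfolding sum_incr_idx avg_var_def by (simp add: algebra_simps)
  qed
  have rv: "random_variable borel (incr i g p)" if "p \<in> incr_idx i 2" for p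
    using incr_indep[OF i g] that by (auto simp: indep_vars_def2)
  have "prob {\<omega> \<in> space M. (\<forall>k<P i. b < state i k e \<omega>) \<and> z \<le> \<beta> * W i k0 h \<omega>}
      \<le> prob {\<omega> \<in> space M. lam * b + z \<le> (\<Sum>p\<in>incr_idx i 2. a p * incr i g p \<omega>)}"
  proof (rule finite_measure_mono)
    show "{\<omega> \<in> space M. (\<forall>k<P i. b < state i k e \<omega>) \<and> z \<le> \<beta> * W i k0 h \<omega>}
        \<subseteq> {\<omega> \<in> space M. lam * b + z \<le> (\<Sum>p\<in>incr_idx i 2. a p * incr i g p \<omega>)}"
    proof safe
      fix \<omega> assume \<omega>: "\<omega> \<in> space M" and ex: "\<forall>k<P i. b < state i k e \<omega>" and z: "z \<le> \<beta> * W i k0 h \<omega>"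
      have "real (P i) * b \<le> (\<Sum>k<P i. state i k e \<omega>)"
        using sum_mono[of "{..<P i}" "\<lambda>_. b" "\<lambda>k. state i k e \<omega>"] ex by (auto intro: less_imp_le)
      then have "b \<le> (\<Sum>k<P i. state i k e \<omega>) / P i" using Pi by (simp add: field_simps)
      then show "lam * b + z \<le> (\<Sum>p\<in>incr_idx i 2. a p * incr i g p \<omega>)"
        unfolding lin[OF \<omega>] using z lam by (intro add_mono mult_left_mono)
    qed
    have "(\<lambda>\<omega>. \<Sum>p\<in>incr_idx i 2. a p * incr i g p \<omega>) \<in> borel_measurable M"
      by (intro borel_measurable_sum borel_measurable_times rv) auto
    then show "{\<omega> \<in> space M. lam * b + z \<le> (\<Sum>p\<in>incr_idx i 2. a p * incr i g p \<omega>)} \<in> events"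
      by measurable
  qed
  also have "\<dots> \<le> exp ((lam\<^sup>2 * avg_var i e + 2 * lam * \<beta> * h / P i + \<beta>\<^sup>2 * h) / 2 - (lam * b + z))"
    unfolding var[symmetric]
    by (rule normal_chernoff[OF finite_incr_idx incr_indep[OF i g] incr_distributed[OF i g] incr_sd_pos[OF i g]])
  finally show ?thesis .
qed

lemma avg_var_pos: "i \<le> \<eta> \<Longrightarrow> 0 < e \<Longrightarrow> 0 < avg_var i e"
  unfolding avg_var_def using P_pos len_pos by (intro add_nonneg_pos sum_nonneg divide_nonneg_nonneg) (auto simp: less_imp_le)

text \<open>
  Force each motion above its share of the cheapest way to \<open>b\<close>: an increment of variance \<open>d\<close> at level \<open>l\<close>
  has to exceed \<open>b * d / (P l * avg_var i e)\<close>. Along each branch these shares add up to \<open>b\<close>, and the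
  Gaussian costs of all motions together add up to \<open>b\<^sup>2 / (2 * avg_var i e)\<close>.
\<close>

lemma level_lower_bound:
  assumes i: "i \<le> \<eta>" and e: "0 < e"
  obtains K1 K2 where "\<And>b. 0 \<le> b \<Longrightarrow>
    exp (- (b\<^sup>2 / (2 * avg_var i e)) - K1 * b - K2) \<le> prob {\<omega> \<in> space M. \<forall>k<P i. b < state i k e \<omega>}"
proof -
  define g where "g = (\<lambda>j::nat. if j = 0 then 0 else e)"
  have g: "time_grid g 1" using e by (auto simp: time_grid_def g_def)
  let ?I = "incr_idx i 1"
  define s where "s = incr_sd i g"
  have s: "0 < s p" if "p \<in> ?I" for p using incr_sd_pos[OF i g that] by (simp add: s_def)
  define v where "v = avg_var i e"
  have v: "0 < v" using avg_var_pos[OF i e] by (simp add: v_def)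
  have rv: "random_variable borel (incr i g p)" if "p \<in> ?I" for p
    using incr_indep[OF i g] that by (auto simp: indep_vars_def2)
  (* b * (s p * a p) is the share of the increment p; the normalised thresholds
     b * a p satisfy sum (a p)^2 = 1 / v. *)
  define a where "a = (\<lambda>p. s p / (P (fst (fst p)) * v))"
  have Ppos: "0 < P (fst (fst p))" if "p \<in> ?I" for p
    using that i P_pos[of "fst (fst p)"] by (cases p; cases "fst p") (auto simp: incr_idx_iff)
  have s2: "(s ((l, k), 0))\<^sup>2 = (if l < i then len l else e)" if "l \<le> i" for l k
    using that i len_pos[of l] e by (auto simp: s_def incr_sd_def level_grid_def g_def)
  have a2: "(\<Sum>p\<in>?I. (a p)\<^sup>2) = 1 / v"
  proof -
    have "(\<Sum>k<P l. (a ((l, k), 0))\<^sup>2) = (if l < i then len l else e) / P l / v\<^sup>2" if "l \<le> i" for l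
      using that i P_pos[of l] by (simp add: a_def power_divide s2 power_mult_distrib) (simp add: power2_eq_square)
    then have "(\<Sum>p\<in>?I. (a p)\<^sup>2) = (\<Sum>l<i. len l / P l / v\<^sup>2) + e / P i / v\<^sup>2"
      unfolding sum_incr_idx by simp
    also have "\<dots> = v / v\<^sup>2" unfolding v_def avg_var_def by (simp add: add_divide_distrib sum_divide_distrib)
    finally show ?thesis by (simp add: power2_eq_square)
  qed
  have sub: "(\<Inter>p\<in>?I. incr i g p -` {b * (s p * a p)<..} \<inter> space M) \<subseteq> {\<omega> \<in> space M. \<forall>k<P i. b < state i k e \<omega>}" for b
  proof safe
    fix \<omega> k assume ex: "\<omega> \<in> (\<Inter>p\<in>?I. incr i g p -` {b * (s p * a p)<..} \<inter> space M)" and k: "k < P i"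
    have ex': "b * (s p * a p) < incr i g p \<omega>" if "p \<in> ?I" for p
      using ex that by blast
    have ne: "((i, k), 0) \<in> ?I" using k by (simp add: incr_idx_iff)
    then have \<omega>: "\<omega> \<in> space M" using ex by blast
    have "b = b * ((\<Sum>l<i. len l / P l) + e / P i) / v"
      using v by (simp add: v_def avg_var_def)
    also have "\<dots> = (\<Sum>l<i. b * (s ((l, k mod P l), 0) * a ((l, k mod P l), 0))) + b * (s ((i, k), 0) * a ((i, k), 0))"
      by (simp add: a_def s2 power2_eq_square[symmetric] sum_distrib_left sum_divide_distrib distrib_left add_divide_distrib)
    also have "\<dots> < (\<Sum>l<i. incr i g ((l, k mod P l), 0) \<omega>) + incr i g ((i, k), 0) \<omega>"
    proof (rule add_le_less_mono)
      have "((l, k mod P l), 0) \<in> ?I" if "l < i" for l using that i P_pos[of l] by (simp add: incr_idx_iff)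
      then show "(\<Sum>l<i. b * (s ((l, k mod P l), 0) * a ((l, k mod P l), 0))) \<le> (\<Sum>l<i. incr i g ((l, k mod P l), 0) \<omega>)"
        using ex' by (intro sum_mono less_imp_le) auto
      show "b * (s ((i, k), 0) * a ((i, k), 0)) < incr i g ((i, k), 0) \<omega>" using ne by (rule ex')
    qed
    also have "\<dots> = state i k (g 1) \<omega>"
      using state_eq_vec_state[of g i k \<omega> 1] g i k \<omega> by (simp add: vec_state_def time_grid_def)
    finally show "b < state i k e \<omega>" by (simp add: g_def)
  next
    fix \<omega> assume "\<omega> \<in> (\<Inter>p\<in>?I. incr i g p -` {b * (s p * a p)<..} \<inter> space M)"
    moreover have "((i, 0), 0) \<in> ?I" using P_pos[OF i] by (simp add: incr_idx_iff)
    ultimately show "\<omega> \<in> space M" by blast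
  qed
  have "exp (- (b\<^sup>2 / (2 * v)) - (\<Sum>p\<in>?I. a p) * b - (\<Sum>p\<in>?I. 1 / 2 + ln (sqrt (2 * pi))))
      \<le> prob {\<omega> \<in> space M. \<forall>k<P i. b < state i k e \<omega>}" if b: "0 \<le> b" for b
  proof -
    have "- (b\<^sup>2 / (2 * v)) = (\<Sum>p\<in>?I. - (b * a p)\<^sup>2 / 2)"
      using a2 by (simp add: power_mult_distrib sum_negf sum_distrib_left[symmetric] sum_divide_distrib[symmetric])
    then have "- (b\<^sup>2 / (2 * v)) - (\<Sum>p\<in>?I. a p) * b - (\<Sum>p\<in>?I. 1 / 2 + ln (sqrt (2 * pi)))
        = (\<Sum>p\<in>?I. - (b * a p + 1)\<^sup>2 / 2 - ln (sqrt (2 * pi)))"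
      by (simp only: sum_distrib_right sum_subtractf[symmetric]) (rule sum.cong, simp_all add: power2_eq_square field_simps)
    then have "exp (- (b\<^sup>2 / (2 * v)) - (\<Sum>p\<in>?I. a p) * b - (\<Sum>p\<in>?I. 1 / 2 + ln (sqrt (2 * pi))))
        = (\<Prod>p\<in>?I. exp (- (b * a p + 1)\<^sup>2 / 2) / sqrt (2 * pi))"
      by (simp add: exp_sum finite_incr_idx exp_diff)
    also have "\<dots> \<le> (\<Prod>p\<in>?I. prob (incr i g p -` {b * (s p * a p)<..} \<inter> space M))"
    proof (rule prod_mono, intro conjI)
      fix p assume p: "p \<in> ?I"
      have "0 \<le> b * (s p * a p)" using b s[OF p] v by (simp add: a_def)
      from normal_tail_lower[OF incr_distributed[OF i g p] incr_sd_pos[OF i g p] this]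
      show "exp (- (b * a p + 1)\<^sup>2 / 2) / sqrt (2 * pi) \<le> prob (incr i g p -` {b * (s p * a p)<..} \<inter> space M)"
        using s[OF p] by (simp add: s_def[symmetric] vimage_def Int_def conj_commute)
    qed simp
    also have "\<dots> = prob (\<Inter>p\<in>?I. incr i g p -` {b * (s p * a p)<..} \<inter> space M)"
    proof (rule indep_varsD_finite[OF incr_indep[OF i g], symmetric])
      have "((i, 0), 0) \<in> ?I" using P_pos[OF i] by (simp add: incr_idx_iff)
      then show "?I \<noteq> {}" by blast
    qed (auto simp: finite_incr_idx)
    also have "\<dots> \<le> prob {\<omega> \<in> space M. \<forall>k<P i. b < state i k e \<omega>}"
    proof (rule finite_measure_mono[OF sub])
      have "{\<omega> \<in> space M. \<forall>k\<in>{..<P i}. b < state i k e \<omega>} \<in> events"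
      proof (rule sets.sets_Collect_finite_All)
        fix k assume "k \<in> {..<P i}"
        then have [measurable]: "state i k e \<in> borel_measurable M" using i e by (intro state_measurable) auto
        show "{\<omega> \<in> space M. b < state i k e \<omega>} \<in> events" by measurable
      qed simp
      then show "{\<omega> \<in> space M. \<forall>k<P i. b < state i k e \<omega>} \<in> events" by (simp only: Ball_def lessThan_iff)
    qed
    finally show ?thesis .
  qed
  then show ?thesis by (rule that[unfolded v_def[symmetric]])
qed

end
context brownian_tree_at_0 begin

section \<open>Maximal inequalities\<close>

lemma time_grid_mono:
  assumes g: "time_grid g m" shows "a \<le> b \<Longrightarrow> b \<le> m \<Longrightarrow> g a \<le> g b"
proof (induction b rule: dec_induct)
  case (step n)
  then have "g n < g (Suc n)" using g by (simp add: time_grid_def)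
  then show ?case using step by simp
qed simp

lemma time_grid_strict_mono:
  assumes g: "time_grid g m" and "a < b" "b \<le> m" shows "g a < g b"
proof -
  have "g a < g (Suc a)" using assms by (simp add: time_grid_def)
  also have "\<dots> \<le> g b" using assms by (intro time_grid_mono[OF g]) auto
  finally show ?thesis .
qed

lemma sets_Collect_all_less:
  fixes n :: nat
  assumes "\<And>k. k < n \<Longrightarrow> {\<omega> \<in> space A. Q k \<omega>} \<in> sets A"
  shows "{\<omega> \<in> space A. \<forall>k<n. Q k \<omega>} \<in> sets A"
proof -
  have "{\<omega> \<in> space A. \<forall>k\<in>{..<n}. Q k \<omega>} \<in> sets A"
    using assms by (intro sets.sets_Collect_finite_All finite_lessThan) (simp only: lessThan_iff)
  then show ?thesis by (simp only: Ball_def lessThan_iff)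
qed

text \<open>
  The increments are independent and symmetric, so each of the \<open>P i\<close> signs costs a factor \<open>1 / 2\<close>.
\<close>

lemma future_increments_prob:
  assumes i: "i \<le> \<eta>" and g: "time_grid g m" and j: "1 \<le> j" "j \<le> m"
  shows "(1 / 2) ^ P i \<le> prob {\<omega> \<in> space M. \<forall>k<P i. 0 \<le> W i k (g m) \<omega> - W i k (g j) \<omega>}"
proof (cases "j = m")
  case True
  then show ?thesis by (simp add: prob_space power_le_one)
next
  case False
  define g' where "g' = (\<lambda>n::nat. if n = 0 then 0 else if n = 1 then g j else g m)"
  have "0 < g j" using time_grid_strict_mono[OF g, of 0 j] j g by (simp add: time_grid_def)
  moreover have "g j < g m" using time_grid_strict_mono[OF g, of j m] j False by simp
  ultimately have g': "time_grid g' 2" by (auto simp: time_grid_def g'_def less_2_cases_iff)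
  let ?J = "(\<lambda>k. ((i, k), 1 :: nat)) ` {..<P i}"
  have J: "?J \<subseteq> incr_idx i 2" by (auto simp: incr_idx_iff)
  have inc: "incr i g' ((i, k), 1) \<omega> = W i k (g m) \<omega> - W i k (g j) \<omega>" for k \<omega>
    by (simp add: incr_def level_grid_def g'_def)
  have half: "1 / 2 \<le> prob (incr i g' p -` {0..} \<inter> space M)" if "p \<in> incr_idx i 2" for p
    using normal_ge_0_prob[OF incr_distributed[OF i g' that] incr_sd_pos[OF i g' that]]
    by (simp add: vimage_def Int_def conj_commute)
  have "(1 / 2 :: real) ^ P i = (\<Prod>p\<in>?J. 1 / 2)"
    by (simp add: card_image inj_on_def)
  also have "\<dots> \<le> (\<Prod>p\<in>?J. prob (incr i g' p -` {0..} \<inter> space M))"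
    using half J by (intro prod_mono) auto
  also have "\<dots> = prob (\<Inter>p\<in>?J. incr i g' p -` {0..} \<inter> space M)"
    using J P_pos[OF i] by (intro indep_varsD[OF incr_indep[OF i g'], symmetric]) auto
  also have "(\<Inter>p\<in>?J. incr i g' p -` {0..} \<inter> space M) = {\<omega> \<in> space M. \<forall>k<P i. 0 \<le> W i k (g m) \<omega> - W i k (g j) \<omega>}"
    using P_pos[OF i] inc by auto
  finally show ?thesis .
qed

lemma vec_state_restrict:
  assumes "\<And>l. l < i \<Longrightarrow> ((l, k mod P l), 0) \<in> J" "\<And>j'. j' < j \<Longrightarrow> ((i, k), j') \<in> J"
  shows "vec_state i (restrict v J) j k = vec_state i v j k"
  using assms by (simp add: vec_state_def)

text \<open>
  Levy's inequality for the tree: when the states exceed \<open>b\<close> for the first time on the grid, they still do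
  so at the end of the grid if all remaining increments are nonnegative, and these are independent of the
  past. The event on \<open>W i k0 (g 1)\<close> is part of the past of each grid time in question and can be carried
  along.
\<close>

lemma end_ge_passage:
  assumes i: "i \<le> \<eta>" and g: "time_grid g m" and k0: "k0 < P i" and B: "B \<in> sets borel"
  shows "(1 / 2) ^ P i * prob {\<omega> \<in> space M. (\<exists>j\<in>{1..m}. \<forall>k<P i. b < state i k (g j) \<omega>) \<and> W i k0 (g 1) \<omega> \<in> B}
    \<le> prob {\<omega> \<in> space M. (\<forall>k<P i. b < state i k (g m) \<omega>) \<and> W i k0 (g 1) \<omega> \<in> B}"
proof -
  define \<phi> where "\<phi> j v \<longleftrightarrow> (\<forall>k<P i. b < vec_state i v (Suc j) k) \<and> v ((i, k0), 0) \<in> B" for j v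
  define A where "A j = {\<omega> \<in> space M. (\<forall>k<P i. b < state i k (g (Suc j)) \<omega>) \<and> W i k0 (g 1) \<omega> \<in> B}" for j
  define F where "F j = {\<omega> \<in> space M. \<forall>k<P i. 0 \<le> W i k (g m) \<omega> - W i k (g (Suc j)) \<omega>}" for j
  let ?E = "{\<omega> \<in> space M. (\<forall>k<P i. b < state i k (g m) \<omega>) \<and> W i k0 (g 1) \<omega> \<in> B}"
  have g0: "g 0 = 0" using g by (simp add: time_grid_def)
  have A_iff: "\<omega> \<in> A j \<longleftrightarrow> \<phi> j (\<lambda>p. incr i g p \<omega>)" if "\<omega> \<in> space M" for j \<omega>
  proof -
    have "incr i g ((i, k0), 0) \<omega> = W i k0 (g 1) \<omega>"
      using sum_incr_top_level[of g i k0 \<omega> 1] g0 i k0 that by simp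
    then show ?thesis
      using that state_eq_vec_state[of g i _ \<omega> "Suc j"] g0 i by (simp add: A_def \<phi>_def)
  qed
  have tg: "0 \<le> g j" if "j \<le> m" for j using time_grid_nonneg[OF g that] .
  have Wm: "W i k (g j) \<in> borel_measurable M" if "k < P i" "j \<le> m" for k j
    using W_measurable[OF i that(1) tg[OF that(2)]] .
  have A_ev': "{\<omega> \<in> space M. (\<forall>k<P i. b < state i k (g j) \<omega>) \<and> W i k0 (g 1) \<omega> \<in> B} \<in> events" if "j \<le> m" "1 \<le> m" for j
  proof (intro sets.sets_Collect_conj sets_Collect_all_less)
    fix k assume "k < P i"
    then have [measurable]: "state i k (g j) \<in> borel_measurable M" using i tg[OF that(1)] by (intro state_measurable) auto
    show "{\<omega> \<in> space M. b < state i k (g j) \<omega>} \<in> events" by measurable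
  next
    show "{\<omega> \<in> space M. W i k0 (g 1) \<omega> \<in> B} \<in> events"
      using measurable_sets[OF Wm[OF k0 that(2)] B] by (simp add: vimage_def Int_def conj_commute)
  qed
  have A_ev: "A j \<in> events" if "j < m" for j
    unfolding A_def by (rule A_ev') (use that in auto)
  have F_ev: "F j \<in> events" if "j < m" for j
    unfolding F_def
  proof (rule sets_Collect_all_less)
    fix k assume "k < P i"
    then have [measurable]: "W i k (g m) \<in> borel_measurable M" "W i k (g (Suc j)) \<in> borel_measurable M"
      using that by (auto intro!: Wm)
    show "{\<omega> \<in> space M. 0 \<le> W i k (g m) \<omega> - W i k (g (Suc j)) \<omega>} \<in> events" by measurable
  qed
  have q: "(1 / 2) ^ P i * prob (disjointed A j) \<le> prob (disjointed A j \<inter> F j)" if j: "j < m" for j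
  proof -
    define past where "past = {p \<in> incr_idx i m. fst (fst p) < i \<or> snd p < Suc j}"
    define fut where "fut = incr_idx i m - past"
    define S where "S = {v \<in> space (Pi\<^sub>M past (\<lambda>_. borel)). \<phi> j v \<and> (\<forall>j'<j. \<not> \<phi> j' v)}"
    (* F j in terms of the future increments, which telescope. *)
    define S' where "S' = {v \<in> space (Pi\<^sub>M fut (\<lambda>_. borel)). \<forall>k<P i. 0 \<le> (\<Sum>j'\<in>{Suc j..<m}. v ((i, k), j') :: real)}"
    have inp: "((l, k mod P l), 0) \<in> past" if "l < i" for l k
      using that i P_pos[of l] by (simp add: past_def incr_idx_iff)
    have inp2: "((i, k), j') \<in> past" if "k < P i" "j' < Suc j" for k j'
      using that j by (simp add: past_def incr_idx_iff)
    have inf: "((i, k), j') \<in> fut" if "k < P i" "j' \<in> {Suc j..<m}" for k j'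
      using that by (simp add: past_def fut_def incr_idx_iff)
    have \<phi>_restrict: "\<phi> j' (restrict v past) = \<phi> j' v" if "j' \<le> j" for j' v
    proof -
      have "vec_state i (restrict v past) (Suc j') k = vec_state i v (Suc j') k" if "k < P i" for k
        using \<open>j' \<le> j\<close> that by (intro vec_state_restrict inp inp2) auto
      then show ?thesis using inp2[OF k0, of 0] by (simp add: \<phi>_def)
    qed
    have \<phi>_meas: "{v \<in> space (Pi\<^sub>M past (\<lambda>_. borel)). \<phi> j' v} \<in> sets (Pi\<^sub>M past (\<lambda>_. borel))" if "j' \<le> j" for j'
      unfolding \<phi>_def
    proof (intro sets.sets_Collect_conj sets_Collect_all_less)
      fix k assume "k < P i"
      then have [measurable]: "(\<lambda>v. vec_state i v (Suc j') k) \<in> borel_measurable (Pi\<^sub>M past (\<lambda>_. borel))"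
        using that by (intro vec_state_measurable inp inp2) auto
      show "{v \<in> space (Pi\<^sub>M past (\<lambda>_. borel)). b < vec_state i v (Suc j') k} \<in> sets (Pi\<^sub>M past (\<lambda>_. borel))"
        by measurable
    next
      have "(\<lambda>v. v ((i, k0), 0)) \<in> borel_measurable (Pi\<^sub>M past (\<lambda>_. borel))"
        by (rule measurable_component_singleton) (use inp2[OF k0] in simp)
      from measurable_sets[OF this B]
      show "{v \<in> space (Pi\<^sub>M past (\<lambda>_. borel)). v ((i, k0), 0) \<in> B} \<in> sets (Pi\<^sub>M past (\<lambda>_. borel))"
        by (simp add: vimage_def Int_def conj_commute)
    qed
    have S: "S \<in> sets (Pi\<^sub>M past (\<lambda>_. borel))"
      unfolding S_def by (intro sets.sets_Collect_conj sets_Collect_all_less sets.sets_Collect_neg \<phi>_meas) auto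
    have S': "S' \<in> sets (Pi\<^sub>M fut (\<lambda>_. borel))"
      unfolding S'_def
    proof (rule sets_Collect_all_less)
      fix k assume k: "k < P i"
      have [measurable]: "(\<lambda>v. \<Sum>j'\<in>{Suc j..<m}. v ((i, k), j') :: real) \<in> borel_measurable (Pi\<^sub>M fut (\<lambda>_. borel))"
        using inf[OF k] by (intro borel_measurable_sum measurable_component_singleton) auto
      show "{v \<in> space (Pi\<^sub>M fut (\<lambda>_. borel)). 0 \<le> (\<Sum>j'\<in>{Suc j..<m}. v ((i, k), j') :: real)} \<in> sets (Pi\<^sub>M fut (\<lambda>_. borel))"
        by measurable
    qed
    let ?X = "\<lambda>\<omega>. restrict (\<lambda>p. incr i g p \<omega>) past" and ?Y = "\<lambda>\<omega>. restrict (\<lambda>p. incr i g p \<omega>) fut"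
    have ind: "indep_var (Pi\<^sub>M past (\<lambda>_. borel)) ?X (Pi\<^sub>M fut (\<lambda>_. borel)) ?Y"
      by (rule indep_var_restrict[OF incr_indep[OF i g]]) (auto simp: past_def fut_def)
    have eqA: "disjointed A j = ?X -` S \<inter> space M"
    proof -
      have "\<omega> \<in> disjointed A j \<longleftrightarrow> ?X \<omega> \<in> S" if "\<omega> \<in> space M" for \<omega>
        using A_iff[OF that] \<phi>_restrict[of j "\<lambda>p. incr i g p \<omega>"] \<phi>_restrict[of _ "\<lambda>p. incr i g p \<omega>"]
        by (auto simp: disjointed_def S_def space_PiM)
      moreover have "disjointed A j \<subseteq> space M" using disjointed_subset[of A j] by (auto simp: A_def)
      ultimately show ?thesis by blast
    qed
    have eqF: "F j = ?Y -` S' \<inter> space M"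
    proof -
      have "(\<Sum>j'\<in>{Suc j..<m}. ?Y \<omega> ((i, k), j')) = W i k (g m) \<omega> - W i k (g (Suc j)) \<omega>" if k: "k < P i" for k \<omega>
      proof -
        have "(\<Sum>j'\<in>{Suc j..<m}. ?Y \<omega> ((i, k), j')) = (\<Sum>j'\<in>{Suc j..<m}. W i k (g (Suc j')) \<omega> - W i k (g j') \<omega>)"
          using inf[OF k] by (intro sum.cong) (auto simp: incr_def level_grid_def)
        also have "\<dots> = W i k (g m) \<omega> - W i k (g (Suc j)) \<omega>"
          using sum_Suc_diff'[of "Suc j" m "\<lambda>j. W i k (g j) \<omega>"] j by simp
        finally show ?thesis .
      qed
      then show ?thesis by (auto simp: F_def S'_def space_PiM)
    qed
    have "disjointed A j \<inter> F j = (\<lambda>\<omega>. (?X \<omega>, ?Y \<omega>)) -` (S \<times> S') \<inter> space M"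
      unfolding eqA eqF by auto
    then have "prob (disjointed A j \<inter> F j) = prob (disjointed A j) * prob (F j)"
      using indep_varD[OF ind S S'] unfolding eqA eqF by simp
    moreover have "(1 / 2) ^ P i \<le> prob (F j)"
      unfolding F_def using j by (intro future_increments_prob[OF i g]) auto
    ultimately show ?thesis
      by (metis measure_nonneg mult.commute mult_left_mono)
  qed
  show ?thesis
  proof (cases "m = 0")
    case False
    have "{\<omega> \<in> space M. (\<exists>j\<in>{1..m}. \<forall>k<P i. b < state i k (g j) \<omega>) \<and> W i k0 (g 1) \<omega> \<in> B} = (\<Union>j<m. A j)"
    proof (intro set_eqI iffI)
      fix \<omega> assume "\<omega> \<in> {\<omega> \<in> space M. (\<exists>j\<in>{1..m}. \<forall>k<P i. b < state i k (g j) \<omega>) \<and> W i k0 (g 1) \<omega> \<in> B}"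
      then obtain j where "1 \<le> j" "j \<le> m" "\<omega> \<in> space M" "\<forall>k<P i. b < state i k (g j) \<omega>" "W i k0 (g 1) \<omega> \<in> B" by auto
      then show "\<omega> \<in> (\<Union>j<m. A j)" by (auto simp: A_def intro!: bexI[of _ "j - 1"])
    qed (auto simp: A_def)
    moreover have "(1 / 2) ^ P i * prob (\<Union>j<m. A j) \<le> prob ?E"
    proof (rule first_passage_bound[OF A_ev F_ev _ _ q])
      show "?E \<in> events" using False by (intro A_ev') auto
      show "A j \<inter> F j \<subseteq> ?E" for j
        by (auto simp: A_def F_def state_def) (metis add_le_cancel_left order_less_le_trans)
    qed
    ultimately show ?thesis by (simp only:)
  qed simp
qed

end
context brownian_tree_at_0 begin

lemma passage_bound:
  assumes "i \<le> \<eta>" "time_grid g m" "k0 < P i" "B \<in> sets borel"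
  shows "prob {\<omega> \<in> space M. (\<exists>j\<in>{1..m}. \<forall>k<P i. b < state i k (g j) \<omega>) \<and> W i k0 (g 1) \<omega> \<in> B}
    \<le> 2 ^ P i * prob {\<omega> \<in> space M. (\<forall>k<P i. b < state i k (g m) \<omega>) \<and> W i k0 (g 1) \<omega> \<in> B}"
  using mult_left_mono[OF end_ge_passage[OF assms, of b], of "2 ^ P i"]
  by (simp add: mult.assoc[symmetric] power_mult_distrib[symmetric])

lemma avg_var_mono: "i \<le> \<eta> \<Longrightarrow> e \<le> e' \<Longrightarrow> avg_var i e \<le> avg_var i e'"
  by (simp add: avg_var_def divide_right_mono)

lemma drift_bound: "0 \<le> t \<Longrightarrow> t \<le> T \<Longrightarrow> u - \<bar>c\<bar> * T \<le> u + c * t"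
  using mult_mono[of "\<bar>c\<bar>" "\<bar>c\<bar>" t T] abs_ge_minus_self[of "c * t"] by (simp add: abs_mult)

lemma state_less_events:
  assumes "i \<le> \<eta>" "k < P i" "0 \<le> s" shows "{\<omega> \<in> space M. b < state i k s \<omega>} \<in> events"
proof -
  have [measurable]: "state i k s \<in> borel_measurable M" using assms by (rule state_measurable)
  show ?thesis by measurable
qed

lemma passage_events:
  fixes g :: "nat \<Rightarrow> real" and J :: "nat set"
  assumes i: "i \<le> \<eta>" and J: "finite J" "\<And>j. j \<in> J \<Longrightarrow> 0 \<le> g j" and k0: "k0 < P i" "0 \<le> s" and B: "B \<in> sets borel"
  shows "{\<omega> \<in> space M. (\<exists>j\<in>J. \<forall>k<P i. b < state i k (g j) \<omega>) \<and> W i k0 s \<omega> \<in> B} \<in> events"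
proof (rule sets.sets_Collect_conj)
  have "{\<omega> \<in> space M. \<forall>k<P i. b < state i k (g j) \<omega>} \<in> events" if "j \<in> J" for j
    by (rule sets_Collect_all_less) (rule state_less_events[OF i _ J(2)[OF that]])
  then show "{\<omega> \<in> space M. \<exists>j\<in>J. \<forall>k<P i. b < state i k (g j) \<omega>} \<in> events"
    by (intro sets.sets_Collect_finite_Ex J(1))
  show "{\<omega> \<in> space M. W i k0 s \<omega> \<in> B} \<in> events"
    using measurable_sets[OF W_measurable[OF i k0] B] by (simp add: vimage_def Int_def conj_commute)
qed

text \<open>
  The inequality of Levy replaces the exceedance at some time by the one at the last grid time, and the
  Chernoff bound with the optimal \<open>lam = u / avg_var i e\<close> applies there. The drift only changes the
  level by at most \<open>\<bar>c\<bar> * T\<close>.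
\<close>

lemma exceed_early_bound:
  assumes i: "i \<le> \<eta>" and e: "0 < e" "\<tau> i + e \<le> T" and u: "0 \<le> u"
  shows "prob (exceed u i 0 e) \<le> 2 ^ P i * exp (- (u\<^sup>2 / (2 * avg_var i e)) + u * (\<bar>c\<bar> * T / avg_var i e))"
    (is "_ \<le> ?R")
proof (rule LIMSEQ_le_const2[OF exceed_grid_limit[OF i order.refl e(1)]], intro exI allI impI)
  fix n :: nat assume n: "1 \<le> n"
  define v where "v = avg_var i e"
  have v: "0 < v" using avg_var_pos[OF i e(1)] by (simp add: v_def)
  define m where "m = (2 ^ n - 1 :: nat)"
  have "2 ^ 1 \<le> (2 ^ n :: nat)" using n by (intro power_increasing) auto
  then have m: "1 \<le> m" "m < 2 ^ n" by (auto simp: m_def)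
  define g where "g = dyadic 0 e n"
  have g: "time_grid g m" using e by (auto simp: time_grid_def g_def dyadic_def field_simps)
  have gin: "g j \<in> {0<..<e}" if "1 \<le> j" "j \<le> m" for j
    unfolding g_def using that m by (intro dyadic_in[OF e(1)]) auto
  define b where "b = u - \<bar>c\<bar> * T"
  have ev: "{\<omega> \<in> space M. (\<exists>j\<in>{1..m}. \<forall>k<P i. b < state i k (g j) \<omega>) \<and> W i 0 (g 1) \<omega> \<in> UNIV} \<in> events"
  proof (rule passage_events[OF i])
    show "0 \<le> g j" if "j \<in> {1..m}" for j using gin[of j] that by auto
    show "0 \<le> g 1" using gin[of 1] m by auto
  qed (use P_pos[OF i] in auto)
  have "prob (exceed_grid u i 0 e n)
      \<le> prob {\<omega> \<in> space M. (\<exists>j\<in>{1..m}. \<forall>k<P i. b < state i k (g j) \<omega>) \<and> W i 0 (g 1) \<omega> \<in> UNIV}"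
  proof (rule finite_measure_mono[OF _ ev], rule subsetI)
    fix \<omega> assume "\<omega> \<in> exceed_grid u i 0 e n"
    then obtain j where j: "\<omega> \<in> space M" "1 \<le> j" "j < 2 ^ n" "\<forall>k<P i. u + c * (\<tau> i + g j) < state i k (g j) \<omega>"
      by (auto simp: exceed_grid_def g_def)
    then have jm: "j \<le> m" by (simp add: m_def)
    then have "b \<le> u + c * (\<tau> i + g j)"
      unfolding b_def using j gin[of j] e tau_nonneg[OF i] by (intro drift_bound) auto
    then have "\<forall>k<P i. b < state i k (g j) \<omega>" using j by fastforce
    then show "\<omega> \<in> {\<omega> \<in> space M. (\<exists>j\<in>{1..m}. \<forall>k<P i. b < state i k (g j) \<omega>) \<and> W i 0 (g 1) \<omega> \<in> UNIV}"
      using j jm by (auto intro!: bexI[of _ j])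
  qed
  also have "\<dots> \<le> 2 ^ P i * prob {\<omega> \<in> space M. (\<forall>k<P i. b < state i k (g m) \<omega>) \<and> W i 0 (g 1) \<omega> \<in> UNIV}"
    by (rule passage_bound[OF i g P_pos[OF i]]) simp
  also have "prob {\<omega> \<in> space M. (\<forall>k<P i. b < state i k (g m) \<omega>) \<and> W i 0 (g 1) \<omega> \<in> UNIV}
      \<le> exp (((u / v)\<^sup>2 * avg_var i (g m)) / 2 - u / v * b)"
    using level_chernoff[OF i, of "g m / 2" "g m" "u / v" 0 b 0 0] gin[of m] m v u P_pos[OF i] by simp
  also have "\<dots> \<le> exp (- (u\<^sup>2 / (2 * v)) + u * (\<bar>c\<bar> * T / v))"
  proof -
    have "(u / v)\<^sup>2 * avg_var i (g m) \<le> (u / v)\<^sup>2 * v"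
      unfolding v_def using gin[of m] m by (intro mult_left_mono avg_var_mono[OF i]) auto
    also have "\<dots> = u\<^sup>2 / v" using v by (simp add: power2_eq_square)
    finally have "(u / v)\<^sup>2 * avg_var i (g m) / 2 - u / v * b \<le> u\<^sup>2 / v / 2 - u / v * b" by simp
    also have "\<dots> = - (u\<^sup>2 / (2 * v)) + u * (\<bar>c\<bar> * T / v)"
      using v by (simp add: b_def field_simps power2_eq_square)
    finally show ?thesis by simp
  qed
  finally show "prob (exceed_grid u i 0 e n) \<le> ?R"
    by (simp add: v_def)
qed

text \<open>
  A first step from \<open>0\<close> to \<open>h\<close>, followed by the dyadic grid on \<open>[h, q]\<close>: the value at time \<open>h\<close>, whose law will
  be changed, becomes a single increment.
\<close>

definition late_grid :: "real \<Rightarrow> real \<Rightarrow> nat \<Rightarrow> nat \<Rightarrow> real" where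
  "late_grid h q n j = (if j = 0 then 0 else dyadic h q n (j - 1))"

lemma late_grid_time_grid: "0 < h \<Longrightarrow> h < q \<Longrightarrow> time_grid (late_grid h q n) m"
  by (auto simp: time_grid_def late_grid_def dyadic_def field_simps gr0_conv_Suc)

text \<open>
  The regression of \<open>W \<eta> k h\<close> on the final average has slope \<open>z0\<close>, so on a late exceedance of the level
  \<open>u\<close> it should be close to \<open>u * z0\<close>. An additional tilt \<open>\<theta> * u\<close> of \<open>W \<eta> k h'\<close> gains
  \<open>\<theta> * \<rho> * u\<^sup>2\<close> and costs at most \<open>\<theta>\<^sup>2 * h * u\<^sup>2\<close> in the exponent, which makes a deviation by
  \<open>\<rho> * u\<close> exponentially less likely. The delay \<open>h' - h\<close> only enters through \<open>u\<^sup>2 * (h' - h)\<close>, which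
  is constant in the application.
\<close>

lemma late_deviation_bound:
  fixes u h q \<delta> \<rho> L v :: real
  defines "v \<equiv> avg_var \<eta> (T - \<tau> \<eta>)" and "z0 \<equiv> h / (P \<eta> * avg_var \<eta> (T - \<tau> \<eta>))"
  assumes u: "0 < u" and h: "0 < h" "h \<le> h'" "h' \<le> 2 * h" "h' < q" "q \<le> T - \<tau> \<eta>" and \<rho>: "0 < \<rho>"
  shows "prob (exceed_grid u \<eta> h' q n - {\<omega> \<in> space M. \<forall>k<P \<eta>. \<bar>W \<eta> k h' \<omega> - u * z0\<bar> \<le> \<rho> * u})
    \<le> P \<eta> * 2 ^ P \<eta> * 2 * exp (- (u\<^sup>2 / (2 * v)) - u\<^sup>2 * (\<rho>\<^sup>2 / (4 * h))
         + \<rho> * (u\<^sup>2 * (h' - h)) / (2 * h * P \<eta> * v) + u * (\<bar>c\<bar> * T / v))"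
    (is "prob (_ - ?G) \<le> _ * exp ?x")
proof (cases "n = 0")
  case True
  then show ?thesis by (simp add: exceed_grid_def)
next
  case False
  have h': "0 < h'" using h by simp
  have v: "0 < v" unfolding v_def using h by (intro avg_var_pos) auto
  define b where "b = u - \<bar>c\<bar> * T"
  define g where "g = late_grid h' q n"
  define m where "m = (2 ^ n :: nat)"
  have "2 ^ 1 \<le> (2 ^ n :: nat)" using False by (intro power_increasing) auto
  then have m: "2 \<le> m" by (auto simp: m_def)
  have g: "time_grid g m" unfolding g_def using h' h by (intro late_grid_time_grid)
  have g1: "g 1 = h'" by (simp add: g_def late_grid_def dyadic_def)
  have gj: "g (Suc j) = dyadic h' q n j" for j by (simp add: g_def late_grid_def)
  have gm: "h' < g m" "g m < q"
    using dyadic_in[OF h(4), of "m - 1" n] m gj[of "m - 1"] by (auto simp: m_def)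
  define B where "B = {w. \<rho> * u < \<bar>w - u * z0\<bar>}"
  have B: "B \<in> sets borel" by (simp add: B_def)
  (* The minimiser of theta^2 * h - theta * rho. *)
  define \<theta> where "\<theta> = \<rho> / (2 * h)"
  have \<theta>: "0 < \<theta>" using \<rho> h by (simp add: \<theta>_def)
  have gn: "0 \<le> g j" if "j \<le> m" for j using time_grid_nonneg[OF g that] .
  have Wm[measurable]: "W \<eta> k h' \<in> borel_measurable M" if "k < P \<eta>" for k
    using that h' by (intro W_measurable) auto
  have end_bound: "prob {\<omega> \<in> space M. (\<forall>k<P \<eta>. b < state \<eta> k (g m) \<omega>) \<and> W \<eta> k0 (g 1) \<omega> \<in> B} \<le> 2 * exp ?x"
    if k0: "k0 < P \<eta>" for k0
  proof -
    (* Both signs of the deviation at once: sg = 1 above, sg = -1 below. *)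
    have one: "prob {\<omega> \<in> space M. (\<forall>k<P \<eta>. b < state \<eta> k (g m) \<omega>) \<and> sg * \<theta> * u * u * (z0 + sg * \<rho>) \<le> (sg * \<theta> * u) * W \<eta> k0 h' \<omega>}
        \<le> exp ?x" if sg: "sg \<in> {1, -1}" for sg :: real
    proof -
      have "prob {\<omega> \<in> space M. (\<forall>k<P \<eta>. b < state \<eta> k (g m) \<omega>) \<and> sg * \<theta> * u * u * (z0 + sg * \<rho>) \<le> (sg * \<theta> * u) * W \<eta> k0 h' \<omega>}
         \<le> exp (((u / v)\<^sup>2 * avg_var \<eta> (g m) + 2 * (u / v) * (sg * \<theta> * u) * h' / P \<eta> + (sg * \<theta> * u)\<^sup>2 * h') / 2
              - (u / v * b + sg * \<theta> * u * u * (z0 + sg * \<rho>)))"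
        using u v k0 gm h' by (intro level_chernoff) auto
      also have "\<dots> \<le> exp ?x"
      proof -
        have "avg_var \<eta> (g m) \<le> v"
          unfolding v_def using gm h by (intro avg_var_mono) auto
        then have 1: "(u / v)\<^sup>2 * avg_var \<eta> (g m) \<le> (u / v)\<^sup>2 * v" by (intro mult_left_mono) auto
        have 2: "(sg * \<theta> * u)\<^sup>2 * h' \<le> (\<theta> * u)\<^sup>2 * (2 * h)"
          using sg h by (auto intro!: mult_left_mono simp: power_mult_distrib)
        have z0: "z0 = h / (P \<eta> * v)" by (simp add: z0_def v_def)
        have 3: "sg * (\<theta> * u * u * (h' - h) / (P \<eta> * v)) \<le> \<theta> * u * u * (h' - h) / (P \<eta> * v)"
          using sg \<theta> u h v by (auto intro: order.trans[of _ 0])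
        have sg2: "sg * sg = 1" using sg by auto
        have eq4: "u / v * (sg * \<theta> * u) * h' / P \<eta> - sg * \<theta> * u * u * (z0 + sg * \<rho>)
            = sg * (\<theta> * u * u * (h' - h) / (P \<eta> * v)) - \<theta> * u * u * \<rho>"
        proof -
          have "sg * \<theta> * u * u * (z0 + sg * \<rho>) = sg * \<theta> * u * u * z0 + (sg * sg) * \<theta> * u * u * \<rho>"
            by (simp add: algebra_simps)
          then have "sg * \<theta> * u * u * (z0 + sg * \<rho>) = sg * \<theta> * u * u * (h / (P \<eta> * v)) + \<theta> * u * u * \<rho>"
            unfolding sg2 z0 by simp
          then show ?thesis by (simp add: right_diff_distrib diff_divide_distrib mult_ac)
        qed
        have eq5: "(\<theta> * u)\<^sup>2 * (2 * h) / 2 - \<theta> * u * u * \<rho> = - (u\<^sup>2 * (\<rho>\<^sup>2 / (4 * h)))"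
          using h by (simp add: \<theta>_def power2_eq_square field_simps)
        have eq6: "\<theta> * u * u * (h' - h) / (P \<eta> * v) = \<rho> * (u\<^sup>2 * (h' - h)) / (2 * h * P \<eta> * v)"
          by (simp add: \<theta>_def power2_eq_square)
        have eq7: "(u / v)\<^sup>2 * v / 2 - u / v * b = - (u\<^sup>2 / (2 * v)) + u * (\<bar>c\<bar> * T / v)"
          using v by (simp add: b_def field_simps power2_eq_square)
        have "((u / v)\<^sup>2 * avg_var \<eta> (g m) + 2 * (u / v) * (sg * \<theta> * u) * h' / P \<eta> + (sg * \<theta> * u)\<^sup>2 * h') / 2
              - (u / v * b + sg * \<theta> * u * u * (z0 + sg * \<rho>))
            = (u / v)\<^sup>2 * avg_var \<eta> (g m) / 2 - u / v * b + (sg * \<theta> * u)\<^sup>2 * h' / 2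
              + (u / v * (sg * \<theta> * u) * h' / P \<eta> - sg * \<theta> * u * u * (z0 + sg * \<rho>))"
          by (simp add: add_divide_distrib)
        also have "\<dots> \<le> ?x"
          using 1 2 3 eq4 eq5 eq6 eq7 by linarith
        finally show ?thesis by simp
      qed
      finally show ?thesis .
    qed
    let ?H = "\<lambda>sg. {\<omega> \<in> space M. (\<forall>k<P \<eta>. b < state \<eta> k (g m) \<omega>) \<and> sg * \<theta> * u * u * (z0 + sg * \<rho>) \<le> (sg * \<theta> * u) * W \<eta> k0 h' \<omega>}"
    have H_ev: "?H sg \<in> events" for sg
    proof (intro sets.sets_Collect_conj sets_Collect_all_less state_less_events order.refl gn)
      have [measurable]: "W \<eta> k0 h' \<in> borel_measurable M" using Wm[OF k0] .
      show "{\<omega> \<in> space M. sg * \<theta> * u * u * (z0 + sg * \<rho>) \<le> (sg * \<theta> * u) * W \<eta> k0 h' \<omega>} \<in> events" by measurable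
    qed
    have "prob {\<omega> \<in> space M. (\<forall>k<P \<eta>. b < state \<eta> k (g m) \<omega>) \<and> W \<eta> k0 (g 1) \<omega> \<in> B} \<le> prob (?H 1 \<union> ?H (- 1))"
    proof (rule finite_measure_mono)
      have imp: "sg * \<theta> * u * u * (z0 + sg * \<rho>) \<le> (sg * \<theta> * u) * w" if "u * (z0 + sg * \<rho>) * sg \<le> sg * w" for sg w
        using mult_left_mono[OF that, of "\<theta> * u"] \<theta> u by (simp add: algebra_simps)
      have "u * (z0 + 1 * \<rho>) * 1 \<le> 1 * w \<or> u * (z0 + - 1 * \<rho>) * - 1 \<le> - 1 * w" if "w \<in> B" for w
        using that by (auto simp: B_def algebra_simps abs_if split: if_splits)
      then have "1 * \<theta> * u * u * (z0 + 1 * \<rho>) \<le> (1 * \<theta> * u) * w \<or> - 1 * \<theta> * u * u * (z0 + - 1 * \<rho>) \<le> (- 1 * \<theta> * u) * w"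
        if "w \<in> B" for w
        using imp[of 1 w] imp[of "- 1" w] that by blast
      then show "{\<omega> \<in> space M. (\<forall>k<P \<eta>. b < state \<eta> k (g m) \<omega>) \<and> W \<eta> k0 (g 1) \<omega> \<in> B} \<subseteq> ?H 1 \<union> ?H (- 1)"
        unfolding g1 by blast
    qed (intro sets.Un H_ev)
    also have "\<dots> \<le> prob (?H 1) + prob (?H (- 1))" by (rule measure_Un_le[OF H_ev H_ev])
    also have "\<dots> \<le> 2 * exp ?x" using one[of 1] one[of "- 1"] by simp
    finally show ?thesis .
  qed
  let ?A = "\<lambda>k0. {\<omega> \<in> space M. (\<exists>j\<in>{1..m}. \<forall>k<P \<eta>. b < state \<eta> k (g j) \<omega>) \<and> W \<eta> k0 (g 1) \<omega> \<in> B}"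
  have A_ev: "?A k0 \<in> events" if k0: "k0 < P \<eta>" for k0
  proof (rule passage_events[OF order.refl _ _ k0 _ B])
    show "0 \<le> g j" if "j \<in> {1..m}" for j using gn[of j] that by auto
    show "0 \<le> g 1" using gn[of 1] m by auto
  qed simp
  have "prob (exceed_grid u \<eta> h' q n - ?G) \<le> prob (\<Union>k0<P \<eta>. ?A k0)"
  proof (rule finite_measure_mono, rule subsetI)
    fix \<omega> assume "\<omega> \<in> exceed_grid u \<eta> h' q n - ?G"
    then obtain j k0 where \<omega>: "\<omega> \<in> space M" and j: "1 \<le> j" "j < 2 ^ n" and
      ex: "\<forall>k<P \<eta>. u + c * (\<tau> \<eta> + dyadic h' q n j) < state \<eta> k (dyadic h' q n j) \<omega>"
      and k0: "k0 < P \<eta>" "\<rho> * u < \<bar>W \<eta> k0 h' \<omega> - u * z0\<bar>"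
      by (auto simp: exceed_grid_def not_le)
    have "dyadic h' q n j \<in> {h'<..<q}" by (rule dyadic_in[OF h(4) j])
    then have "b \<le> u + c * (\<tau> \<eta> + dyadic h' q n j)"
      unfolding b_def using h tau_nonneg[of \<eta>] by (intro drift_bound) auto
    then have "\<forall>k<P \<eta>. b < state \<eta> k (g (Suc j)) \<omega>" unfolding gj using ex by fastforce
    moreover have "Suc j \<in> {1..m}" using j by (simp add: m_def)
    ultimately have "\<omega> \<in> ?A k0" using \<omega> k0 by (simp only: g1 B_def mem_Collect_eq) blast
    then show "\<omega> \<in> (\<Union>k0<P \<eta>. ?A k0)" using k0 by blast
  qed (intro sets.finite_UN finite_lessThan A_ev, simp)
  also have "\<dots> \<le> (\<Sum>k0<P \<eta>. prob (?A k0))"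
    by (rule finite_measure_subadditive_finite[OF finite_lessThan]) (rule image_subsetI, rule A_ev, simp)
  also have "\<dots> \<le> (\<Sum>k0<P \<eta>. 2 ^ P \<eta> * (2 * exp ?x))"
  proof (rule sum_mono)
    fix k0 assume "k0 \<in> {..<P \<eta>}"
    then have k0: "k0 < P \<eta>" by simp
    have "prob (?A k0) \<le> 2 ^ P \<eta> * prob {\<omega> \<in> space M. (\<forall>k<P \<eta>. b < state \<eta> k (g m) \<omega>) \<and> W \<eta> k0 (g 1) \<omega> \<in> B}"
      by (rule passage_bound[OF order.refl g k0 B])
    also have "\<dots> \<le> 2 ^ P \<eta> * (2 * exp ?x)"
      using end_bound[OF k0] by (intro mult_left_mono) auto
    finally show "prob (?A k0) \<le> 2 ^ P \<eta> * (2 * exp ?x)" .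
  qed
  also have "\<dots> = P \<eta> * 2 ^ P \<eta> * 2 * exp ?x" by simp
  finally show ?thesis .
qed

end

section \<open>Change of measure in the last level\<close>

text \<open>
  The density of \<open>N(0, h)\<close> divided by that of \<open>N(- c \<delta>, h + \<delta>)\<close>, at the point \<open>w - c * \<delta>\<close>. The mean
  \<open>- c \<delta>\<close> compensates the drift that accumulates during a delay \<open>\<delta>\<close>.
\<close>

definition shift_ratio :: "real \<Rightarrow> real \<Rightarrow> real \<Rightarrow> real \<Rightarrow> real" where
  "shift_ratio c h \<delta> w = sqrt ((h + \<delta>) / h) * exp (w\<^sup>2 / (2 * (h + \<delta>)) - (w - c * \<delta>)\<^sup>2 / (2 * h))"

lemma shift_ratio_nonneg: "0 < h \<Longrightarrow> 0 < \<delta> \<Longrightarrow> 0 \<le> shift_ratio c h \<delta> w"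
  by (simp add: shift_ratio_def)

lemma shift_ratio_measurable[measurable]: "shift_ratio c h \<delta> \<in> borel_measurable borel"
  unfolding shift_ratio_def[abs_def] by measurable

lemma normal_density_shift_ratio:
  assumes "0 < h" "0 < \<delta>"
  shows "normal_density 0 (sqrt h) x = shift_ratio c h \<delta> (x + c * \<delta>) * normal_density (- c * \<delta>) (sqrt (h + \<delta>)) x"
proof -
  have "exp ((x + c * \<delta>)\<^sup>2 / (2 * (h + \<delta>)) - x\<^sup>2 / (2 * h)) * exp (- (x + c * \<delta>)\<^sup>2 / (2 * (h + \<delta>))) = exp (- x\<^sup>2 / (2 * h))"
    by (simp add: exp_add[symmetric])
  moreover have "1 / sqrt (2 * pi * h) = sqrt ((h + \<delta>) / h) * (1 / sqrt (2 * pi * (h + \<delta>)))"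
    using assms by (simp add: real_sqrt_divide real_sqrt_mult)
  ultimately show ?thesis
    using assms by (simp add: normal_density_def shift_ratio_def)
qed

text \<open>
  The bound exceeds the exponent of the ratio by a multiple of a complete square.
\<close>

lemma shift_ratio_le:
  assumes "0 < h" "0 < \<delta>"
  shows "shift_ratio c h \<delta> w \<le> sqrt ((h + \<delta>) / h) * exp (c\<^sup>2 * \<delta> / 2)"
proof -
  have "c\<^sup>2 * \<delta> / 2 - (w\<^sup>2 / (2 * (h + \<delta>)) - (w - c * \<delta>)\<^sup>2 / (2 * h)) = \<delta> * (w - c * (h + \<delta>))\<^sup>2 / (2 * h * (h + \<delta>))"
    using assms by (simp add: divide_simps add_pos_pos[THEN less_imp_neq, THEN not_sym] power2_eq_square) (simp add: algebra_simps)
  also have "\<dots> \<ge> 0" using assms by simp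
  finally show ?thesis
    unfolding shift_ratio_def using assms by (intro mult_left_mono) auto
qed

text \<open>
  For \<open>\<delta> = D / u\<^sup>2\<close> and \<open>w = u * z\<close> the ratio is a function of \<open>1 / u\<close> and \<open>z\<close> that extends
  continuously to \<open>1 / u = 0\<close>, where only the Gaussian term in \<open>z\<close> remains.
\<close>

lemma shift_ratio_limit:
  fixes D h z0 c \<epsilon> :: real
  assumes D: "0 < D" and h: "0 < h" and \<epsilon>: "0 < \<epsilon>"
  obtains \<rho> where "0 < \<rho>"
    "\<forall>\<^sub>F u in at_top. \<forall>z. \<bar>z - z0\<bar> \<le> \<rho> \<longrightarrow> \<bar>shift_ratio c h (D / u\<^sup>2) (u * z) - exp (- D * z0\<^sup>2 / (2 * h\<^sup>2))\<bar> \<le> \<epsilon>"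
proof -
  define \<Phi> where "\<Phi> x = sqrt ((h + D * (fst x)\<^sup>2) / h) * exp (- D * (snd x)\<^sup>2 / (2 * h * (h + D * (fst x)\<^sup>2))
     + snd x * c * D * fst x / h - c\<^sup>2 * D\<^sup>2 * (fst x) ^ 4 / (2 * h))" for x :: "real \<times> real"
  (* In Phi the first coordinate stands for 1 / u, so that D * (fst x)^2 is the delay. *)
  have "isCont \<Phi> (0, z0)"
    unfolding \<Phi>_def using h by (intro continuous_intros) auto
  moreover have \<Phi>0: "\<Phi> (0, z0) = exp (- D * z0\<^sup>2 / (2 * h\<^sup>2))"
    using h by (simp add: \<Phi>_def power2_eq_square)
  ultimately obtain d where d: "0 < d" "\<And>x. dist x (0, z0) < d \<Longrightarrow> dist (\<Phi> x) (exp (- D * z0\<^sup>2 / (2 * h\<^sup>2))) < \<epsilon>"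
    unfolding continuous_at_eps_delta using \<epsilon> by metis
  have \<Phi>u: "\<Phi> (1 / u, z) = shift_ratio c h (D / u\<^sup>2) (u * z)" if u: "0 < u" for u z
  proof -
    define \<delta> where "\<delta> = D / u\<^sup>2"
    have \<delta>: "0 < \<delta>" "u\<^sup>2 * \<delta> = D" "D * (1 / u)\<^sup>2 = \<delta>" using u D by (auto simp: \<delta>_def power_divide)
    have hd: "h + \<delta> \<noteq> 0" using \<delta> h by simp
    have "(u * z)\<^sup>2 / (2 * (h + \<delta>)) - (u * z)\<^sup>2 / (2 * h) = - (u\<^sup>2 * \<delta>) * z\<^sup>2 / (2 * h * (h + \<delta>))"
      using h hd by (simp add: divide_simps power_mult_distrib) (simp add: algebra_simps)
    moreover have "(u * z)\<^sup>2 / (2 * h) - (u * z - c * \<delta>)\<^sup>2 / (2 * h) = u * z * c * \<delta> / h - c\<^sup>2 * \<delta>\<^sup>2 / (2 * h)"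
      using h by (simp add: divide_simps power2_eq_square) (simp add: algebra_simps)
    moreover have "u * z * c * \<delta> / h = z * c * D * (1 / u) / h"
      using u unfolding \<delta>(2)[symmetric] by (simp add: power2_eq_square)
    moreover have "c\<^sup>2 * \<delta>\<^sup>2 / (2 * h) = c\<^sup>2 * D\<^sup>2 * (1 / u) ^ 4 / (2 * h)"
      using u by (simp add: \<delta>_def power_divide power_mult[symmetric])
    ultimately have "(u * z)\<^sup>2 / (2 * (h + \<delta>)) - (u * z - c * \<delta>)\<^sup>2 / (2 * h)
        = - D * z\<^sup>2 / (2 * h * (h + \<delta>)) + z * c * D * (1 / u) / h - c\<^sup>2 * D\<^sup>2 * (1 / u) ^ 4 / (2 * h)"
      unfolding \<delta>(2) by simp
    then show ?thesis
      unfolding shift_ratio_def \<Phi>_def \<delta>_def[symmetric] fst_conv snd_conv \<delta>(3) by simp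
  qed
  have "\<forall>\<^sub>F u in at_top. \<forall>z. \<bar>z - z0\<bar> \<le> d / 2 \<longrightarrow> \<bar>shift_ratio c h (D / u\<^sup>2) (u * z) - exp (- D * z0\<^sup>2 / (2 * h\<^sup>2))\<bar> \<le> \<epsilon>"
    using eventually_gt_at_top[of "max 0 (2 / d)"]
  proof eventually_elim
    case (elim u)
    then have "0 < u" "2 / d < u" by auto
    then have u: "0 < u" "1 / u < d / 2" using d(1) by (auto simp: field_simps)
    show ?case
    proof (intro allI impI)
      fix z assume z: "\<bar>z - z0\<bar> \<le> d / 2"
      have "dist (1 / u, z) (0, z0) \<le> dist (1 / u) 0 + dist z z0"
        unfolding dist_Pair_Pair by (rule sqrt_sum_squares_le_sum) auto
      also have "\<dots> < d" using u z by (simp add: dist_real_def)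
      finally show "\<bar>shift_ratio c h (D / u\<^sup>2) (u * z) - exp (- D * z0\<^sup>2 / (2 * h\<^sup>2))\<bar> \<le> \<epsilon>"
        using d(2)[of "(1 / u, z)"] \<Phi>u[OF u(1), of z] by (simp add: dist_real_def)
    qed
  qed
  then show ?thesis using d(1) by (intro that[of "d / 2"]) auto
qed

context brownian_tree_at_0 begin

definition top_ratio :: "real \<Rightarrow> real \<Rightarrow> 'a \<Rightarrow> real" where
  "top_ratio h \<delta> \<omega> = (\<Prod>k<P \<eta>. shift_ratio c h \<delta> (W \<eta> k (h + \<delta>) \<omega>))"

text \<open>
  If the initial value \<open>W \<eta> k h\<close> of each motion is replaced by \<open>W \<eta> k (h + \<delta>) - c * \<delta>\<close> and the later
  increments by the same increments after a delay \<open>\<delta>\<close>, then the functional for exceedance on the grid of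
  \<open>[h, q]\<close> turns into the one for the delayed grid. Only the laws of the initial values change.
\<close>

lemma exceed_grid_change_of_measure:
  assumes h: "0 < h" "h < q" and \<delta>: "0 < \<delta>"
  shows "emeasure M (exceed_grid u \<eta> h q n)
    = (\<integral>\<^sup>+\<omega>. ennreal (top_ratio h \<delta> \<omega>) * indicator (exceed_grid u \<eta> (h + \<delta>) (q + \<delta>) n) \<omega> \<partial>M)"
proof -
  let ?m = "2 ^ n :: nat"
  define g where "g = late_grid h q n"
  define g' where "g' = late_grid (h + \<delta>) (q + \<delta>) n"
  have dy: "dyadic (h + \<delta>) (q + \<delta>) n j = dyadic h q n j + \<delta>" for j by (simp add: dyadic_def)
  have gS: "g (Suc j) = dyadic h q n j" "g' (Suc j) = dyadic h q n j + \<delta>" "g 0 = 0" "g' 0 = 0" for j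
    by (simp_all add: g_def g'_def late_grid_def dy)
  have g: "time_grid g ?m" unfolding g_def using h by (rule late_grid_time_grid)
  have g': "time_grid g' ?m" unfolding g'_def using h \<delta> by (intro late_grid_time_grid) auto
  let ?I = "incr_idx \<eta> ?m"
  define top0 where "top0 p \<longleftrightarrow> fst (fst p) = \<eta> \<and> snd p = 0" for p :: "(nat \<times> nat) \<times> nat"
  define X where "X = incr \<eta> g"
  define Y where "Y p \<omega> = incr \<eta> g' p \<omega> - (if top0 p then c * \<delta> else 0)" for p \<omega>
  define r where "r p x = (if top0 p then shift_ratio c h \<delta> (x + c * \<delta>) else 1)" for p x
  define fX where "fX p = normal_density 0 (incr_sd \<eta> g p)" for p
  define fY where "fY p = normal_density (if top0 p then - c * \<delta> else 0) (incr_sd \<eta> g' p)" for p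
  have I_top: "{p \<in> ?I. top0 p} = (\<lambda>k. ((\<eta>, k), 0)) ` {..<P \<eta>}"
    by (auto simp: top0_def incr_idx_iff image_iff)
  have I0: "((\<eta>, 0), 0) \<in> ?I" using P_pos[of \<eta>] by (simp add: incr_idx_iff)
  (* The index is Suc j because grid point 0 of late_grid is time 0. *)
  define S where "S = {v \<in> space (Pi\<^sub>M ?I (\<lambda>_. borel)). \<exists>j\<in>{1..<2 ^ n}. \<forall>k<P \<eta>.
     u + c * (\<tau> \<eta> + dyadic h q n j) < vec_state \<eta> v (Suc j) k}"
  have idx: "((l, k mod P l), 0) \<in> ?I" if "l < \<eta>" for l k
    using that P_pos[of l] by (simp add: incr_idx_iff)
  have idx2: "((\<eta>, k), j') \<in> ?I" if "k < P \<eta>" "j' < ?m" for k j'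
    using that by (simp add: incr_idx_iff)
  have S: "S \<in> sets (Pi\<^sub>M ?I (\<lambda>_. borel))"
    unfolding S_def
  proof (intro sets.sets_Collect_finite_Ex finite_atLeastLessThan sets_Collect_all_less)
    fix j k :: nat assume j: "j \<in> {1..<2 ^ n}" and k: "k < P \<eta>"
    have [measurable]: "(\<lambda>v. vec_state \<eta> v (Suc j) k) \<in> borel_measurable (Pi\<^sub>M ?I (\<lambda>_. borel))"
      using j k by (intro vec_state_measurable idx idx2) auto
    show "{v \<in> space (Pi\<^sub>M ?I (\<lambda>_. borel)). u + c * (\<tau> \<eta> + dyadic h q n j) < vec_state \<eta> v (Suc j) k}
        \<in> sets (Pi\<^sub>M ?I (\<lambda>_. borel))" by measurable
  qed
  have S_iff: "restrict v ?I \<in> S \<longleftrightarrow> (\<exists>j\<in>{1..<2 ^ n}. \<forall>k<P \<eta>.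
     u + c * (\<tau> \<eta> + dyadic h q n j) < vec_state \<eta> v (Suc j) k)" for v
  proof -
    have "vec_state \<eta> (restrict v ?I) (Suc j) k = vec_state \<eta> v (Suc j) k" if "j \<in> {1..<2 ^ n}" "k < P \<eta>" for j k
      using that by (intro vec_state_restrict idx idx2) auto
    then show ?thesis by (simp add: S_def space_PiM)
  qed
  have vX: "vec_state \<eta> (\<lambda>p. X p \<omega>) (Suc j) k = state \<eta> k (dyadic h q n j) \<omega>"
    if "k < P \<eta>" "\<omega> \<in> space M" for j k \<omega>
    unfolding X_def gS(1)[symmetric] using that by (intro state_eq_vec_state[symmetric] gS) auto
  have EX: "exceed_grid u \<eta> h q n = {\<omega> \<in> space M. (\<lambda>p\<in>?I. X p \<omega>) \<in> S}"
    unfolding exceed_grid_def S_iff by (intro Collect_cong conj_cong bex_cong refl) (simp add: vX)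
  have vY: "vec_state \<eta> (\<lambda>p. Y p \<omega>) (Suc j) k = state \<eta> k (dyadic h q n j + \<delta>) \<omega> - c * \<delta>"
    if "k < P \<eta>" "\<omega> \<in> space M" for j k \<omega>
  proof -
    have "(\<Sum>j'<Suc j. Y ((\<eta>, k), j') \<omega>) = (\<Sum>j'<Suc j. incr \<eta> g' ((\<eta>, k), j') \<omega>) - c * \<delta>"
      unfolding Y_def sum_subtractf by (simp add: top0_def del: sum.lessThan_Suc)
    moreover have "(\<Sum>l<\<eta>. Y ((l, k mod P l), 0) \<omega>) = (\<Sum>l<\<eta>. incr \<eta> g' ((l, k mod P l), 0) \<omega>)"
      by (intro sum.cong) (auto simp: Y_def top0_def)
    ultimately have "vec_state \<eta> (\<lambda>p. Y p \<omega>) (Suc j) k = vec_state \<eta> (\<lambda>p. incr \<eta> g' p \<omega>) (Suc j) k - c * \<delta>"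
      unfolding vec_state_def by simp
    also have "vec_state \<eta> (\<lambda>p. incr \<eta> g' p \<omega>) (Suc j) k = state \<eta> k (g' (Suc j)) \<omega>"
      using that by (intro state_eq_vec_state[symmetric] gS) auto
    finally show ?thesis by (simp only: gS)
  qed
  have EY: "exceed_grid u \<eta> (h + \<delta>) (q + \<delta>) n = {\<omega> \<in> space M. (\<lambda>p\<in>?I. Y p \<omega>) \<in> S}"
    unfolding exceed_grid_def S_iff dy
    by (intro Collect_cong conj_cong bex_cong refl) (simp add: vY less_diff_eq distrib_left add.assoc)
  have ratio: "(\<Prod>p\<in>?I. r p (Y p \<omega>)) = top_ratio h \<delta> \<omega>" if \<omega>: "\<omega> \<in> space M" for \<omega>
  proof -
    have "(\<Prod>p\<in>?I. r p (Y p \<omega>)) = (\<Prod>p\<in>{p \<in> ?I. top0 p}. r p (Y p \<omega>))"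
      by (rule prod.mono_neutral_right[OF finite_incr_idx]) (auto simp: r_def)
    also have "\<dots> = (\<Prod>k<P \<eta>. r ((\<eta>, k), 0) (Y ((\<eta>, k), 0) \<omega>))"
      unfolding I_top by (subst prod.reindex) (auto simp: inj_on_def)
    also have "\<dots> = top_ratio h \<delta> \<omega>"
      unfolding top_ratio_def
      by (intro prod.cong) (auto simp: r_def Y_def top0_def incr_def level_grid_def dyadic_def gS W_0[OF order.refl _ \<omega>])
    finally show ?thesis .
  qed
  have "emeasure M {\<omega> \<in> space M. (\<lambda>p\<in>?I. X p \<omega>) \<in> S}
     = (\<integral>\<^sup>+\<omega>. ennreal (\<Prod>p\<in>?I. r p (Y p \<omega>)) * indicator {\<omega> \<in> space M. (\<lambda>p\<in>?I. Y p \<omega>) \<in> S} \<omega> \<partial>M)"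
  proof (rule indep_change_of_measure[where f = fX and g = fY, OF finite_incr_idx])
    show "?I \<noteq> {}" using I0 by blast
    show "indep_vars (\<lambda>_. borel) X ?I" unfolding X_def by (rule incr_indep[OF order.refl g])
    have "indep_vars (\<lambda>_. borel) (\<lambda>p \<omega>. (\<lambda>x. x - (if top0 p then c * \<delta> else 0)) (incr \<eta> g' p \<omega>)) ?I"
      by (rule indep_vars_compose2[OF incr_indep[OF order.refl g']]) simp
    then show "indep_vars (\<lambda>_. borel) Y ?I" by (simp add: Y_def[abs_def])
    show "r p \<in> borel_measurable borel" for p unfolding r_def by (cases "top0 p") simp_all
    show "0 \<le> r p x" for p x using h \<delta> by (simp add: r_def shift_ratio_nonneg)
    show "0 \<le> fY p x" for p x by (simp add: fY_def)
    show "distributed M lborel (X p) (\<lambda>x. ennreal (fX p x))" if "p \<in> ?I" for p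
      unfolding X_def fX_def by (rule incr_distributed[OF order.refl g that])
    show "distributed M lborel (Y p) (\<lambda>x. ennreal (fY p x))" if "p \<in> ?I" for p
      using normal_density_affine[OF incr_distributed[OF order.refl g' that] incr_sd_pos[OF order.refl g' that],
          of 1 "- (if top0 p then c * \<delta> else 0)"]
      by (cases "top0 p") (simp_all add: Y_def[abs_def] fY_def)
    show "fX p x = r p x * fY p x" if p: "p \<in> ?I" for p x
    proof (cases "top0 p")
      case True
      then obtain k where "p = ((\<eta>, k), 0)" by (metis top0_def prod.collapse)
      then have "incr_sd \<eta> g p = sqrt h" "incr_sd \<eta> g' p = sqrt (h + \<delta>)"
        by (simp_all add: incr_sd_def level_grid_def dyadic_def gS)
      then show ?thesis using True normal_density_shift_ratio[OF h(1) \<delta>] by (simp add: fX_def fY_def r_def)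
    next
      case False
      obtain l k j where lkj: "p = ((l, k), j)" by (metis prod.collapse)
      have "incr_sd \<eta> g p = incr_sd \<eta> g' p"
      proof (cases "l < \<eta>")
        case True
        then show ?thesis by (simp add: lkj incr_sd_def level_grid_def)
      next
        case False
        then have "l = \<eta>" "j \<noteq> 0" using p \<open>\<not> top0 p\<close> by (auto simp: lkj incr_idx_iff top0_def)
        then show ?thesis by (cases j) (simp_all add: lkj incr_sd_def level_grid_def gS)
      qed
      then show ?thesis using False by (simp add: fX_def fY_def r_def)
    qed
  qed (rule S)
  also have "\<dots> = (\<integral>\<^sup>+\<omega>. ennreal (top_ratio h \<delta> \<omega>) * indicator {\<omega> \<in> space M. (\<lambda>p\<in>?I. Y p \<omega>) \<in> S} \<omega> \<partial>M)"
    by (intro nn_integral_cong) (simp add: ratio)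
  finally show ?thesis unfolding EX EY .
qed

text \<open>
  The likelihood ratio is controlled precisely on the good event \<open>G\<close> and crudely by \<open>C\<close> elsewhere. All
  bounds are uniform in the grid, so they survive the refinement of the grid.
\<close>

lemma exceed_compare:
  assumes h: "0 < h" "h < q" and \<delta>: "0 < \<delta>" and G: "G \<in> events"
    and C: "0 \<le> C" "\<And>\<omega>. top_ratio h \<delta> \<omega> \<le> C"
    and r: "0 \<le> r1" "\<And>\<omega>. \<omega> \<in> G \<Longrightarrow> r1 \<le> top_ratio h \<delta> \<omega>" "0 \<le> r2" "\<And>\<omega>. \<omega> \<in> G \<Longrightarrow> top_ratio h \<delta> \<omega> \<le> r2"
    and bad: "\<And>n. prob (exceed_grid u \<eta> (h + \<delta>) (q + \<delta>) n - G) \<le> \<epsilon>"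
  shows "prob (exceed u \<eta> h q) \<le> r2 * prob (exceed u \<eta> (h + \<delta>) (q + \<delta>)) + C * \<epsilon>"
    and "r1 * (prob (exceed u \<eta> (h + \<delta>) (q + \<delta>)) - \<epsilon>) \<le> prob (exceed u \<eta> h q)"
proof -
  let ?E = "exceed_grid u \<eta> h q" and ?E' = "exceed_grid u \<eta> (h + \<delta>) (q + \<delta>)"
  have E': "?E' n \<in> events" for n using h \<delta> by (intro exceed_grid_events) auto
  have lim: "(\<lambda>n. prob (?E n)) \<longlonglongrightarrow> prob (exceed u \<eta> h q)"
    using h by (intro exceed_grid_limit) auto
  have lim': "(\<lambda>n. prob (?E' n)) \<longlonglongrightarrow> prob (exceed u \<eta> (h + \<delta>) (q + \<delta>))"
    using h \<delta> by (intro exceed_grid_limit) auto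
  have upper: "prob (?E n) \<le> r2 * prob (?E' n) + C * \<epsilon>" for n
  proof -
    have "emeasure M (?E n) = (\<integral>\<^sup>+\<omega>. ennreal (top_ratio h \<delta> \<omega>) * indicator (?E' n) \<omega> \<partial>M)"
      by (rule exceed_grid_change_of_measure[OF h \<delta>])
    also have "\<dots> \<le> (\<integral>\<^sup>+\<omega>. ennreal r2 * indicator (?E' n) \<omega> + ennreal C * indicator (?E' n - G) \<omega> \<partial>M)"
      using r C by (intro nn_integral_mono) (auto simp: indicator_def intro!: ennreal_leI add_increasing)
    also have "\<dots> = ennreal r2 * emeasure M (?E' n) + ennreal C * emeasure M (?E' n - G)"
      using E' G by (subst nn_integral_add) (auto simp: nn_integral_cmult_indicator)
    also have "\<dots> = ennreal (r2 * prob (?E' n) + C * prob (?E' n - G))"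
      using r C by (simp add: emeasure_eq_measure ennreal_mult ennreal_plus)
    finally have "prob (?E n) \<le> r2 * prob (?E' n) + C * prob (?E' n - G)"
      unfolding emeasure_eq_measure using r C by (subst (asm) ennreal_le_iff) auto
    also have "C * prob (?E' n - G) \<le> C * \<epsilon>" using bad C by (intro mult_left_mono)
    finally show ?thesis by simp
  qed
  then show "prob (exceed u \<eta> h q) \<le> r2 * prob (exceed u \<eta> (h + \<delta>) (q + \<delta>)) + C * \<epsilon>"
    by (intro LIMSEQ_le[OF lim tendsto_add[OF tendsto_mult_left[OF lim'] tendsto_const]]) auto
  have lower: "r1 * (prob (?E' n) - \<epsilon>) \<le> prob (?E n)" for n
  proof -
    have "prob (?E' n) = prob (?E' n \<inter> G) + prob (?E' n - G)"
      using E'[of n] G by (metis finite_measure_Diff' Int_commute add.commute diff_add_cancel)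
    then have "r1 * (prob (?E' n) - \<epsilon>) \<le> r1 * prob (?E' n \<inter> G)"
      using bad[of n] r by (intro mult_left_mono) auto
    moreover have "ennreal (r1 * prob (?E' n \<inter> G)) \<le> emeasure M (?E n)"
    proof -
      have "ennreal (r1 * prob (?E' n \<inter> G)) = (\<integral>\<^sup>+\<omega>. ennreal r1 * indicator (?E' n \<inter> G) \<omega> \<partial>M)"
        using E' G r by (subst nn_integral_cmult_indicator) (auto simp: emeasure_eq_measure ennreal_mult)
      also have "\<dots> \<le> (\<integral>\<^sup>+\<omega>. ennreal (top_ratio h \<delta> \<omega>) * indicator (?E' n) \<omega> \<partial>M)"
        using r by (intro nn_integral_mono) (auto simp: indicator_def intro!: ennreal_leI)
      also have "\<dots> = emeasure M (?E n)" by (rule exceed_grid_change_of_measure[OF h \<delta>, symmetric])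
      finally show ?thesis .
    qed
    then have "r1 * prob (?E' n \<inter> G) \<le> prob (?E n)"
      using r by (simp add: emeasure_eq_measure)
    ultimately show ?thesis by linarith
  qed
  then show "r1 * (prob (exceed u \<eta> (h + \<delta>) (q + \<delta>)) - \<epsilon>) \<le> prob (exceed u \<eta> h q)"
    by (intro LIMSEQ_le[OF tendsto_mult_left[OF tendsto_diff[OF lim' tendsto_const]] lim]) auto
qed

end

section \<open>Asymptotics\<close>

lemma gaussian_decay:
  fixes \<alpha> \<beta> \<gamma> A :: real
  assumes "0 < \<alpha>" shows "((\<lambda>u. A * exp (- \<alpha> * u\<^sup>2 + \<beta> * u + \<gamma>)) \<longlongrightarrow> 0) at_top"
proof -
  have "LIM u at_top. u * (\<alpha> * u - \<beta>) :> at_top"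
  proof (intro filterlim_at_top_mult_at_top filterlim_ident)
    show "LIM u at_top. \<alpha> * u - \<beta> :> at_top"
      using filterlim_tendsto_add_at_top[OF tendsto_const filterlim_tendsto_pos_mult_at_top[OF tendsto_const assms filterlim_ident], of "- \<beta>"]
      by simp
  qed
  then have "LIM u at_top. - (u * (\<alpha> * u - \<beta>)) :> at_bot"
    by (simp add: filterlim_uminus_at_bot)
  then have "((\<lambda>u. exp (- (u * (\<alpha> * u - \<beta>)))) \<longlongrightarrow> 0) at_top"
    by (rule filterlim_compose[OF exp_at_bot])
  then have "((\<lambda>u. A * exp \<gamma> * exp (- (u * (\<alpha> * u - \<beta>)))) \<longlongrightarrow> 0) at_top"
    by (rule tendsto_mult_right_zero)
  also have "(\<lambda>u. A * exp \<gamma> * exp (- (u * (\<alpha> * u - \<beta>)))) = (\<lambda>u. A * exp (- \<alpha> * u\<^sup>2 + \<beta> * u + \<gamma>))"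
    by (simp add: fun_eq_iff mult.assoc exp_add[symmetric] power2_eq_square algebra_simps)
  finally show ?thesis .
qed

lemma power_bracket:
  fixes R \<kappa> :: real
  assumes "0 < R" "0 < \<kappa>"
  obtains \<epsilon> where "0 < \<epsilon>" "\<epsilon> \<le> R" "(R + \<epsilon>) ^ n \<le> R ^ n + \<kappa>" "R ^ n - \<kappa> \<le> (R - \<epsilon>) ^ n"
proof -
  have "isCont (\<lambda>x. x ^ n) R" by (intro continuous_intros)
  then obtain d where d: "0 < d" "\<And>x. dist x R < d \<Longrightarrow> dist (x ^ n) (R ^ n) < \<kappa>"
    unfolding continuous_at_eps_delta using assms(2) by metis
  define \<epsilon> where "\<epsilon> = min (d / 2) R"
  have e: "0 < \<epsilon>" "\<epsilon> \<le> R" "\<epsilon> < d" using d assms by (auto simp: \<epsilon>_def)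
  show ?thesis
    using e d(2)[of "R + \<epsilon>"] d(2)[of "R - \<epsilon>"] by (intro that[of \<epsilon>]) (auto simp: dist_real_def)
qed

lemma inv_square_small: "0 < d \<Longrightarrow> \<forall>\<^sub>F u in at_top. y / u\<^sup>2 < d" for y d :: real
proof -
  have "((\<lambda>u. y / u\<^sup>2) \<longlongrightarrow> 0) at_top"
    by (intro tendsto_divide_0[OF tendsto_const] filterlim_at_top_imp_at_infinity filterlim_pow_at_top filterlim_ident) simp
  then show "0 < d \<Longrightarrow> \<forall>\<^sub>F u in at_top. y / u\<^sup>2 < d" by (rule order_tendstoD)
qed

context brownian_tree_at_0 begin

abbreviation v0 :: real where "v0 \<equiv> avg_var \<eta> (T - \<tau> \<eta>)"

lemma v0_pos: "0 < v0"
  using tau_T by (intro avg_var_pos) auto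

text \<open>
  The product of \<open>N j\<close> over \<open>j > l\<close> is \<open>P \<eta> / P l\<close>, the number of leaves below a component of level \<open>l\<close>.
\<close>

lemma mu0_eq: "mu0 T \<eta> \<tau> N = P \<eta> * v0"
proof -
  have "real (\<Prod>j=Suc l..\<eta>. N j) = P \<eta> / P l" if "l < \<eta>" for l
  proof -
    have "{1..\<eta>} = {1..l} \<union> {Suc l..\<eta>}" using that by auto
    then have "P \<eta> = P l * (\<Prod>j=Suc l..\<eta>. N j)"
      unfolding offspring_prod_def by (simp only:) (rule prod.union_disjoint, auto)
    then show ?thesis using P_pos[of l] that by simp
  qed
  then have "(\<Sum>l<\<eta>. len l * real (\<Prod>j=Suc l..\<eta>. N j)) = P \<eta> * (\<Sum>l<\<eta>. len l / P l)"
    unfolding sum_distrib_left by (intro sum.cong) auto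
  then show ?thesis
    using P_pos[of \<eta>]
    by (simp add: mu0_def avg_var_def sum.atLeast1_atMost_eq len_def distrib_left)
qed

text \<open>
  On a late exceedance of \<open>u\<close> every initial value \<open>W \<eta> k (h + D / u\<^sup>2)\<close> is close to \<open>u * z0\<close>, where the
  likelihood ratio is close to \<open>R = exp (- D * z0\<^sup>2 / (2 * h\<^sup>2))\<close>. As \<open>z0 / h = 1 / mu0 T \<eta> \<tau> N\<close>, the
  product over the \<open>P \<eta>\<close> components is close to \<open>r\<close>, whatever the choice of \<open>h\<close>.
\<close>

lemma late_comparison:
  fixes h \<kappa> D :: real
  defines "r \<equiv> exp (- (D * P \<eta> / (2 * (mu0 T \<eta> \<tau> N)\<^sup>2)))"
  assumes h: "0 < h" "2 * h < T - \<tau> \<eta>" and \<kappa>: "0 < \<kappa>" and D: "0 < D"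
  obtains A K a where "1 / (2 * v0) < a"
    "\<forall>\<^sub>F u in at_top. \<forall>q. h < q \<and> q + D / u\<^sup>2 \<le> T - \<tau> \<eta> \<longrightarrow>
       prob (exceed u \<eta> h q) \<le> (r + \<kappa>) * prob (exceed u \<eta> (h + D / u\<^sup>2) (q + D / u\<^sup>2)) + A * exp (- a * u\<^sup>2 + K * u) \<and>
       (r - \<kappa>) * prob (exceed u \<eta> (h + D / u\<^sup>2) (q + D / u\<^sup>2)) - A * exp (- a * u\<^sup>2 + K * u) \<le> prob (exceed u \<eta> h q)"
proof -
  define z0 where "z0 = h / (P \<eta> * v0)"
  define R where "R = exp (- D * z0\<^sup>2 / (2 * h\<^sup>2))"
  have Ppos: "0 < P \<eta>" using P_pos[of \<eta>] by simp
  have Rr: "R ^ P \<eta> = r"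
    using h v0_pos Ppos by (simp add: R_def r_def z0_def mu0_eq exp_of_nat_mult[symmetric] power_divide mult.commute)
  have R: "0 < R" "R \<le> 1" using D by (auto simp: R_def)
  obtain \<epsilon> where \<epsilon>: "0 < \<epsilon>" "\<epsilon> \<le> R" "(R + \<epsilon>) ^ P \<eta> \<le> r + \<kappa>" "r - \<kappa> \<le> (R - \<epsilon>) ^ P \<eta>"
    using power_bracket[OF R(1) \<kappa>, of "P \<eta>"] unfolding Rr by metis
  obtain \<rho> where \<rho>: "0 < \<rho>" "\<forall>\<^sub>F u in at_top. \<forall>z. \<bar>z - z0\<bar> \<le> \<rho> \<longrightarrow> \<bar>shift_ratio c h (D / u\<^sup>2) (u * z) - R\<bar> \<le> \<epsilon>"
    using shift_ratio_limit[OF D h(1) \<epsilon>(1), of z0 c] unfolding R_def by blast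
  define C where "C = (sqrt 2 * exp (c\<^sup>2 * h / 2)) ^ P \<eta>"
  have C: "1 \<le> C"
  proof -
    have "1 * 1 \<le> sqrt 2 * exp (c\<^sup>2 * h / 2)" using h by (intro mult_mono) auto
    then show ?thesis unfolding C_def by (intro one_le_power) simp
  qed
  define A0 where "A0 = P \<eta> * 2 ^ P \<eta> * 2 * exp (\<rho> * D / (2 * h * P \<eta> * v0))"
  define a where "a = 1 / (2 * v0) + \<rho>\<^sup>2 / (4 * h)"
  define K where "K = \<bar>c\<bar> * T / v0"
  define err where "err u = A0 * exp (- a * u\<^sup>2 + K * u)" for u
  have err: "0 \<le> err u" for u by (simp add: err_def A0_def)
  have "\<forall>\<^sub>F u in at_top. D / u\<^sup>2 < h" using h(1) by (rule inv_square_small)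
  then have "\<forall>\<^sub>F u in at_top. \<forall>q. h < q \<and> q + D / u\<^sup>2 \<le> T - \<tau> \<eta> \<longrightarrow>
       prob (exceed u \<eta> h q) \<le> (r + \<kappa>) * prob (exceed u \<eta> (h + D / u\<^sup>2) (q + D / u\<^sup>2)) + C * A0 * exp (- a * u\<^sup>2 + K * u) \<and>
       (r - \<kappa>) * prob (exceed u \<eta> (h + D / u\<^sup>2) (q + D / u\<^sup>2)) - C * A0 * exp (- a * u\<^sup>2 + K * u) \<le> prob (exceed u \<eta> h q)"
    using \<rho>(2) eventually_gt_at_top[of 0]
  proof eventually_elim
    case (elim u)
    define \<delta> where "\<delta> = D / u\<^sup>2"
    have \<delta>: "0 < \<delta>" "\<delta> < h" "u\<^sup>2 * \<delta> = D" using elim D by (auto simp: \<delta>_def)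
    define G where "G = {\<omega> \<in> space M. \<forall>k<P \<eta>. \<bar>W \<eta> k (h + \<delta>) \<omega> - u * z0\<bar> \<le> \<rho> * u}"
    have G: "G \<in> events"
      unfolding G_def
    proof (rule sets_Collect_all_less)
      fix k assume "k < P \<eta>"
      then have [measurable]: "W \<eta> k (h + \<delta>) \<in> borel_measurable M" using h \<delta> by (intro W_measurable) auto
      show "{\<omega> \<in> space M. \<bar>W \<eta> k (h + \<delta>) \<omega> - u * z0\<bar> \<le> \<rho> * u} \<in> events" by measurable
    qed
    have near: "R - \<epsilon> \<le> shift_ratio c h \<delta> (W \<eta> k (h + \<delta>) \<omega>)" "shift_ratio c h \<delta> (W \<eta> k (h + \<delta>) \<omega>) \<le> R + \<epsilon>"
      if "\<omega> \<in> G" "k < P \<eta>" for \<omega> k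
    proof -
      define w where "w = W \<eta> k (h + \<delta>) \<omega>"
      have "\<bar>w - u * z0\<bar> \<le> \<rho> * u" using that by (simp add: G_def w_def)
      moreover have "w - u * z0 = u * (w / u - z0)" using elim by (simp add: field_simps)
      ultimately have "\<bar>w / u - z0\<bar> \<le> \<rho>" using elim by (simp add: abs_mult)
      then have "\<bar>shift_ratio c h \<delta> (u * (w / u)) - R\<bar> \<le> \<epsilon>" using elim(2) unfolding \<delta>_def by blast
      then have "\<bar>shift_ratio c h \<delta> w - R\<bar> \<le> \<epsilon>" using elim by simp
      then show "R - \<epsilon> \<le> shift_ratio c h \<delta> (W \<eta> k (h + \<delta>) \<omega>)" "shift_ratio c h \<delta> (W \<eta> k (h + \<delta>) \<omega>) \<le> R + \<epsilon>"
        unfolding w_def by linarith+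
    qed
    have upper: "top_ratio h \<delta> \<omega> \<le> (R + \<epsilon>) ^ P \<eta>" if "\<omega> \<in> G" for \<omega>
    proof -
      have "top_ratio h \<delta> \<omega> \<le> (\<Prod>k<P \<eta>. R + \<epsilon>)"
        unfolding top_ratio_def using near[OF that] h \<delta>
        by (intro prod_mono) (auto simp: shift_ratio_nonneg)
      then show ?thesis by simp
    qed
    have lower: "(R - \<epsilon>) ^ P \<eta> \<le> top_ratio h \<delta> \<omega>" if "\<omega> \<in> G" for \<omega>
    proof -
      have "(\<Prod>k<P \<eta>. R - \<epsilon>) \<le> top_ratio h \<delta> \<omega>"
        unfolding top_ratio_def using near[OF that] \<epsilon>
        by (intro prod_mono) auto
      then show ?thesis by simp
    qed
    have cap: "top_ratio h \<delta> \<omega> \<le> C" for \<omega>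
    proof -
      have "shift_ratio c h \<delta> w \<le> sqrt 2 * exp (c\<^sup>2 * h / 2)" for w
      proof -
        have "shift_ratio c h \<delta> w \<le> sqrt ((h + \<delta>) / h) * exp (c\<^sup>2 * \<delta> / 2)" by (rule shift_ratio_le[OF h(1) \<delta>(1)])
        also have "\<dots> \<le> sqrt 2 * exp (c\<^sup>2 * h / 2)"
          using h \<delta> by (intro mult_mono) (auto simp: field_simps intro!: mult_right_mono)
        finally show ?thesis .
      qed
      then have "top_ratio h \<delta> \<omega> \<le> (\<Prod>k<P \<eta>. sqrt 2 * exp (c\<^sup>2 * h / 2))"
        unfolding top_ratio_def using h \<delta> by (intro prod_mono) (auto simp: shift_ratio_nonneg)
      then show ?thesis by (simp add: C_def)
    qed
    have bad: "prob (exceed_grid u \<eta> (h + \<delta>) (q + \<delta>) n - G) \<le> err u"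
      if q: "h < q" "q + \<delta> \<le> T - \<tau> \<eta>" for q n
    proof -
      have "prob (exceed_grid u \<eta> (h + \<delta>) (q + \<delta>) n - G)
          \<le> P \<eta> * 2 ^ P \<eta> * 2 * exp (- (u\<^sup>2 / (2 * v0)) - u\<^sup>2 * (\<rho>\<^sup>2 / (4 * h))
         + \<rho> * (u\<^sup>2 * (h + \<delta> - h)) / (2 * h * P \<eta> * v0) + u * (\<bar>c\<bar> * T / v0))"
        unfolding G_def z0_def using elim h \<delta> q \<rho> by (intro late_deviation_bound) auto
      also have "- (u\<^sup>2 / (2 * v0)) - u\<^sup>2 * (\<rho>\<^sup>2 / (4 * h)) + \<rho> * (u\<^sup>2 * (h + \<delta> - h)) / (2 * h * P \<eta> * v0) + u * (\<bar>c\<bar> * T / v0)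
          = \<rho> * D / (2 * h * P \<eta> * v0) + (- a * u\<^sup>2 + K * u)"
        by (simp add: \<delta>(3)[symmetric] a_def K_def algebra_simps)
      finally show ?thesis by (simp add: err_def A0_def exp_add mult.assoc)
    qed
    have r1: "0 \<le> (R - \<epsilon>) ^ P \<eta>" "(R - \<epsilon>) ^ P \<eta> \<le> 1"
      using \<epsilon> R by (auto intro: power_le_one)
    have "prob (exceed u \<eta> h q) \<le> (r + \<kappa>) * prob (exceed u \<eta> (h + \<delta>) (q + \<delta>)) + C * err u \<and>
      (r - \<kappa>) * prob (exceed u \<eta> (h + \<delta>) (q + \<delta>)) - C * err u \<le> prob (exceed u \<eta> h q)"
      if q: "h < q" "q + \<delta> \<le> T - \<tau> \<eta>" for q
    proof -
      have cmp: "prob (exceed u \<eta> h q) \<le> (R + \<epsilon>) ^ P \<eta> * prob (exceed u \<eta> (h + \<delta>) (q + \<delta>)) + C * err u"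
        "(R - \<epsilon>) ^ P \<eta> * (prob (exceed u \<eta> (h + \<delta>) (q + \<delta>)) - err u) \<le> prob (exceed u \<eta> h q)"
        using C r1 \<epsilon> R by (intro exceed_compare[OF h(1) q(1) \<delta>(1) G _ cap _ lower _ upper bad[OF q]]; simp)+
      have "prob (exceed u \<eta> h q) \<le> (r + \<kappa>) * prob (exceed u \<eta> (h + \<delta>) (q + \<delta>)) + C * err u"
        using cmp(1) mult_right_mono[OF \<epsilon>(3), of "prob (exceed u \<eta> (h + \<delta>) (q + \<delta>))"] by simp
      moreover have "(r - \<kappa>) * prob (exceed u \<eta> (h + \<delta>) (q + \<delta>)) - C * err u \<le> prob (exceed u \<eta> h q)"
      proof -
        have "(R - \<epsilon>) ^ P \<eta> * err u \<le> C * err u" using r1 C err[of u] by (intro mult_right_mono) auto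
        then show ?thesis
          using cmp(2) mult_right_mono[OF \<epsilon>(4), of "prob (exceed u \<eta> (h + \<delta>) (q + \<delta>))"] by (simp add: right_diff_distrib)
      qed
      ultimately show ?thesis by blast
    qed
    then show ?case by (simp add: \<delta>_def err_def mult.assoc)
  qed
  moreover have "1 / (2 * v0) < a" using h \<rho> by (simp add: a_def)
  ultimately show ?thesis by (rule that[rotated])
qed

lemma early_var_less: "i < \<eta> \<Longrightarrow> avg_var i (len i) < v0"
proof -
  assume i: "i < \<eta>"
  have "avg_var i (len i) = (\<Sum>l<Suc i. len l / P l)" by (simp add: avg_var_def)
  also have "\<dots> \<le> (\<Sum>l<\<eta>. len l / P l)"
    using i len_pos by (intro sum_mono2) (auto simp: less_imp_le)
  also have "\<dots> < v0" using tau_T P_pos[of \<eta>] by (simp add: avg_var_def)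
  finally show ?thesis .
qed

definition early_prob :: "real \<Rightarrow> real \<Rightarrow> real" where
  "early_prob h u = (\<Sum>i<\<eta>. prob (exceed u i 0 (len i))) + prob (exceed u \<eta> 0 (2 * h))"

lemma hit_less_sandwich:
  assumes u: "0 \<le> u" and s: "\<tau> \<eta> < s" "s \<le> T" and h: "0 < h" "0 < h'" "h' < 2 * h" "2 * h < s - \<tau> \<eta>"
  shows "prob (exceed u \<eta> h' (s - \<tau> \<eta>)) \<le> prob {\<omega> \<in> space M. hit u \<omega> < s}"
    and "prob {\<omega> \<in> space M. hit u \<omega> < s} \<le> prob (exceed u \<eta> h' (s - \<tau> \<eta>)) + early_prob h u"
proof -
  have H: "{\<omega> \<in> space M. hit u \<omega> < s} \<in> events" by (rule hit_less_events[OF s])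
  have E: "exceed u \<eta> h' (s - \<tau> \<eta>) \<in> events" "exceed u \<eta> 0 (2 * h) \<in> events"
    using h by (auto intro!: exceed_events)
  have Ei: "exceed u i 0 (len i) \<in> events" if "i < \<eta>" for i
    using that len_pos[of i] by (intro exceed_events) auto
  have "exceed u \<eta> h' (s - \<tau> \<eta>) \<subseteq> {\<omega> \<in> space M. hit u \<omega> < s}"
  proof
    fix \<omega> assume "\<omega> \<in> exceed u \<eta> h' (s - \<tau> \<eta>)"
    then have "\<omega> \<in> exceed u \<eta> 0 (s - \<tau> \<eta>)" "\<omega> \<in> space M"
      using h by (auto simp: exceed_def)
    then show "\<omega> \<in> {\<omega> \<in> space M. hit u \<omega> < s}"
      using hit_less_iff[OF s, of \<omega> u] by blast
  qed
  then show "prob (exceed u \<eta> h' (s - \<tau> \<eta>)) \<le> prob {\<omega> \<in> space M. hit u \<omega> < s}"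
    by (rule finite_measure_mono[OF _ H])
  let ?U = "\<Union>i<\<eta>. exceed u i 0 (len i)"
  have U: "?U \<in> events" using Ei by (intro sets.finite_UN) auto
  have "exceed u \<eta> 0 (s - \<tau> \<eta>) \<subseteq> exceed u \<eta> 0 (2 * h) \<union> exceed u \<eta> h' (s - \<tau> \<eta>)"
  proof
    fix \<omega> assume "\<omega> \<in> exceed u \<eta> 0 (s - \<tau> \<eta>)"
    then obtain r where "\<omega> \<in> space M" "0 < r" "r < s - \<tau> \<eta>" "\<forall>k<P \<eta>. u + c * (\<tau> \<eta> + r) < state \<eta> k r \<omega>"
      by (auto simp: exceed_def)
    then show "\<omega> \<in> exceed u \<eta> 0 (2 * h) \<union> exceed u \<eta> h' (s - \<tau> \<eta>)"
      using h by (cases "r < 2 * h") (auto simp: exceed_def intro!: bexI[of _ r])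
  qed
  moreover have "\<not> u < W 0 0 0 \<omega>" if "\<omega> \<in> space M" for \<omega>
    using W_0[of 0 0 \<omega>] u that by (simp add: offspring_prod_0)
  ultimately have "{\<omega> \<in> space M. hit u \<omega> < s} \<subseteq> (?U \<union> exceed u \<eta> 0 (2 * h)) \<union> exceed u \<eta> h' (s - \<tau> \<eta>)"
    using hit_less_iff[OF s, of _ u] by blast
  then have "prob {\<omega> \<in> space M. hit u \<omega> < s} \<le> prob ((?U \<union> exceed u \<eta> 0 (2 * h)) \<union> exceed u \<eta> h' (s - \<tau> \<eta>))"
    by (rule finite_measure_mono) (intro sets.Un U E)
  also have "\<dots> \<le> prob (?U \<union> exceed u \<eta> 0 (2 * h)) + prob (exceed u \<eta> h' (s - \<tau> \<eta>))"
    by (intro measure_Un_le sets.Un U E)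
  also have "prob (?U \<union> exceed u \<eta> 0 (2 * h)) \<le> prob ?U + prob (exceed u \<eta> 0 (2 * h))"
    by (intro measure_Un_le U E)
  also have "prob ?U \<le> (\<Sum>i<\<eta>. prob (exceed u i 0 (len i)))"
    by (rule finite_measure_subadditive_finite[OF finite_lessThan]) (rule image_subsetI, rule Ei, simp)
  finally show "prob {\<omega> \<in> space M. hit u \<omega> < s} \<le> prob (exceed u \<eta> h' (s - \<tau> \<eta>)) + early_prob h u"
    by (simp add: early_prob_def)
qed

text \<open>
  The probability in the denominator is at least that of exceedance at a fixed time \<open>\<tau> \<eta> + e\<close> close to \<open>T\<close>.
  Since \<open>avg_var \<eta> e\<close> tends to \<open>v0\<close> as the time tends to \<open>T\<close>, its Gaussian rate can be made smaller than \<open>a\<close>.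
\<close>

lemma negligible_gaussian:
  fixes a A K y :: real
  assumes a: "1 / (2 * v0) < a" and y: "0 < y"
  shows "((\<lambda>u. A * exp (- a * u\<^sup>2 + K * u) / prob {\<omega> \<in> space M. hit u \<omega> \<le> T - y / u\<^sup>2}) \<longlongrightarrow> 0) at_top"
    and "\<forall>\<^sub>F u in at_top. 0 < prob {\<omega> \<in> space M. hit u \<omega> \<le> T - y / u\<^sup>2}"
proof -
  have Ppos: "0 < P \<eta>" using P_pos[of \<eta>] by simp
  have apos: "0 < a" using a v0_pos by (smt (verit) zero_less_divide_1_iff)
  have av: "1 / (2 * a) < v0" using a v0_pos apos by (simp add: field_simps)
  define L where "L = T - \<tau> \<eta>"
  have L: "0 < L" using tau_T by (simp add: L_def)
  (* Small enough that the variance at time T - zeta still exceeds 1 / (2 * a). *)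
  define \<zeta> where "\<zeta> = min (L / 2) (P \<eta> * (v0 - 1 / (2 * a)) / 2)"
  have \<zeta>: "0 < \<zeta>" "\<zeta> < L" using L Ppos av by (auto simp: \<zeta>_def min_less_iff_disj)
  have "\<zeta> \<le> P \<eta> * (v0 - 1 / (2 * a)) / 2" unfolding \<zeta>_def by (rule min.cobounded2)
  then have \<zeta>3: "\<zeta> / P \<eta> \<le> (v0 - 1 / (2 * a)) / 2" using Ppos by (simp add: field_simps)
  define e where "e = L - \<zeta>"
  have e: "0 < e" "e < L" using \<zeta> by (auto simp: e_def)
  define v where "v = avg_var \<eta> e"
  have "v = v0 - \<zeta> / P \<eta>" by (simp add: v_def avg_var_def e_def L_def diff_divide_distrib)
  then have v: "1 / (2 * a) < v" using \<zeta>3 av by simp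
  have vpos: "0 < v" unfolding v_def using e by (intro avg_var_pos) auto
  have va: "1 / (2 * v) < a" using v vpos apos by (simp add: field_simps)
  obtain K1 K2 where low: "\<And>b. 0 \<le> b \<Longrightarrow>
    exp (- (b\<^sup>2 / (2 * v)) - K1 * b - K2) \<le> prob {\<omega> \<in> space M. \<forall>k<P \<eta>. b < state \<eta> k e \<omega>}"
    using level_lower_bound[OF order.refl e(1)] unfolding v_def by blast
  define C where "C = \<bar>c\<bar> * T"
  have C: "0 \<le> C" using tau_T tau_nonneg[of \<eta>] by (simp add: C_def)
  let ?H = "\<lambda>u. {\<omega> \<in> space M. hit u \<omega> \<le> T - y / u\<^sup>2}"
  have "\<forall>\<^sub>F u in at_top. y / u\<^sup>2 < L - e" using e by (intro inv_square_small) auto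
  then have ev: "\<forall>\<^sub>F u in at_top. exp (- ((u + C)\<^sup>2 / (2 * v)) - K1 * (u + C) - K2) \<le> prob (?H u)"
    using eventually_gt_at_top[of 0]
  proof eventually_elim
    case (elim u)
    have s: "\<tau> \<eta> < T - y / u\<^sup>2" "T - y / u\<^sup>2 < T" using elim e y by (auto simp: L_def)
    have "exp (- ((u + C)\<^sup>2 / (2 * v)) - K1 * (u + C) - K2) \<le> prob {\<omega> \<in> space M. \<forall>k<P \<eta>. u + C < state \<eta> k e \<omega>}"
      using elim C by (intro low) auto
    also have "\<dots> \<le> prob (?H u)"
    proof (rule finite_measure_mono[OF _ hit_le_events[OF s]], rule subsetI)
      fix \<omega> assume \<omega>: "\<omega> \<in> {\<omega> \<in> space M. \<forall>k<P \<eta>. u + C < state \<eta> k e \<omega>}"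
      have "c * (\<tau> \<eta> + e) \<le> \<bar>c\<bar> * (\<tau> \<eta> + e)"
        using e tau_nonneg[of \<eta>] by (intro mult_right_mono) auto
      also have "\<dots> \<le> C"
        unfolding C_def using e by (intro mult_left_mono) (auto simp: L_def)
      finally have "\<omega> \<in> exceed u \<eta> 0 (T - y / u\<^sup>2 - \<tau> \<eta>)"
        using \<omega> e elim by (fastforce simp: exceed_def L_def intro!: bexI[of _ e])
      then show "\<omega> \<in> ?H u"
        using hit_less_iff[of "T - y / u\<^sup>2" \<omega> u] s \<omega> by auto
    qed
    finally show ?case .
  qed
  then show "\<forall>\<^sub>F u in at_top. 0 < prob (?H u)"
    by eventually_elim (rule less_le_trans[OF exp_gt_zero])
  define \<beta> where "\<beta> = K + C / v + K1"
  define \<gamma> where "\<gamma> = C\<^sup>2 / (2 * v) + K1 * C + K2"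
  have lim: "((\<lambda>u. \<bar>A\<bar> * exp (- (a - 1 / (2 * v)) * u\<^sup>2 + \<beta> * u + \<gamma>)) \<longlongrightarrow> 0) at_top"
    using va by (intro gaussian_decay) simp
  show "((\<lambda>u. A * exp (- a * u\<^sup>2 + K * u) / prob (?H u)) \<longlongrightarrow> 0) at_top"
  proof (rule Lim_null_comparison[OF _ lim])
    show "\<forall>\<^sub>F u in at_top. norm (A * exp (- a * u\<^sup>2 + K * u) / prob (?H u)) \<le> \<bar>A\<bar> * exp (- (a - 1 / (2 * v)) * u\<^sup>2 + \<beta> * u + \<gamma>)"
      using ev
    proof eventually_elim
      case (elim u)
      have "norm (A * exp (- a * u\<^sup>2 + K * u) / prob (?H u)) = \<bar>A\<bar> * exp (- a * u\<^sup>2 + K * u) / prob (?H u)"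
        by (simp add: abs_mult)
      also have "\<dots> \<le> \<bar>A\<bar> * exp (- a * u\<^sup>2 + K * u) / exp (- ((u + C)\<^sup>2 / (2 * v)) - K1 * (u + C) - K2)"
        using elim by (intro divide_left_mono mult_pos_pos less_le_trans[OF exp_gt_zero elim]) auto
      also have "\<dots> = \<bar>A\<bar> * exp (- a * u\<^sup>2 + K * u - (- ((u + C)\<^sup>2 / (2 * v)) - K1 * (u + C) - K2))"
        by (simp add: exp_diff)
      also have "- a * u\<^sup>2 + K * u - (- ((u + C)\<^sup>2 / (2 * v)) - K1 * (u + C) - K2)
          = - (a - 1 / (2 * v)) * u\<^sup>2 + \<beta> * u + \<gamma>"
        using vpos by (simp add: \<beta>_def \<gamma>_def power2_sum field_simps)
      finally show ?case .
    qed
  qed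
qed

text \<open>
  The average has strictly smaller variance at earlier times, hence a strictly larger Gaussian rate.
\<close>

lemma negligible_early:
  assumes h: "0 < h" "2 * h < T - \<tau> \<eta>" and y: "0 < y"
  shows "((\<lambda>u. early_prob h u / prob {\<omega> \<in> space M. hit u \<omega> \<le> T - y / u\<^sup>2}) \<longlongrightarrow> 0) at_top"
proof -
  let ?H = "\<lambda>u. {\<omega> \<in> space M. hit u \<omega> \<le> T - y / u\<^sup>2}"
  have one: "((\<lambda>u. prob (exceed u i 0 e) / prob (?H u)) \<longlongrightarrow> 0) at_top"
    if i: "i \<le> \<eta>" "0 < e" "\<tau> i + e \<le> T" "avg_var i e < v0" for i e
  proof -
    define v where "v = avg_var i e"
    have v: "0 < v" unfolding v_def by (rule avg_var_pos[OF i(1,2)])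
    have "1 / (2 * v0) < 1 / (2 * v)" using i(4) v by (simp add: v_def field_simps)
    note lim = negligible_gaussian(1)[OF this y, of "2 ^ P i" "\<bar>c\<bar> * T / v"]
    show ?thesis
    proof (rule Lim_null_comparison[OF _ lim])
      show "\<forall>\<^sub>F u in at_top. norm (prob (exceed u i 0 e) / prob (?H u))
          \<le> 2 ^ P i * exp (- (1 / (2 * v)) * u\<^sup>2 + \<bar>c\<bar> * T / v * u) / prob (?H u)"
        using eventually_ge_at_top[of 0]
      proof eventually_elim
        case (elim u)
        have "prob (exceed u i 0 e) \<le> 2 ^ P i * exp (- (u\<^sup>2 / (2 * v)) + u * (\<bar>c\<bar> * T / v))"
          unfolding v_def by (rule exceed_early_bound[OF i(1-3) elim])
        also have "- (u\<^sup>2 / (2 * v)) + u * (\<bar>c\<bar> * T / v) = - (1 / (2 * v)) * u\<^sup>2 + \<bar>c\<bar> * T / v * u"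
          by simp
        finally show ?case by (simp add: divide_right_mono)
      qed
    qed
  qed
  have "((\<lambda>u. (\<Sum>i<\<eta>. prob (exceed u i 0 (len i)) / prob (?H u)) + prob (exceed u \<eta> 0 (2 * h)) / prob (?H u))
      \<longlongrightarrow> (\<Sum>i<\<eta>. 0) + 0) at_top"
  proof (intro tendsto_add tendsto_sum one early_var_less)
    show "\<tau> i + len i \<le> T" if "i \<in> {..<\<eta>}" for i
      using tau_mono[of "Suc i" \<eta>] tau_T that by (simp add: len_def)
    show "avg_var \<eta> (2 * h) < v0"
      using h P_pos[of \<eta>] by (simp add: avg_var_def divide_strict_right_mono)
  qed (use h len_pos in auto)
  then show ?thesis
    by (simp add: early_prob_def add_divide_distrib sum_divide_distrib)
qed

text \<open>
  The comparison holds for hitting before \<open>s\<close> and before \<open>s + (x - y) / u\<^sup>2\<close>, uniformly in \<open>s\<close>. Letting \<open>s\<close>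
  decrease to \<open>T - x / u\<^sup>2\<close> gives it for the closed events, whose end times are \<open>T - x / u\<^sup>2\<close> and
  \<open>T - y / u\<^sup>2\<close>. The room needed for the approximation is \<open>d = y / u\<^sup>2\<close>.
\<close>

lemma hit_ratio_limit:
  assumes y: "0 < y" and xy: "y < x"
  shows "((\<lambda>u. prob {\<omega> \<in> space M. hit u \<omega> \<le> T - x / u\<^sup>2} / prob {\<omega> \<in> space M. hit u \<omega> \<le> T - y / u\<^sup>2})
    \<longlongrightarrow> exp (- ((x - y) * P \<eta> / (2 * (mu0 T \<eta> \<tau> N)\<^sup>2)))) at_top" (is "(_ \<longlongrightarrow> ?r) _")
proof -
  let ?H = "\<lambda>z u. {\<omega> \<in> space M. hit u \<omega> \<le> T - z / u\<^sup>2}"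
  define D where "D = x - y"
  have D: "0 < D" using xy by (simp add: D_def)
  define L where "L = T - \<tau> \<eta>"
  have L: "0 < L" using tau_T by (simp add: L_def)
  (* Room for the delayed start: h + delta < 2 * h < L. *)
  define h where "h = L / 4"
  have h: "0 < h" "2 * h < T - \<tau> \<eta>" using L by (auto simp: h_def L_def)
  have r: "0 < ?r" "?r \<le> 1" using D by (auto simp: D_def)
  show ?thesis
  proof (rule tendstoI)
    fix \<epsilon> :: real assume \<epsilon>: "0 < \<epsilon>"
    define \<kappa> where "\<kappa> = min 1 (\<epsilon> / 4)"
    have \<kappa>: "0 < \<kappa>" "\<kappa> \<le> \<epsilon> / 4" using \<epsilon> by (auto simp: \<kappa>_def)
    obtain A K a where a: "1 / (2 * v0) < a" and
      cmp: "\<forall>\<^sub>F u in at_top. \<forall>q. h < q \<and> q + D / u\<^sup>2 \<le> T - \<tau> \<eta> \<longrightarrow>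
       prob (exceed u \<eta> h q) \<le> (?r + \<kappa>) * prob (exceed u \<eta> (h + D / u\<^sup>2) (q + D / u\<^sup>2)) + A * exp (- a * u\<^sup>2 + K * u) \<and>
       (?r - \<kappa>) * prob (exceed u \<eta> (h + D / u\<^sup>2) (q + D / u\<^sup>2)) - A * exp (- a * u\<^sup>2 + K * u) \<le> prob (exceed u \<eta> h q)"
      using late_comparison[OF h \<kappa>(1) D] unfolding D_def by blast
    define err where "err u = A * exp (- a * u\<^sup>2 + K * u)" for u
    have "\<forall>\<^sub>F u in at_top. dist (err u / prob (?H y u)) 0 < \<epsilon> / 4"
      unfolding err_def using \<epsilon> by (intro tendstoD[OF negligible_gaussian(1)[OF a y]]) simp
    moreover have "\<forall>\<^sub>F u in at_top. dist (early_prob h u / prob (?H y u)) 0 < \<epsilon> / 4"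
      using \<epsilon> by (intro tendstoD[OF negligible_early[OF h y]]) simp
    moreover have "\<forall>\<^sub>F u in at_top. x / u\<^sup>2 < L / 4" "\<forall>\<^sub>F u in at_top. D / u\<^sup>2 < h"
      using L h by (auto intro!: inv_square_small)
    moreover note cmp negligible_gaussian(2)[OF a y] eventually_gt_at_top[of 0]
    ultimately show "\<forall>\<^sub>F u in at_top. dist (prob (?H x u) / prob (?H y u)) ?r < \<epsilon>"
    proof eventually_elim
      case (elim u)
      define \<delta> where "\<delta> = D / u\<^sup>2"
      have u: "0 < u" and \<delta>: "0 < \<delta>" "\<delta> < h" using elim D by (auto simp: \<delta>_def)
      have E: "0 \<le> early_prob h u" by (auto simp: early_prob_def intro!: add_nonneg_nonneg sum_nonneg)
      define d where "d = y / u\<^sup>2"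
      have d: "0 < d" using y u by (simp add: d_def)
      have xd: "x / u\<^sup>2 = d + \<delta>" by (simp add: d_def \<delta>_def D_def diff_divide_distrib)
      have small: "d + \<delta> < L / 4" using elim xd by simp
      have step: "prob {\<omega> \<in> space M. hit u \<omega> < s} \<le> (?r + \<kappa>) * prob {\<omega> \<in> space M. hit u \<omega> < s + \<delta>} + (err u + early_prob h u)"
        "(?r - \<kappa>) * prob {\<omega> \<in> space M. hit u \<omega> < s + \<delta>} - (err u + early_prob h u) \<le> prob {\<omega> \<in> space M. hit u \<omega> < s}"
        if s: "T - L / 4 < s" "s + \<delta> \<le> T" for s
      proof -
        let ?p = "prob (exceed u \<eta> h (s - \<tau> \<eta>))" and ?p' = "prob (exceed u \<eta> (h + \<delta>) (s - \<tau> \<eta> + \<delta>))"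
        let ?F = "prob {\<omega> \<in> space M. hit u \<omega> < s}" and ?F' = "prob {\<omega> \<in> space M. hit u \<omega> < s + \<delta>}"
        have "\<tau> \<eta> < s" "s \<le> T" using s \<delta> L unfolding L_def by argo+
        moreover have "2 * h < s - \<tau> \<eta>" using s \<delta> L unfolding L_def h_def by argo
        ultimately have s2: "\<tau> \<eta> < s" "s \<le> T" "2 * h < s - \<tau> \<eta>" by auto
        have 1: "?p \<le> ?F" "?F \<le> ?p + early_prob h u"
          using s2 h u by (intro hit_less_sandwich[where h = h]; simp)+
        have eq: "s + \<delta> - \<tau> \<eta> = s - \<tau> \<eta> + \<delta>" by simp
        have 2: "?p' \<le> ?F'" "?F' \<le> ?p' + early_prob h u"
          using hit_less_sandwich[of u "s + \<delta>" h "h + \<delta>"] s s2 h u \<delta> by (simp_all add: eq)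
        have 3: "?p \<le> (?r + \<kappa>) * ?p' + err u" "(?r - \<kappa>) * ?p' - err u \<le> ?p"
          using elim(5) s2 s h by (auto simp: \<delta>_def err_def)
        have "(?r + \<kappa>) * ?p' \<le> (?r + \<kappa>) * ?F'" using 2 r \<kappa> by (intro mult_left_mono) auto
        then show "?F \<le> (?r + \<kappa>) * ?F' + (err u + early_prob h u)" using 1 3 by linarith
        have "?r - \<kappa> \<le> 1" using r(2) \<kappa>(1) by linarith
        then have "(?r - \<kappa>) * (?F' - ?p') \<le> 1 * (?F' - ?p')" by (rule mult_right_mono) (use 2 in simp)
        also have "\<dots> \<le> early_prob h u" using 2 by simp
        finally show "(?r - \<kappa>) * ?F' - (err u + early_prob h u) \<le> ?F" using 1 3 by (simp add: right_diff_distrib)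
      qed
      have dn: "0 < d / Suc n" "d / Suc n \<le> d" for n using d by (auto simp: field_simps)
      have limx: "(\<lambda>n. prob {\<omega> \<in> space M. hit u \<omega> < T - x / u\<^sup>2 + d / Suc n}) \<longlonglongrightarrow> prob (?H x u)"
        using small d \<delta> by (intro hit_le_limit) (auto simp: xd L_def)
      have limy: "(\<lambda>n. prob {\<omega> \<in> space M. hit u \<omega> < T - x / u\<^sup>2 + d / Suc n + \<delta>}) \<longlonglongrightarrow> prob (?H y u)"
      proof -
        have "(\<lambda>n. prob {\<omega> \<in> space M. hit u \<omega> < T - d + d / Suc n}) \<longlonglongrightarrow> prob {\<omega> \<in> space M. hit u \<omega> \<le> T - d}"
          using small d \<delta> by (intro hit_le_limit) (auto simp: L_def)
        moreover have "T - x / u\<^sup>2 + d / Suc n + \<delta> = T - d + d / Suc n" for n by (simp add: xd)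
        ultimately show ?thesis by (simp only: d_def[symmetric])
      qed
      have sn: "T - L / 4 < T - x / u\<^sup>2 + d / Suc n" "T - x / u\<^sup>2 + d / Suc n + \<delta> \<le> T" for n
        using small dn[of n] by (simp_all add: xd)
      have up: "prob (?H x u) \<le> (?r + \<kappa>) * prob (?H y u) + (err u + early_prob h u)"
        by (rule LIMSEQ_le[OF limx tendsto_add[OF tendsto_mult_left[OF limy] tendsto_const]]) (use step(1)[OF sn] in blast)
      have lo: "(?r - \<kappa>) * prob (?H y u) - (err u + early_prob h u) \<le> prob (?H x u)"
        by (rule LIMSEQ_le[OF tendsto_diff[OF tendsto_mult_left[OF limy] tendsto_const] limx]) (use step(2)[OF sn] in blast)
      have pos: "0 < prob (?H y u)" using elim by blast
      have "\<bar>prob (?H x u) / prob (?H y u) - ?r\<bar> \<le> \<kappa> + (err u / prob (?H y u) + early_prob h u / prob (?H y u))"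
        using up lo pos by (simp add: abs_le_iff field_simps)
      also have "err u / prob (?H y u) < \<epsilon> / 4"
        using elim(1) by (simp only: dist_real_def diff_0_right)
      also have "early_prob h u / prob (?H y u) < \<epsilon> / 4" using elim(2) by (simp only: dist_real_def diff_0_right)
      also have "\<kappa> + (\<epsilon> / 4 + \<epsilon> / 4) < \<epsilon>" using \<kappa> by simp
      finally show ?case by (simp add: dist_real_def)
    qed
  qed
qed

end

context brownian_tree begin

section \<open>Reduction to paths that start in zero\<close>

lemma level_at_le: "level_at \<eta> \<tau> t \<le> \<eta>"
proof (cases "\<tau> 1 < t")
  case True
  have "finite {i \<in> {1..\<eta>}. \<tau> i < t}" "{i \<in> {1..\<eta>}. \<tau> i < t} \<noteq> {}" using True eta by auto
  from Max_in[OF this] show ?thesis by (simp add: level_at_def)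
qed (simp add: level_at_def)

lemma hitting_time_cong:
  assumes W': "\<And>i k t. i \<le> \<eta> \<Longrightarrow> k < P i \<Longrightarrow> W' i k t \<omega> = W i k t \<omega>"
  shows "hitting_time T \<eta> \<tau> N W' c u \<omega> = hitting_time T \<eta> \<tau> N W c u \<omega>"
proof -
  have tree: "tree_vector \<tau> N W' i t \<omega> k = tree_vector \<tau> N W i t \<omega> k" if "i \<le> \<eta>" "k < P i" for i t k
    using that by (induction i arbitrary: t k) (auto simp: W' P_pos)
  have "branch \<eta> \<tau> N W' \<gamma> t \<omega> = branch \<eta> \<tau> N W \<gamma> t \<omega>" for \<gamma> t
    using level_at_le[of t] P_pos[of "level_at \<eta> \<tau> t"] by (simp add: branch_def Let_def tree)
  then show ?thesis by (simp add: hitting_time_def)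
qed

lemma brownian_tree_at_0_shift:
  "brownian_tree_at_0 M T \<eta> \<tau> N (\<lambda>i k t \<omega>. W i k t \<omega> - W i k 0 \<omega>)"
proof -
  let ?W = "\<lambda>i k t \<omega>. W i k t \<omega> - W i k 0 \<omega>"
  have std: "std_brownian_motion M (?W i k)" if "i \<le> \<eta>" "k < P i" for i k
  proof -
    have "continuous_on {0..} (\<lambda>t. ?W i k t \<omega>)" if "\<omega> \<in> space M" for \<omega>
      using W_continuous[OF \<open>i \<le> \<eta>\<close> \<open>k < P i\<close> that] by (intro continuous_intros)
    moreover have "?W i k t \<in> borel_measurable M" if "0 \<le> t" for t
      using W_measurable[OF \<open>i \<le> \<eta>\<close> \<open>k < P i\<close>] that by (intro borel_measurable_diff) auto
    ultimately show ?thesis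
      using bm[OF that] by (auto simp: std_brownian_motion_def)
  qed
  have "indep_vars (\<lambda>_. Pi\<^sub>M {0..} (\<lambda>_. borel)) (\<lambda>(i, k) \<omega>. \<lambda>t\<in>{0..}. W i k t \<omega>) (SIGMA i:{..\<eta>}. {..<P i})"
    using driving by (simp add: driving_brownian_motions_def)
  moreover have "(\<lambda>z. \<lambda>t\<in>{0::real..}. z t - z 0 :: real) \<in> measurable (Pi\<^sub>M {0..} (\<lambda>_. borel)) (Pi\<^sub>M {0..} (\<lambda>_. borel))"
    by (intro measurable_restrict borel_measurable_diff measurable_component_singleton) auto
  ultimately have "indep_vars (\<lambda>_. Pi\<^sub>M {0..} (\<lambda>_. borel))
      (\<lambda>p \<omega>. (\<lambda>z. \<lambda>t\<in>{0::real..}. z t - z 0 :: real) ((case p of (i, k) \<Rightarrow> \<lambda>\<omega>. \<lambda>t\<in>{0..}. W i k t \<omega>) \<omega>))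
      (SIGMA i:{..\<eta>}. {..<P i})"
    by (rule indep_vars_compose2)
  also have "(\<lambda>p \<omega>. (\<lambda>z. \<lambda>t\<in>{0::real..}. z t - z 0 :: real) ((case p of (i, k) \<Rightarrow> \<lambda>\<omega>. \<lambda>t\<in>{0..}. W i k t \<omega>) \<omega>))
      = (\<lambda>(i, k) \<omega>. \<lambda>t\<in>{0..}. ?W i k t \<omega>)"
    by (auto simp: fun_eq_iff split: prod.split)
  finally have "driving_brownian_motions M \<eta> N ?W"
    using std by (simp add: driving_brownian_motions_def)
  then show ?thesis
    by unfold_locales (use eta tau0 tau_Suc tau_T N_pos in auto)
qed

lemma AE_start_at_0: "AE \<omega> in M. \<forall>i\<le>\<eta>. \<forall>k<P i. W i k 0 \<omega> = 0"
proof -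
  have "AE \<omega> in M. \<forall>p\<in>(SIGMA i:{..\<eta>}. {..<P i}). W (fst p) (snd p) 0 \<omega> = 0"
    using bm by (subst AE_ball_countable) (auto simp: std_brownian_motion_def)
  then show ?thesis by eventually_elim auto
qed

end

section \<open>The limit theorem\<close>

theorem corollary3p7:
  fixes M :: "'a measure" and T c x y :: real and \<eta> :: nat
    and \<tau> :: "nat \<Rightarrow> real" and N :: "nat \<Rightarrow> nat"
    and W :: "nat \<Rightarrow> nat \<Rightarrow> real \<Rightarrow> 'a \<Rightarrow> real"
  assumes "prob_space M"
    and "T > 0" and "\<eta> \<ge> 1"
    and "\<tau> 0 = 0" and "\<And>i. i < \<eta> \<Longrightarrow> \<tau> i < \<tau> (Suc i)" and "\<tau> \<eta> < T"
    and "\<And>i. i \<in> {1..\<eta>} \<Longrightarrow> N i \<ge> 1"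
    and "driving_brownian_motions M \<eta> N W"
    and "0 < y" and "y < x"
  shows "((\<lambda>u. \<P>(\<omega> in M. u\<^sup>2 * (T - hitting_time T \<eta> \<tau> N W c u \<omega>) \<ge> x
                 \<bar> hitting_time T \<eta> \<tau> N W c u \<omega> \<le> T - y / u\<^sup>2))
          \<longlongrightarrow> exp (- ((x - y) * real (offspring_prod N \<eta>) / (2 * (mu0 T \<eta> \<tau> N)\<^sup>2)))) at_top"
proof -
  interpret prob_space M by fact
  interpret tree: brownian_tree M T c \<eta> \<tau> N W
    by unfold_locales (use assms in auto)
  let ?W = "\<lambda>i k t \<omega>. W i k t \<omega> - W i k 0 \<omega>"
  interpret tree0: brownian_tree_at_0 M T c \<eta> \<tau> N ?W
    by (rule tree.brownian_tree_at_0_shift)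
  have same: "AE \<omega> in M. \<forall>u. hitting_time T \<eta> \<tau> N ?W c u \<omega> = hitting_time T \<eta> \<tau> N W c u \<omega>"
    using tree.AE_start_at_0 by eventually_elim (auto intro: tree.hitting_time_cong)
  have "\<forall>\<^sub>F u in at_top. x / u\<^sup>2 < T - \<tau> \<eta>"
    using assms by (intro inv_square_small) auto
  then have "\<forall>\<^sub>F u in at_top.
      prob {\<omega> \<in> space M. hitting_time T \<eta> \<tau> N ?W c u \<omega> \<le> T - x / u\<^sup>2}
        / prob {\<omega> \<in> space M. hitting_time T \<eta> \<tau> N ?W c u \<omega> \<le> T - y / u\<^sup>2}
      = \<P>(\<omega> in M. u\<^sup>2 * (T - hitting_time T \<eta> \<tau> N W c u \<omega>) \<ge> x
                 \<bar> hitting_time T \<eta> \<tau> N W c u \<omega> \<le> T - y / u\<^sup>2)"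
    using eventually_gt_at_top[of 0]
  proof eventually_elim
    case (elim u)
    have yx: "y / u\<^sup>2 < x / u\<^sup>2" using elim assms by (simp add: divide_strict_right_mono)
    have eq: "prob {\<omega> \<in> space M. hitting_time T \<eta> \<tau> N ?W c u \<omega> \<le> T - z / u\<^sup>2}
        = prob {\<omega> \<in> space M. hitting_time T \<eta> \<tau> N W c u \<omega> \<le> T - z / u\<^sup>2}"
      if z: "z / u\<^sup>2 < T - \<tau> \<eta>" "0 < z" for z
    proof (rule finite_measure_eq_AE)
      show "AE \<omega> in M. (\<omega> \<in> {\<omega> \<in> space M. hitting_time T \<eta> \<tau> N ?W c u \<omega> \<le> T - z / u\<^sup>2})
          \<longleftrightarrow> (\<omega> \<in> {\<omega> \<in> space M. hitting_time T \<eta> \<tau> N W c u \<omega> \<le> T - z / u\<^sup>2})"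
        using same by eventually_elim simp
    qed (use z elim in \<open>auto intro!: tree.hit_le_events tree0.hit_le_events\<close>)
    have "x \<le> u\<^sup>2 * (T - s) \<and> s \<le> T - y / u\<^sup>2 \<longleftrightarrow> s \<le> T - x / u\<^sup>2" for s
      using elim yx by (auto simp: field_simps)
    then show ?case
      using elim yx assms by (simp add: cond_prob_def eq)
  qed
  with tree0.hit_ratio_limit[OF assms(9,10)] show ?thesis
    by (rule Lim_transform_eventually)
qed

end
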